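(* Let $\Gamma$ be a non-elementary, torsion-free, convex cocompact discrete subgroup of $G=\mathrm{PSL}_2(\mathbb{C})$ with critical exponent $\delta$, and let $X=\Gamma\backslash G$. If $\delta>1$, then the action of $U$ on $X$ by right translations is conservative for $m^{\mathrm{BR}}$.
   Context: $G=\mathrm{PSL}_2(\mathbb{C})$ acts on $\partial\mathbb{H}^3=\mathbb{C}\cup\{\infty\}$ by Möbius transformations and on $\mathbb{H}^3=\{z+jy: z\in\mathbb{C},\,y>0\}$ by orientation preserving isometries; $d$ is the hyperbolic distance, $o=j$, $K=\mathrm{PSU}(2)$ is the stabilizer of $o$. Put $a_s=\mathrm{diag}(e^{s/2},e^{-s/2})$, $A=\{a_s\}$, $n_z=\begin{pmatrix}1&0\\ z&1\end{pmatrix}$, $N=\{n_z:z\in\mathbb{C}\}$, $u_t=n_t$ and $U=\{u_t: t\in\mathbb{R}\}$. $M$ is the centralizer of $A$ in $K$, with probability Haar measure $dm$. Conservativity: for a locally finite $U$-invariant measure $\mu$ on $X$, the $U$-action is conservative for $\mu$ if one of the following equivalent conditions holds: (1) for every positive Borel function $\psi$ on $X$, $\int_{\mathbb{R}}\psi(xu_t)\,dt=\infty$ for $\mu$-a.e. $x\in X$; (2) for any Borel subset $B\subset X$ with $\mu(B)>0$, $\int_{\mathbb{R}}\chi_B(xu_t)\,dt=\infty$ for $\mu$-a.e. $x\in B$. $\Lambda(\Gamma)$ is the limit set, $\delta$ the critical exponent of $\Gamma$ (abscissa of convergence of $\sum_{\gamma\in\Gamma}e^{-s\,d(o,\gamma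 o)}$). $\Gamma$ is convex cocompact if its convex core (quotient by $\Gamma$ of the convex hull of $\Lambda(\Gamma)$) is compact; non-elementary means not virtually abelian. Patterson–Sullivan density: the family $\{\nu_x:x\in\mathbb{H}^3\}$, unique up to a common scalar, of nonzero finite Borel measures on $\partial\mathbb{H}^3$ supported on $\Lambda(\Gamma)$ with $\gamma_*\nu_x=\nu_{\gamma x}$ for $\gamma\in\Gamma$ and $\frac{d\nu_y}{d\nu_x}(\xi)=e^{-\delta\beta_\xi(y,x)}$, where $\beta_\xi(x,y)=\lim_{s\to\infty}(d(x,\xi_s)-d(y,\xi_s))$ for a geodesic ray $\xi_s$ tending to $\xi$. Lift $\nu_o$ to $K$: $\int_K\psi\,d\nu_o=\int_{\partial\mathbb{H}^3}\int_M\psi(k_\xi m)\,dm\,d\nu_o(\xi)$, where $k_\xi\in K$ satisfies $k_\xi(0)=\xi$. Burger–Roblin measure: for $\psi\in C_c(G)$, $\tilde m^{\mathrm{BR}}(\psi)=\int_{K}\int_{\mathbb{R}}\int_{\mathbb{C}}\psi(ka_sn_z)e^{-\delta s}\,dz\,ds\,d\nu_o(k)$; it is left $\Gamma$-invariant and right $N$-invariant, and $m^{\mathrm{BR}}$ is the induced locally finite measure on $X$: $m^{\mathrm{BR}}(\Psi)=\tilde m^{\mathrm{BR}}(\psi)$ if $\Psi(\Gamma g)=\sum_{\gamma\in\Gamma}\psi(\gamma g)$. *)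

theory Defs
  imports "HOL-Probability.Probability_Measure" "HOL-Algebra.Coset"
begin

section \<open>Generic topology\<close>

definition quotient_top :: "'a topology \<Rightarrow> ('a \<Rightarrow> 'b) \<Rightarrow> 'b topology" where
  "quotient_top X f =
     topology (\<lambda>U. U \<subseteq> f ` topspace X \<and> openin X {x \<in> topspace X. f x \<in> U})"

lemma openin_quotient_top:
  "openin (quotient_top X f) U \<longleftrightarrow>
     U \<subseteq> f ` topspace X \<and> openin X {x \<in> topspace X. f x \<in> U}"
proof -
  let ?P = "\<lambda>U. U \<subseteq> f ` topspace X \<and> openin X {x \<in> topspace X. f x \<in> U}"
  have "?P (S \<inter> T)" if "?P S" "?P T" for S T
  proof -
    have "{x \<in> topspace X. f x \<in> S \<inter> T} =
        {x \<in> topspace X. f x \<in> S} \<inter> {x \<in> topspace X. f x \<in> T}"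
      by auto
    then show ?thesis using that openin_Int by fastforce
  qed
  moreover have "?P (\<Union>\<K>)" if "\<forall>S\<in>\<K>. ?P S" for \<K>
  proof -
    have "{x \<in> topspace X. f x \<in> \<Union>\<K>} = \<Union> ((\<lambda>S. {x \<in> topspace X. f x \<in> S}) ` \<K>)"
      by auto
    moreover have "openin X (\<Union> ((\<lambda>S. {x \<in> topspace X. f x \<in> S}) ` \<K>))"
      using that by (intro openin_Union) auto
    moreover have "\<Union>\<K> \<subseteq> f ` topspace X"
      using that by (intro Union_least) simp
    ultimately show ?thesis by (simp only: simp_thms)
  qed
  ultimately have "istopology ?P"
    by (simp add: istopology_def)
  then show ?thesis
    unfolding quotient_top_def by (simp only: topology_inverse')
qed

lemma topspace_quotient_top [simp]: "topspace (quotient_top X f) = f ` topspace X"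
proof (rule antisym)
  have "openin (quotient_top X f) (topspace (quotient_top X f))" by (rule openin_topspace)
  then show "topspace (quotient_top X f) \<subseteq> f ` topspace X"
    by (simp only: openin_quotient_top)
  have "{x \<in> topspace X. f x \<in> f ` topspace X} = topspace X" by auto
  then show "f ` topspace X \<subseteq> topspace (quotient_top X f)"
    by (intro openin_subset) (simp add: openin_quotient_top)
qed

lemma quotient_map_quotient_top: "quotient_map X (quotient_top X f) f"
  unfolding quotient_map_def topspace_quotient_top by (simp add: openin_quotient_top)

definition borel_of_top :: "'a topology \<Rightarrow> 'a measure" where
  "borel_of_top X = sigma (topspace X) {U. openin X U}"

definition locally_finite_measure :: "'a topology \<Rightarrow> 'a measure \<Rightarrow> bool" where
  "locally_finite_measure X \<mu> \<longleftrightarrow> (\<forall>x\<in>topspace X. \<exists>U. openin X U \<and> x \<in> U \<and> emeasure \<mu> U < \<infinity>)"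

section \<open>The topological group of Moebius transformations\<close>

definition mat2 :: "complex \<Rightarrow> complex \<Rightarrow> complex \<Rightarrow> complex \<Rightarrow> complex^2^2" where
  "mat2 a b c d = vector [vector [a, b], vector [c, d]]"

lemma mat2_nth [simp]:
  "mat2 a b c d $ 1 $ 1 = a" "mat2 a b c d $ 1 $ 2 = b"
  "mat2 a b c d $ 2 $ 1 = c" "mat2 a b c d $ 2 $ 2 = d"
  by (simp_all add: mat2_def)

definition psl_rel :: "complex^2^2 \<Rightarrow> complex^2^2 \<Rightarrow> bool" where
  "psl_rel A B \<longleftrightarrow> det A = 1 \<and> det B = 1 \<and> (A = B \<or> A = - B)"

lemma det_uminus_2: "det (- A) = det A" for A :: "complex^2^2"
  by (simp add: det_2)

quotient_type psl2c = "complex^2^2" / partial: psl_rel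
proof (rule part_equivpI)
  show "\<exists>x. psl_rel x x"
    by (rule exI[of _ "mat 1"]) (simp add: psl_rel_def)
  show "symp psl_rel"
    by (auto simp: symp_def psl_rel_def)
  show "transp psl_rel"
    by (auto simp: transp_def psl_rel_def)
qed

instantiation psl2c :: topological_space
begin

definition open_psl2c :: "psl2c set \<Rightarrow> bool" where
  "open_psl2c U \<longleftrightarrow> openin (quotient_top (top_of_set {A. det A = 1}) abs_psl2c) U"

instance
proof
  have "A \<in> abs_psl2c ` {A. det A = 1}" for A
    by (induct A) (auto simp: psl_rel_def)
  then have *: "topspace (quotient_top (top_of_set {A. det A = 1}) abs_psl2c) = UNIV"
    by auto
  show "open (UNIV :: psl2c set)"
    unfolding open_psl2c_def by (metis * openin_topspace)
qed (auto simp: open_psl2c_def)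

end

lift_definition psl_one :: psl2c is "mat 1 :: complex^2^2"
  by (simp add: psl_rel_def)

lift_definition psl_mult :: "psl2c \<Rightarrow> psl2c \<Rightarrow> psl2c" is "(**) :: complex^2^2 \<Rightarrow> complex^2^2 \<Rightarrow> complex^2^2"
proof -
  have 1: "(- A) ** B = - (A ** B)" "A ** (- B) = - (A ** B)" for A B :: "complex^2^2"
    by (simp_all add: vec_eq_iff matrix_matrix_mult_def sum_negf)
  show "\<And>A B C D. psl_rel A B \<Longrightarrow> psl_rel C D \<Longrightarrow> psl_rel (A ** C) (B ** D)"
    by (auto simp: psl_rel_def det_mul 1)
qed

definition PSL2C :: "psl2c monoid" where
  "PSL2C = \<lparr>carrier = UNIV, mult = psl_mult, one = psl_one\<rparr>"

lemma PSL2C_simps [simp]: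
  "carrier PSL2C = UNIV" "x \<otimes>\<^bsub>PSL2C\<^esub> y = psl_mult x y" "\<one>\<^bsub>PSL2C\<^esub> = psl_one"
  by (simp_all add: PSL2C_def)

lemma group_PSL2C: "group PSL2C"
proof (rule groupI)
  fix x y z :: psl2c
  show "x \<otimes>\<^bsub>PSL2C\<^esub> y \<otimes>\<^bsub>PSL2C\<^esub> z = x \<otimes>\<^bsub>PSL2C\<^esub> (y \<otimes>\<^bsub>PSL2C\<^esub> z)"
    by (simp, transfer) (simp add: psl_rel_def det_mul matrix_mul_assoc)
  show "\<one>\<^bsub>PSL2C\<^esub> \<otimes>\<^bsub>PSL2C\<^esub> x = x"
    by (simp, transfer) (simp add: psl_rel_def)
  have "\<exists>y. psl_mult y x = psl_one"
  proof (transfer)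
    fix A :: "complex^2^2" assume "psl_rel A A"
    then have d: "det A = 1" by (simp add: psl_rel_def)
    define B where "B = mat2 (A$2$2) (- A$1$2) (- A$2$1) (A$1$1)"
    have "B ** A = mat 1" using d
      by (simp add: B_def vec_eq_iff forall_2 matrix_matrix_mult_def sum_2 mat_def det_2 algebra_simps)
    moreover have "det B = 1" using d by (simp add: B_def det_2 algebra_simps)
    ultimately show "\<exists>y\<in>{x. psl_rel x x}. psl_rel (y ** A) (mat 1)"
      by (auto simp: psl_rel_def intro!: bexI[of _ B])
  qed
  then show "\<exists>y\<in>carrier PSL2C. y \<otimes>\<^bsub>PSL2C\<^esub> x = \<one>\<^bsub>PSL2C\<^esub>"
    by simp
qed auto

definition a_elt :: "real \<Rightarrow> psl2c" where
  "a_elt s = abs_psl2c (mat2 (of_real (exp (s/2))) 0 0 (of_real (exp (- s/2))))"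

definition n_elt :: "complex \<Rightarrow> psl2c" where
  "n_elt z = abs_psl2c (mat2 1 0 z 1)"

definition u_elt :: "real \<Rightarrow> psl2c" where
  "u_elt t = n_elt (of_real t)"

definition Cc_G :: "(psl2c \<Rightarrow> real) set" where
  "Cc_G = {\<psi>. continuous_on UNIV \<psi> \<and> compact (closure {g. \<psi> g \<noteq> 0})}"

section \<open>Hyperbolic space and its boundary\<close>

text \<open>The point \<open>z + jy\<close> of the upper half-space is the pair \<open>(z, y)\<close>; the boundary point at
  infinity is \<^term>\<open>None\<close>.\<close>

definition H3 :: "(complex \<times> real) set" where
  "H3 = {p. snd p > 0}"

definition base_pt :: "complex \<times> real" where
  "base_pt = (0, 1)"

definition hdist :: "complex \<times> real \<Rightarrow> complex \<times> real \<Rightarrow> real" where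
  "hdist p q = arcosh (1 + ((cmod (fst p - fst q))\<^sup>2 + (snd p - snd q)\<^sup>2) / (2 * snd p * snd q))"

text \<open>The Poincare extension \<open>q \<mapsto> (aq + b)(cq + d)\<^sup>-\<^sup>1\<close>, computed in the quaternions at \<open>q = z + jy\<close>.\<close>

definition hact_mat :: "complex^2^2 \<Rightarrow> complex \<times> real \<Rightarrow> complex \<times> real" where
  "hact_mat A = (\<lambda>(z, y).
     let a = A$1$1; b = A$1$2; c = A$2$1; d = A$2$2;
         D = (cmod (c * z + d))\<^sup>2 + (cmod c)\<^sup>2 * y\<^sup>2
     in (((a * z + b) * cnj (c * z + d) + a * cnj c * of_real (y\<^sup>2)) / of_real D, y / D))"

lemma hact_mat_uminus: "hact_mat (- A) = hact_mat A"
proof (rule ext, clarify)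
  fix z :: complex and y :: real
  have *: "(- A)$i$1 * z + (- A)$i$2 = - (A$i$1 * z + A$i$2)" for i
    by simp
  show "hact_mat (- A) (z, y) = hact_mat A (z, y)"
    unfolding hact_mat_def Let_def prod.case *
    by (simp only: norm_minus_cancel complex_cnj_minus vector_uminus_component
        mult_minus_left mult_minus_right minus_minus)
qed

lift_definition hact :: "psl2c \<Rightarrow> complex \<times> real \<Rightarrow> complex \<times> real" is hact_mat
  by (auto simp: psl_rel_def hact_mat_uminus)

definition moebius_mat :: "complex^2^2 \<Rightarrow> complex option \<Rightarrow> complex option" where
  "moebius_mat A \<xi> =
     (let a = A$1$1; b = A$1$2; c = A$2$1; d = A$2$2 in
      case \<xi> of
        None \<Rightarrow> if c = 0 then None else Some (a / c)
      | Some z \<Rightarrow> if c * z + d = 0 then None else Some ((a * z + b) / (c * z + d)))"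

lemma moebius_mat_uminus: "moebius_mat (- A) = moebius_mat A"
proof
  fix \<xi>
  have *: "(- A)$i$1 * z + (- A)$i$2 = - (A$i$1 * z + A$i$2)" for i z
    by simp
  show "moebius_mat (- A) \<xi> = moebius_mat A \<xi>"
    unfolding moebius_mat_def Let_def *
    by (simp only: vector_uminus_component minus_divide_divide neg_equal_0_iff_equal)
qed

lift_definition moebius :: "psl2c \<Rightarrow> complex option \<Rightarrow> complex option" is moebius_mat
  by (auto simp: psl_rel_def moebius_mat_uminus)

definition bdry_top :: "complex option topology" where
  "bdry_top = Alexandroff_compactification euclidean"

text \<open>\<open>\<H>\<^sup>3 \<union> \<partial>\<H>\<^sup>3\<close> is the one-point compactification of the closed half-space.\<close>

definition H3_closure_top :: "(complex \<times> real) option topology" where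
  "H3_closure_top = Alexandroff_compactification (top_of_set {p. snd p \<ge> 0})"

definition bdry_pt :: "complex option \<Rightarrow> (complex \<times> real) option" where
  "bdry_pt = map_option (\<lambda>z. (z, 0))"

definition tends_to_bdry :: "('a \<Rightarrow> complex \<times> real) \<Rightarrow> complex option \<Rightarrow> 'a filter \<Rightarrow> bool" where
  "tends_to_bdry f \<xi> F \<longleftrightarrow> limitin H3_closure_top (\<lambda>x. Some (f x)) (bdry_pt \<xi>) F"

definition hgeodesic :: "real set \<Rightarrow> (real \<Rightarrow> complex \<times> real) \<Rightarrow> bool" where
  "hgeodesic I c \<longleftrightarrow> c ` I \<subseteq> H3 \<and> (\<forall>s\<in>I. \<forall>t\<in>I. hdist (c s) (c t) = \<bar>s - t\<bar>)"

definition hconvex :: "(complex \<times> real) set \<Rightarrow> bool" where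
  "hconvex C \<longleftrightarrow> C \<subseteq> H3 \<and>
     (\<forall>a b c. a \<le> b \<and> hgeodesic {a..b} c \<and> c a \<in> C \<and> c b \<in> C \<longrightarrow> c ` {a..b} \<subseteq> C)"

text \<open>The convex hull of a subset of the boundary: the smallest convex subset of \<open>\<H>\<^sup>3\<close> containing
  all complete geodesics with both endpoints in that subset.\<close>

definition hconvex_hull :: "complex option set \<Rightarrow> (complex \<times> real) set" where
  "hconvex_hull L = \<Inter> {C. hconvex C \<and>
     (\<forall>c. hgeodesic UNIV c \<and> (\<exists>\<xi>\<in>L. tends_to_bdry c \<xi> at_bot) \<and> (\<exists>\<eta>\<in>L. tends_to_bdry c \<eta> at_top)
          \<longrightarrow> range c \<subseteq> C)}"

definition busemann :: "complex option \<Rightarrow> complex \<times> real \<Rightarrow> complex \<times> real \<Rightarrow> real" where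
  "busemann \<xi> x y = (THE b. \<forall>r. hgeodesic {0..} r \<and> tends_to_bdry r \<xi> at_top \<longrightarrow>
      ((\<lambda>s. hdist x (r s) - hdist y (r s)) \<longlongrightarrow> b) at_top)"

section \<open>Kleinian groups\<close>

definition discrete_subgroup :: "psl2c set \<Rightarrow> bool" where
  "discrete_subgroup \<Gamma> \<longleftrightarrow> subgroup \<Gamma> PSL2C \<and> discrete \<Gamma>"

definition torsion_free :: "psl2c set \<Rightarrow> bool" where
  "torsion_free \<Gamma> \<longleftrightarrow>
     (\<forall>\<gamma>\<in>\<Gamma>. \<gamma> \<noteq> \<one>\<^bsub>PSL2C\<^esub> \<longrightarrow> (\<forall>n::nat. n > 0 \<longrightarrow> \<gamma> [^]\<^bsub>PSL2C\<^esub> n \<noteq> \<one>\<^bsub>PSL2C\<^esub>))"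

definition virtually_abelian :: "('a, 'b) monoid_scheme \<Rightarrow> bool" where
  "virtually_abelian G \<longleftrightarrow>
     (\<exists>H. subgroup H G \<and> finite (rcosets\<^bsub>G\<^esub> H) \<and> comm_group (G\<lparr>carrier := H\<rparr>))"

definition non_elementary :: "psl2c set \<Rightarrow> bool" where
  "non_elementary \<Gamma> \<longleftrightarrow> \<not> virtually_abelian (PSL2C\<lparr>carrier := \<Gamma>\<rparr>)"

definition horbit :: "psl2c set \<Rightarrow> complex \<times> real \<Rightarrow> (complex \<times> real) set" where
  "horbit \<Gamma> p = (\<lambda>\<gamma>. hact \<gamma> p) ` \<Gamma>"

definition limit_set :: "psl2c set \<Rightarrow> complex option set" where
  "limit_set \<Gamma> = {\<xi>. bdry_pt \<xi> \<in> H3_closure_top derived_set_of (Some ` horbit \<Gamma> base_pt)}"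

definition convex_core_top :: "psl2c set \<Rightarrow> (complex \<times> real) set topology" where
  "convex_core_top \<Gamma> = quotient_top (top_of_set (hconvex_hull (limit_set \<Gamma>))) (horbit \<Gamma>)"

definition convex_cocompact :: "psl2c set \<Rightarrow> bool" where
  "convex_cocompact \<Gamma> \<longleftrightarrow> compact_space (convex_core_top \<Gamma>)"

text \<open>For a non-elementary discrete group the set below is non-empty and bounded below, so that the
  infimum in the reals is the abscissa of convergence.\<close>

definition critical_exponent :: "psl2c set \<Rightarrow> real" where
  "critical_exponent \<Gamma> = Inf {s. (\<lambda>\<gamma>. exp (- s * hdist base_pt (hact \<gamma> base_pt))) summable_on \<Gamma>}"

definition PS_density :: "psl2c set \<Rightarrow> (complex \<times> real \<Rightarrow> complex option measure) \<Rightarrow> bool" where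
  "PS_density \<Gamma> \<nu> \<longleftrightarrow>
     (\<forall>x\<in>H3. sets (\<nu> x) = sets (borel_of_top bdry_top) \<and> finite_measure (\<nu> x) \<and>
        emeasure (\<nu> x) UNIV \<noteq> 0 \<and> emeasure (\<nu> x) (- limit_set \<Gamma>) = 0) \<and>
     (\<forall>\<gamma>\<in>\<Gamma>. \<forall>x\<in>H3. distr (\<nu> x) (borel_of_top bdry_top) (moebius \<gamma>) = \<nu> (hact \<gamma> x)) \<and>
     (\<forall>x\<in>H3. \<forall>y\<in>H3.
        \<nu> y = density (\<nu> x) (\<lambda>\<xi>. ennreal (exp (- critical_exponent \<Gamma> * busemann \<xi> y x))))"

section \<open>The Burger--Roblin measure\<close>

definition K_grp :: "psl2c set" where
  "K_grp = {k. hact k base_pt = base_pt}"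

definition M_grp :: "psl2c set" where
  "M_grp = {m \<in> K_grp. \<forall>s. m \<otimes>\<^bsub>PSL2C\<^esub> a_elt s = a_elt s \<otimes>\<^bsub>PSL2C\<^esub> m}"

definition haar_M :: "psl2c measure" where
  "haar_M = (THE \<mu>. sets \<mu> = sets (restrict_space borel M_grp) \<and> prob_space \<mu> \<and>
     (\<forall>h\<in>M_grp. distr \<mu> \<mu> (\<lambda>m. h \<otimes>\<^bsub>PSL2C\<^esub> m) = \<mu>))"

text \<open>A choice of \<open>k\<^sub>\<xi>\<close>; it is determined up to right multiplication by \<^const>\<open>M_grp\<close>, so
  the integral below does not depend on it.\<close>

definition k_rep :: "complex option \<Rightarrow> psl2c" where
  "k_rep \<xi> = (SOME k. k \<in> K_grp \<and> moebius k (Some 0) = \<xi>)"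

definition int_K :: "complex option measure \<Rightarrow> (psl2c \<Rightarrow> real) \<Rightarrow> real" where
  "int_K \<nu>\<^sub>o \<phi> = (\<integral>\<xi>. (\<integral>m. \<phi> (k_rep \<xi> \<otimes>\<^bsub>PSL2C\<^esub> m) \<partial>haar_M) \<partial>\<nu>\<^sub>o)"

definition BR_lift :: "real \<Rightarrow> complex option measure \<Rightarrow> (psl2c \<Rightarrow> real) \<Rightarrow> real" where
  "BR_lift \<delta> \<nu>\<^sub>o \<psi> =
     int_K \<nu>\<^sub>o (\<lambda>k. \<integral>s. (\<integral>z. \<psi> (k \<otimes>\<^bsub>PSL2C\<^esub> a_elt s \<otimes>\<^bsub>PSL2C\<^esub> n_elt z) * exp (- \<delta> * s)
       \<partial>(lborel :: complex measure)) \<partial>(lborel :: real measure))"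

text \<open>Points of \<open>X = \<Gamma>\G\<close> are the right cosets \<open>\<Gamma>g\<close>.\<close>

definition X_top :: "psl2c set \<Rightarrow> psl2c set topology" where
  "X_top \<Gamma> = quotient_top euclidean (\<lambda>g. \<Gamma> #>\<^bsub>PSL2C\<^esub> g)"

lemma topspace_X_top: "topspace (X_top \<Gamma>) = rcosets\<^bsub>PSL2C\<^esub> \<Gamma>"
  by (auto simp: X_top_def RCOSETS_def)

text \<open>For \<open>\<psi> \<in> C\<^sub>c(G)\<close> the sum over \<open>\<Gamma>\<close> has only finitely many non-zero terms.\<close>

definition is_BR_measure ::
  "psl2c set \<Rightarrow> (complex \<times> real \<Rightarrow> complex option measure) \<Rightarrow> psl2c set measure \<Rightarrow> bool" where
  "is_BR_measure \<Gamma> \<nu> \<mu> \<longleftrightarrow>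
     sets \<mu> = sets (borel_of_top (X_top \<Gamma>)) \<and> locally_finite_measure (X_top \<Gamma>) \<mu> \<and>
     (\<forall>\<psi>\<in>Cc_G. \<forall>\<Psi> :: psl2c set \<Rightarrow> real.
        (\<forall>g. \<Psi> (\<Gamma> #>\<^bsub>PSL2C\<^esub> g) = (\<Sum>\<^sub>\<infinity>\<gamma>\<in>\<Gamma>. \<psi> (\<gamma> \<otimes>\<^bsub>PSL2C\<^esub> g))) \<longrightarrow>
        (\<integral>x. \<Psi> x \<partial>\<mu>) = BR_lift (critical_exponent \<Gamma>) (\<nu> base_pt) \<psi>)"

text \<open>Every positive-measure Borel set is recurrent along almost every orbit starting in it. For
  \<open>U\<close>-invariant locally finite \<open>\<mu>\<close> this is equivalent to \<open>\<integral>\<psi>(xu\<^sub>t) dt = \<infinity>\<close> almost everywhere for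
  every positive Borel \<open>\<psi>\<close>. For \<open>x = \<Gamma>g\<close>, the coset product \<open>x #> u_elt t\<close> is \<open>\<Gamma>gu\<^sub>t\<close>.\<close>

definition U_conservative :: "psl2c set measure \<Rightarrow> bool" where
  "U_conservative \<mu> \<longleftrightarrow>
     (\<forall>B\<in>sets \<mu>. emeasure \<mu> B > 0 \<longrightarrow>
        (AE x in \<mu>. x \<in> B \<longrightarrow>
           (\<integral>\<^sup>+t. indicator B (x #>\<^bsub>PSL2C\<^esub> u_elt t) \<partial>(lborel :: real measure)) = \<infinity>))"

end

theory Submission
  imports Defs
begin

text \<open>
  Let \<open>Y\<close> be a set of points \<open>x\<close> whose backward orbit \<open>x a\<^sub>-\<^sub>s\<close> stays in a compact set and assume that
  every \<open>U\<close>-orbit spends time at most \<open>T\<close> in \<open>Y\<close>. Slicing the square of side \<open>2R\<close> in \<open>N = \<complex>\<close> by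
  lines parallel to \<open>U\<close> shows that an \<open>N\<close>-orbit meets \<open>Y\<close> in area at most \<open>2RT\<close> inside every such
  square. Integrate this bound for \<open>R = exp s\<close> against \<open>\<chi>(x a\<^sub>-\<^sub>s)\<close>, where \<open>\<chi>\<close> is the indicator of a
  large compact set. As \<open>n\<^sub>z a\<^sub>-\<^sub>s = a\<^sub>-\<^sub>s n\<^sub>w\<close> with \<open>w = z / R\<close> in the unit square, the
  \<open>N\<close>-invariance of the measure bounds the result below by \<open>4R\<^sup>2 \<mu>(Y)\<close>, while its scaling under \<open>A\<close>
  bounds it above by a multiple of \<open>R exp ((2 - \<delta>) s)\<close>. Hence \<open>\<mu>(Y)\<close> is at most a multiple of
  \<open>exp ((1 - \<delta>) s)\<close> for all \<open>s\<close>, and \<open>\<mu>(Y) = 0\<close> because \<open>\<delta> > 1\<close>.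

  Almost every \<open>x = \<Gamma>g\<close> has \<open>g(0)\<close> in the limit set, and then the ray \<open>g a\<^sub>-\<^sub>s\<close> is asymptotic to a
  geodesic between two limit points, which lies in the convex hull; so convex cocompactness keeps
  \<open>x a\<^sub>-\<^sub>s\<close> in a compact set. A second limit point exists, since otherwise the conformal density
  would force all of \<open>\<Gamma>\<close> to fix one boundary point and its horospheres, making \<open>\<Gamma>\<close> abelian.
\<close>

section \<open>The matrix group and its quotient topology\<close>

text \<open>The measure is known only through Bochner integrals of compactly supported test
  functions, and that description asserts no integrability. The laws under N and A are therefore
  proved for \<open>BR_lift\<close>, as changes of variable that respect the convention that a
  non-integrable function has integral 0. They reach the measure through open sets on which the
  projection to X is injective, where indicators are limits of test functions. The factor under a_t
  has two sources: a_t rescales the complex coordinate by exp t, hence area by exp (2 t), and it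
  shifts the weight exp (- \<delta> s). Together they give exp ((\<delta> - 2) t). A strip bound of
  order R against an area of order R^2 then gains one factor exp s over exp ((2 - \<delta>) s),
  which is decisive exactly for \<delta> > 1. The compact set that holds a backward orbit depends on
  the point, so the transient part of a Borel set is cut into countably many pieces with a uniform
  compact set and a uniform time bound. Haar measure on M and the Busemann function are definite
  descriptions: they carry information only after existence and uniqueness, which explicit formulas
  supply.\<close>

definition SL :: "(complex^2^2) set" where "SL = {A. det A = 1}"

lemma SL_iff: "A \<in> SL \<longleftrightarrow> A$1$1 * A$2$2 - A$1$2 * A$2$1 = 1"
  by (simp add: SL_def det_2)

lemma SL_rel: "A \<in> SL \<longleftrightarrow> psl_rel A A"
  by (auto simp: SL_def psl_rel_def)

lemma SL_mult: "A \<in> SL \<Longrightarrow> B \<in> SL \<Longrightarrow> A ** B \<in> SL"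
  by (simp add: SL_def det_mul)

lemma SL_uminus [simp]: "- A \<in> SL \<longleftrightarrow> A \<in> SL"
  by (simp add: SL_def det_uminus_2)

lemma SL_one: "mat 1 \<in> SL"
  by (simp add: SL_def)

lemma SL_mat2: "mat2 a b c d \<in> SL \<longleftrightarrow> a * d - b * c = 1"
  by (simp add: SL_iff)

lemma abs_eq_iff: "A \<in> SL \<Longrightarrow> B \<in> SL \<Longrightarrow> abs_psl2c A = abs_psl2c B \<longleftrightarrow> A = B \<or> A = - B"
  using Quotient_rel[OF Quotient_psl2c, of A B] by (auto simp: SL_def psl_rel_def)

lemma abs_cases:
  obtains A where "A \<in> SL" "g = abs_psl2c A"
  by (metis Quotient_psl2c Quotient_rep_reflp Quotient_abs_rep SL_rel)

lemma abs_mult: "A \<in> SL \<Longrightarrow> B \<in> SL \<Longrightarrow> psl_mult (abs_psl2c A) (abs_psl2c B) = abs_psl2c (A ** B)"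
  by (simp add: psl_mult.abs_eq SL_rel)

lemma abs_uminus: "A \<in> SL \<Longrightarrow> abs_psl2c (- A) = abs_psl2c A"
  by (simp add: abs_eq_iff)

lemma psl_one_abs: "psl_one = abs_psl2c (mat 1)"
  by (simp add: psl_one_def)

lemma mat_eq_2: "(A :: complex^2^2) = B \<longleftrightarrow>
    A$1$1 = B$1$1 \<and> A$1$2 = B$1$2 \<and> A$2$1 = B$2$1 \<and> A$2$2 = B$2$2"
  by (auto simp: vec_eq_iff forall_2)

lemma mult_nth: "((A :: complex^2^2) ** B) $ i $ j = A$i$1 * B$1$j + A$i$2 * B$2$j"
  by (simp add: matrix_matrix_mult_def sum_2)

lemma mat2_mult: "mat2 a b c d ** mat2 a' b' c' d' =
    mat2 (a * a' + b * c') (a * b' + b * d') (c * a' + d * c') (c * b' + d * d')"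
  by (simp add: mat_eq_2 mult_nth)

lemma continuous_on_mat_mult [continuous_intros]:
  fixes f g :: "'a::topological_space \<Rightarrow> complex^2^2"
  assumes "continuous_on S f" "continuous_on S g"
  shows "continuous_on S (\<lambda>x. f x ** g x)"
  unfolding matrix_matrix_mult_def
  by (intro continuous_intros assms)

lemma continuous_on_mat2 [continuous_intros]:
  assumes "continuous_on S a" "continuous_on S b" "continuous_on S c" "continuous_on S d"
  shows "continuous_on S (\<lambda>x. mat2 (a x) (b x) (c x) (d x))"
proof -
  have *: "mat2 p q r s = (\<chi> i j. if i = 1 then if j = 1 then p else q else if j = 1 then r else s)" for p q r s
    by (simp add: mat_eq_2)
  have "continuous_on S (\<lambda>x. if i = 1 then if j = 1 then a x else b x else if j = 1 then c x else d x)"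
    for i j :: 2
    by (cases "i = 1"; cases "j = 1") (simp_all add: assms)
  then show ?thesis
    unfolding * by (intro continuous_on_vec_lambda)
qed

lemma closed_SL: "closed SL"
proof -
  have "closed {A :: complex^2^2. A$1$1 * A$2$2 - A$1$2 * A$2$1 = 1}"
    by (intro closed_Collect_eq continuous_intros)
  also have "{A :: complex^2^2. A$1$1 * A$2$2 - A$1$2 * A$2$1 = 1} = SL"
    by (auto simp: SL_iff)
  finally show ?thesis .
qed

definition adj :: "complex^2^2 \<Rightarrow> complex^2^2" where
  "adj A = mat2 (A$2$2) (- A$1$2) (- A$2$1) (A$1$1)"

lemma adj_SL [simp]: "adj A \<in> SL \<longleftrightarrow> A \<in> SL"
  by (simp add: adj_def SL_iff mult.commute)

lemma adj_inv: "A \<in> SL \<Longrightarrow> adj A ** A = mat 1" "A \<in> SL \<Longrightarrow> A ** adj A = mat 1"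
  by (auto simp add: adj_def SL_iff mat_eq_2 mult_nth mat_def algebra_simps)

lemma continuous_on_adj [continuous_intros]:
  "continuous_on S f \<Longrightarrow> continuous_on S (\<lambda>x. adj (f x))"
  unfolding adj_def by (intro continuous_intros)

lemma open_psl_iff: "open U \<longleftrightarrow> openin (top_of_set SL) {A \<in> SL. abs_psl2c A \<in> U}"
proof -
  have "U \<subseteq> abs_psl2c ` SL" by (metis abs_cases imageI subsetI)
  then show ?thesis
    by (simp add: open_psl2c_def openin_quotient_top SL_def)
qed

text \<open>The fibres of the projection are the pairs A, -A, so the saturation of the part of T in
  \<open>SL\<close> is cut out by the open set T united with -T.\<close>

lemma open_abs_image:
  assumes "open T" shows "open (abs_psl2c ` (SL \<inter> T))"
proof -
  have "{A \<in> SL. abs_psl2c A \<in> abs_psl2c ` (SL \<inter> T)} = SL \<inter> (T \<union> uminus ` T)"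
    by (force simp: abs_eq_iff image_iff)
  moreover have "open (T \<union> uminus ` T)"
    using assms by (simp add: open_Un open_negations)
  ultimately show ?thesis
    by (simp add: open_psl_iff openin_open_Int)
qed

lemma continuous_on_abs: "continuous_on SL abs_psl2c"
  unfolding continuous_on_open_invariant
proof (intro allI impI)
  fix B :: "psl2c set" assume "open B"
  then obtain T where "open T" "{A \<in> SL. abs_psl2c A \<in> B} = SL \<inter> T"
    unfolding open_psl_iff openin_open by auto
  then show "\<exists>A. open A \<and> A \<inter> SL = abs_psl2c -` B \<inter> SL"
    by (intro exI[of _ T]) auto
qed

text \<open>The universal property of the quotient topology: continuity on the group is tested on
  matrices.\<close>

lemma continuous_on_psl_iff:
  "continuous_on UNIV f \<longleftrightarrow> continuous_on SL (f \<circ> abs_psl2c)"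
proof
  assume "continuous_on SL (f \<circ> abs_psl2c)"
  then have "openin (top_of_set SL) (SL \<inter> (f \<circ> abs_psl2c) -` B)" if "open B" for B
    using that by (simp add: continuous_openin_preimage_gen)
  moreover have "SL \<inter> (f \<circ> abs_psl2c) -` B = {A \<in> SL. abs_psl2c A \<in> f -` B}" for B
    by auto
  ultimately show "continuous_on UNIV f"
    by (simp only: continuous_on_open_vimage[OF open_UNIV] Int_UNIV_right open_psl_iff) simp
qed (meson continuous_on_abs continuous_on_compose continuous_on_subset subset_UNIV)

text \<open>A compact exhaustion of the group. The matrix norm does not see the sign, so it descends
  to the quotient.\<close>

definition psl_ball :: "real \<Rightarrow> psl2c set" where
  "psl_ball r = abs_psl2c ` {A \<in> SL. norm A \<le> r}"

lemma abs_in_psl_ball: "A \<in> SL \<Longrightarrow> abs_psl2c A \<in> psl_ball r \<longleftrightarrow> norm A \<le> r"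
  by (auto simp: psl_ball_def image_iff abs_eq_iff)

lemma compact_SL_ball: "compact {A \<in> SL. norm A \<le> r}"
proof -
  have "{A \<in> SL. norm A \<le> r} = SL \<inter> cball 0 r" by auto
  then show ?thesis using closed_SL by (simp add: closed_Int_compact)
qed

lemma compact_psl_ball: "compact (psl_ball r)"
  unfolding psl_ball_def using compact_SL_ball
  by (rule compact_continuous_image[rotated]) (auto intro: continuous_on_subset[OF continuous_on_abs])

text \<open>Checked on matrices, where the complement is \<open>SL\<close> outside a closed ball; no
  separation property of the quotient enters.\<close>

lemma closed_psl_ball: "closed (psl_ball r)"
proof -
  have "{A \<in> SL. abs_psl2c A \<in> - psl_ball r} = SL \<inter> - cball 0 r"
    by (auto simp: abs_in_psl_ball)
  then show ?thesis
    by (auto simp: closed_def open_psl_iff openin_open_Int)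
qed

lemma psl_ball_mult:
  assumes "compact (C :: (complex^2^2) set)" "C \<subseteq> SL"
  obtains r' where "r' > 0" "\<And>A B. A \<in> SL \<Longrightarrow> norm A \<le> r \<Longrightarrow> B \<in> C \<Longrightarrow> norm (A ** B) \<le> r'"
proof -
  have "compact ((\<lambda>(A, B). A ** B) ` ({A \<in> SL. norm A \<le> r} \<times> C))"
    by (intro compact_continuous_image compact_Times assms compact_SL_ball)
       (auto simp: case_prod_unfold intro!: continuous_intros)
  then obtain r' where "r' > 0" "\<forall>x\<in>(\<lambda>(A, B). A ** B) ` ({A \<in> SL. norm A \<le> r} \<times> C). norm x \<le> r'"
    by (meson bounded_pos compact_imp_bounded)
  then show thesis by (intro that[of r']) auto
qed

section \<open>The diagonal and the lower unipotent subgroup\<close>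

definition a_mat :: "real \<Rightarrow> complex^2^2" where
  "a_mat s = mat2 (of_real (exp (s/2))) 0 0 (of_real (exp (- s/2)))"

definition n_mat :: "complex \<Rightarrow> complex^2^2" where
  "n_mat z = mat2 1 0 z 1"

lemma a_elt_abs: "a_elt s = abs_psl2c (a_mat s)" and n_elt_abs: "n_elt z = abs_psl2c (n_mat z)"
  by (simp_all add: a_elt_def n_elt_def a_mat_def n_mat_def)

lemma a_mat_SL [simp]: "a_mat s \<in> SL" and n_mat_SL [simp]: "n_mat z \<in> SL"
  by (simp_all add: a_mat_def n_mat_def SL_mat2 flip: of_real_mult exp_add)

lemma n_mat_add: "n_mat z ** n_mat w = n_mat (z + w)"
  by (simp add: n_mat_def mat2_mult)

lemma a_mat_add: "a_mat s ** a_mat t = a_mat (s + t)"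
  by (simp add: a_mat_def mat2_mult field_simps flip: of_real_mult exp_add)

text \<open>The renormalisation behind the whole argument: for t = -s the unipotent coordinate is
  contracted by exp (-s).\<close>

lemma n_a_mat: "n_mat z ** a_mat t = a_mat t ** n_mat (exp t *\<^sub>R z)"
  by (simp add: a_mat_def n_mat_def mat2_mult mat_eq_2 scaleR_conv_of_real)
     (simp flip: of_real_mult exp_add)

lemma continuous_n_mat [continuous_intros]:
  "continuous_on S f \<Longrightarrow> continuous_on S (\<lambda>x. n_mat (f x))"
  unfolding n_mat_def by (intro continuous_intros)

interpretation psl: group PSL2C by (rule group_PSL2C)

lemma psl_assoc: "psl_mult (psl_mult x y) z = psl_mult x (psl_mult y z)"
  using psl.m_assoc[of x y z] by simp

lemma n_elt_add: "psl_mult (n_elt z) (n_elt w) = n_elt (z + w)"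
  by (simp add: n_elt_abs abs_mult n_mat_add)

lemma a_elt_add: "psl_mult (a_elt s) (a_elt t) = a_elt (s + t)"
  by (simp add: a_elt_abs abs_mult a_mat_add)

lemma n_a_elt: "psl_mult (n_elt z) (a_elt t) = psl_mult (a_elt t) (n_elt (exp t *\<^sub>R z))"
  by (simp add: n_elt_abs a_elt_abs abs_mult n_a_mat)

lemma n_elt_0 [simp]: "n_elt 0 = psl_one"
proof -
  have "n_mat 0 = mat 1" by (simp add: n_mat_def mat_def mat_eq_2)
  then show ?thesis by (simp add: n_elt_abs psl_one_abs)
qed

lemma psl_one_simps [simp]: "psl_mult x psl_one = x" "psl_mult psl_one x = x"
  using psl.r_one[of x] psl.l_one[of x] by simp_all

lemma continuous_on_psl_mult_right: "continuous_on UNIV (\<lambda>g. psl_mult g h)"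
proof -
  obtain H where H: "H \<in> SL" "h = abs_psl2c H" by (rule abs_cases)
  have "continuous_on SL (\<lambda>A. abs_psl2c (A ** H))"
    by (rule continuous_on_compose2[OF continuous_on_abs]) (auto intro!: continuous_intros SL_mult H)
  then show ?thesis
    unfolding continuous_on_psl_iff
    by (rule continuous_on_eq) (simp add: H abs_mult)
qed

lemma continuous_on_psl_mult_left: "continuous_on UNIV (\<lambda>g. psl_mult h g)"
proof -
  obtain H where H: "H \<in> SL" "h = abs_psl2c H" by (rule abs_cases)
  have "continuous_on SL (\<lambda>A. abs_psl2c (H ** A))"
    by (rule continuous_on_compose2[OF continuous_on_abs]) (auto intro!: continuous_intros SL_mult H)
  then show ?thesis
    unfolding continuous_on_psl_iff
    by (rule continuous_on_eq) (simp add: H abs_mult)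
qed

section \<open>The coset space\<close>

lemma rep_SL: "rep_psl2c g \<in> SL" and abs_rep: "abs_psl2c (rep_psl2c g) = g"
  using Quotient_rep_reflp[OF Quotient_psl2c] Quotient_abs_rep[OF Quotient_psl2c]
  by (auto simp: SL_rel)

lemma abs_mult_adj: "A \<in> SL \<Longrightarrow> psl_mult (abs_psl2c (adj A)) (abs_psl2c A) = psl_one"
  "A \<in> SL \<Longrightarrow> psl_mult (abs_psl2c A) (abs_psl2c (adj A)) = psl_one"
  by (simp_all add: abs_mult adj_inv psl_one_abs)

section \<open>Continuous functions of compact support on the group\<close>

lemma Cc_GI:
  assumes "continuous_on UNIV \<psi>" "{g. \<psi> g \<noteq> 0} \<subseteq> psl_ball r"
  shows "\<psi> \<in> Cc_G"
proof -
  have "closure {g. \<psi> g \<noteq> 0} \<subseteq> psl_ball r"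
    using assms(2) closed_psl_ball closure_minimal by blast
  then show ?thesis
    using compact_Int_closed[OF compact_psl_ball[of r] closed_closure[of "{g. \<psi> g \<noteq> 0}"]] assms(1)
    by (simp add: Cc_G_def Int_absorb1)
qed

text \<open>The ramp min 1 (k d), where d is the distance of a representing matrix from the
  complement of W. That complement is symmetric under A to -A, so d descends to the group, and d
  vanishes exactly off W because the complement is closed.\<close>

lemma open_psl_approx:
  assumes "open W" "W \<subseteq> psl_ball r"
  obtains \<psi> :: "nat \<Rightarrow> psl2c \<Rightarrow> real" where
    "\<And>k. \<psi> k \<in> Cc_G" "\<And>k g. 0 \<le> \<psi> k g" "\<And>k g. \<psi> k g \<le> 1" "\<And>k g. g \<notin> W \<Longrightarrow> \<psi> k g = 0"
    "\<And>g. g \<in> W \<Longrightarrow> (\<lambda>k. \<psi> k g) \<longlonglongrightarrow> 1"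
proof -
  \<comment> \<open>The point 0 keeps C nonempty, as \<open>infdist\<close> requires. It lies
    outside \<open>SL\<close> and is its own negative, so neither the zeros of d nor the symmetry
    change.\<close>
  define C where "C = insert 0 (SL - {A \<in> SL. abs_psl2c A \<in> W})"
  define d where "d g = infdist (rep_psl2c g) C" for g
  define \<psi> where "\<psi> k g = min 1 (real k * d g)" for k :: nat and g
  obtain T where T: "open T" "{A \<in> SL. abs_psl2c A \<in> W} = SL \<inter> T"
    using assms(1) unfolding open_psl_iff openin_open by auto
  have "SL - {A \<in> SL. abs_psl2c A \<in> W} = SL - T" using T by auto
  then have C: "closed C" "C \<noteq> {}"
    using closed_SL T(1) by (auto simp: C_def intro!: closed_insert closed_Diff)
  have C_minus: "- A \<in> C \<longleftrightarrow> A \<in> C" for A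
    by (auto simp: C_def abs_uminus)
  have le: "infdist (- A) C \<le> infdist A C" for A
  proof -
    obtain B where "B \<in> C" "infdist A C = dist A B"
      using infdist_attains_inf[OF C] by metis
    then have "infdist (- A) C \<le> dist (- A) (- B)"
      by (intro infdist_le) (simp add: C_minus)
    then show ?thesis
      using \<open>infdist A C = dist A B\<close> by (metis dist_norm minus_diff_minus norm_minus_commute norm_minus_cancel)
  qed
  then have inf_minus: "infdist (- A) C = infdist A C" for A
    by (metis antisym minus_minus)
  have d_abs: "d (abs_psl2c A) = infdist A C" if "A \<in> SL" for A
    using abs_rep[of "abs_psl2c A"] rep_SL[of "abs_psl2c A"] that inf_minus
    by (auto simp: d_def abs_eq_iff)
  have d_cont: "continuous_on UNIV d"
    unfolding continuous_on_psl_iff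
    by (rule continuous_on_eq[of _ "\<lambda>A. infdist A C"]) (auto simp: d_abs intro: continuous_intros)
  have d_zero: "d g = 0 \<longleftrightarrow> g \<notin> W" for g
  proof -
    obtain A where A: "A \<in> SL" "g = abs_psl2c A" by (rule abs_cases)
    have "0 \<notin> SL" by (simp add: SL_iff)
    then show ?thesis
      using A in_closed_iff_infdist_zero[OF C, of A] d_abs[OF A(1)] by (auto simp: C_def)
  qed
  have d_nonneg: "0 \<le> d g" for g by (simp add: d_def infdist_nonneg)
  show thesis
  proof (rule that[of \<psi>])
    fix k :: nat and g
    have "{g. \<psi> k g \<noteq> 0} \<subseteq> psl_ball r"
    proof
      fix g assume "g \<in> {g. \<psi> k g \<noteq> 0}"
      then have "d g \<noteq> 0" by (auto simp: \<psi>_def)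
      then show "g \<in> psl_ball r" using assms(2) d_zero by auto
    qed
    then show "\<psi> k \<in> Cc_G"
      using d_cont by (intro Cc_GI) (auto simp: \<psi>_def intro!: continuous_intros)
    show "0 \<le> \<psi> k g" "\<psi> k g \<le> 1" using d_nonneg[of g] by (auto simp: \<psi>_def)
    show "\<psi> k g = 0" if "g \<notin> W"
    proof -
      have "d g = 0" using that d_zero by blast
      then show ?thesis by (simp add: \<psi>_def)
    qed
  next
    fix g assume "g \<in> W"
    then have "0 < d g" using d_zero[of g] d_nonneg[of g] by linarith
    then have "eventually (\<lambda>k. 1 \<le> real k * d g) sequentially"
      by real_asymp
    then show "(\<lambda>k. \<psi> k g) \<longlonglongrightarrow> 1"
      by (intro tendsto_eventually) (auto simp: \<psi>_def elim: eventually_mono)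
  qed
qed

section \<open>The quotient by a discrete subgroup\<close>

locale kleinian =
  fixes \<Gamma> :: "psl2c set"
  assumes disc: "discrete_subgroup \<Gamma>"
begin

definition pr :: "psl2c \<Rightarrow> psl2c set" where "pr g = \<Gamma> #>\<^bsub>PSL2C\<^esub> g"

definition XB :: "psl2c set measure" where "XB = borel_of_top (X_top \<Gamma>)"

lemma subgroup: "subgroup \<Gamma> PSL2C" and discrete: "discrete \<Gamma>"
  using disc by (auto simp: discrete_subgroup_def)

lemma one_mem: "psl_one \<in> \<Gamma>"
  using subgroup.one_closed[OF subgroup] by simp

lemma mult_mem: "x \<in> \<Gamma> \<Longrightarrow> y \<in> \<Gamma> \<Longrightarrow> psl_mult x y \<in> \<Gamma>"
  using subgroup.m_closed[OF subgroup, of x y] by simp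

lemma inv_mem:
  assumes "x \<in> \<Gamma>" obtains y where "y \<in> \<Gamma>" "psl_mult y x = psl_one" "psl_mult x y = psl_one"
proof (rule that)
  show "inv\<^bsub>PSL2C\<^esub> x \<in> \<Gamma>" using assms by (rule subgroup.m_inv_closed[OF subgroup])
  show "psl_mult (inv\<^bsub>PSL2C\<^esub> x) x = psl_one" using psl.l_inv[of x] by simp
  show "psl_mult x (inv\<^bsub>PSL2C\<^esub> x) = psl_one" using psl.r_inv[of x] by simp
qed

lemma mem_pr: "x \<in> pr g \<longleftrightarrow> (\<exists>\<gamma>\<in>\<Gamma>. x = psl_mult \<gamma> g)"
  by (auto simp: pr_def r_coset_def)

lemma pr_eq_iff: "pr g = pr g' \<longleftrightarrow> (\<exists>\<gamma>\<in>\<Gamma>. g = psl_mult \<gamma> g')"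
proof
  assume "pr g = pr g'"
  moreover have "g \<in> pr g" using one_mem by (force simp: mem_pr)
  ultimately show "\<exists>\<gamma>\<in>\<Gamma>. g = psl_mult \<gamma> g'" by (simp add: mem_pr)
next
  assume "\<exists>\<gamma>\<in>\<Gamma>. g = psl_mult \<gamma> g'"
  then obtain \<gamma> where \<gamma>: "\<gamma> \<in> \<Gamma>" "g = psl_mult \<gamma> g'" by auto
  obtain \<gamma>' where \<gamma>': "\<gamma>' \<in> \<Gamma>" "psl_mult \<gamma>' \<gamma> = psl_one" "psl_mult \<gamma> \<gamma>' = psl_one"
    using inv_mem[OF \<gamma>(1)] by metis
  have "g' = psl_mult \<gamma>' g" using \<gamma> \<gamma>' by (metis psl_assoc psl_one_simps(2))
  then show "pr g = pr g'"
    using \<gamma> \<gamma>' by (auto simp: set_eq_iff mem_pr) (metis mult_mem psl_assoc)+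
qed

lemma pr_mult: "\<gamma> \<in> \<Gamma> \<Longrightarrow> pr (psl_mult \<gamma> g) = pr g"
  using pr_eq_iff by blast

lemma pr_act: "pr g #>\<^bsub>PSL2C\<^esub> h = pr (psl_mult g h)"
  unfolding pr_def using psl.coset_mult_assoc[of \<Gamma> g h] by simp

lemma topspace_X: "topspace (X_top \<Gamma>) = range pr"
  by (auto simp: X_top_def pr_def)

lemma openin_X: "openin (X_top \<Gamma>) U \<longleftrightarrow> U \<subseteq> range pr \<and> open {g. pr g \<in> U}"
  by (simp add: X_top_def openin_quotient_top pr_def)

lemma openin_subset_X: "{U. openin (X_top \<Gamma>) U} \<subseteq> Pow (range pr)"
  by (auto simp: openin_X)

text \<open>The full preimage of the image of W is the union of the translates of W by \<Gamma>, so
  the projection is an open map.\<close>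

lemma openin_pr:
  assumes "open W" shows "openin (X_top \<Gamma>) (pr ` W)"
proof -
  have "{g. pr g \<in> pr ` W} = (\<Union>\<gamma>\<in>\<Gamma>. (\<lambda>g. psl_mult \<gamma> g) -` W)"
    by (auto simp: image_iff pr_eq_iff) (metis inv_mem psl_assoc psl_one_simps(2))+
  moreover have "open ((\<lambda>g. psl_mult \<gamma> g) -` W)" for \<gamma>
    using continuous_on_psl_mult_left assms by (simp add: continuous_on_open_vimage)
  ultimately show ?thesis by (auto simp: openin_X)
qed

lemma space_XB: "space XB = range pr"
  by (simp add: XB_def borel_of_top_def topspace_X space_measure_of openin_subset_X)

lemma sets_XB: "sets XB = sigma_sets (range pr) {U. openin (X_top \<Gamma>) U}"
  unfolding XB_def borel_of_top_def topspace_X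
  by (rule sets_measure_of[OF openin_subset_X])

lemma open_sets_XB: "openin (X_top \<Gamma>) U \<Longrightarrow> U \<in> sets XB"
  by (auto simp: sets_XB)

text \<open>Continuity alone gives a preimage that is open in the product topology, which need not
  lie in the product sigma-algebra. A countable basis of the parameter space rewrites it as a
  countable union of open rectangles.\<close>

lemma measurable_act:
  fixes h :: "'p::second_countable_topology \<Rightarrow> complex^2^2"
  assumes h: "continuous_on UNIV h" "\<And>t. h t \<in> SL"
  shows "(\<lambda>(x, t). x #>\<^bsub>PSL2C\<^esub> abs_psl2c (h t)) \<in> XB \<Otimes>\<^sub>M borel \<rightarrow>\<^sub>M XB"
proof (rule measurable_sigma_sets[OF sets_XB])
  show "{U. openin (X_top \<Gamma>) U} \<subseteq> Pow (range pr)"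
    by (rule openin_subset_X)
  show "(\<lambda>(x, t). x #>\<^bsub>PSL2C\<^esub> abs_psl2c (h t)) \<in> space (XB \<Otimes>\<^sub>M borel) \<rightarrow> range pr"
    by (auto simp: space_pair_measure space_XB pr_act)
next
  fix U assume "U \<in> {U. openin (X_top \<Gamma>) U}"
  then have U: "openin (X_top \<Gamma>) U" by simp
  define P where "P = (\<lambda>(x, t). x #>\<^bsub>PSL2C\<^esub> abs_psl2c (h t)) -` U \<inter> space (XB \<Otimes>\<^sub>M borel)"
  obtain \<B> :: "'p set set" where \<B>: "countable \<B>" "topological_basis \<B>"
    using ex_countable_basis by auto
  \<comment> \<open>The largest open set whose rectangle over b stays in P. The union is arbitrary
    but still open; only the choice of b has to be countable.\<close>
  define V where "V b = \<Union>{V. openin (X_top \<Gamma>) V \<and> V \<times> b \<subseteq> P}" for b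
  have "P \<subseteq> (\<Union>b\<in>\<B>. V b \<times> b)"
  proof (safe, goal_cases)
    case (1 x t)
    then have x: "x \<in> range pr" "x #>\<^bsub>PSL2C\<^esub> abs_psl2c (h t) \<in> U"
      by (auto simp: P_def space_pair_measure space_XB)
    then obtain A where A: "A \<in> SL" "x = pr (abs_psl2c A)" by (metis abs_cases imageE)
    define f where "f = (\<lambda>(A, t). abs_psl2c (A ** h t))"
    have f: "continuous_on (SL \<times> UNIV) f"
      unfolding f_def case_prod_unfold
      by (rule continuous_on_compose2[OF continuous_on_abs])
         (auto intro!: continuous_intros continuous_on_compose2[OF h(1)] SL_mult h(2))
    have "open {g. pr g \<in> U}" using U by (simp add: openin_X)
    then obtain Q where Q: "open Q" "Q \<inter> SL \<times> UNIV = f -` {g. pr g \<in> U} \<inter> SL \<times> UNIV"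
      using f unfolding continuous_on_open_invariant by metis
    have "(A, t) \<in> Q \<inter> SL \<times> UNIV"
      unfolding Q(2) using x(2) A(1) unfolding A(2) by (simp add: f_def pr_act abs_mult h(2))
    then have "(A, t) \<in> Q" by simp
    then obtain T b' where T: "open T" "open b'" "A \<in> T" "t \<in> b'" "T \<times> b' \<subseteq> Q"
      using Q(1) by (metis open_prod_elim mem_Sigma_iff)
    then obtain b where b: "b \<in> \<B>" "t \<in> b" "b \<subseteq> b'"
      using topological_basisE[OF \<B>(2)] by metis
    have "pr ` abs_psl2c ` (SL \<inter> T) \<times> b \<subseteq> P"
    proof safe
      fix B s assume 1: "B \<in> SL" "B \<in> T" "s \<in> b"
      then have "(B, s) \<in> Q \<inter> SL \<times> UNIV" using T b by auto
      then have "pr (abs_psl2c (B ** h s)) \<in> U" unfolding Q(2) f_def by auto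
      then show "(pr (abs_psl2c B), s) \<in> P"
        using 1 by (auto simp: P_def space_pair_measure space_XB pr_act abs_mult h(2))
    qed
    moreover have "openin (X_top \<Gamma>) (pr ` abs_psl2c ` (SL \<inter> T))"
      by (intro openin_pr open_abs_image T)
    ultimately have "x \<in> V b" using A T(3) by (auto simp: V_def)
    then show ?case using b by auto
  qed
  moreover have "(\<Union>b\<in>\<B>. V b \<times> b) \<subseteq> P" by (auto simp: V_def)
  ultimately have "P = (\<Union>b\<in>\<B>. V b \<times> b)" by auto
  moreover have "V b \<in> sets XB" for b
    unfolding V_def by (intro open_sets_XB openin_Union) auto
  moreover have "b \<in> sets borel" if "b \<in> \<B>" for b
    using topological_basis_open[OF \<B>(2) that] by simp
  ultimately show "P \<in> sets (XB \<Otimes>\<^sub>M borel)"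
    using \<B>(1) by (auto intro!: sets.countable_UN'')
qed

lemma measurable_act_const: "(\<lambda>x. x #>\<^bsub>PSL2C\<^esub> h) \<in> XB \<rightarrow>\<^sub>M XB"
proof -
  obtain H where H: "H \<in> SL" "h = abs_psl2c H" by (rule abs_cases)
  have "(\<lambda>(x, t :: real). x #>\<^bsub>PSL2C\<^esub> abs_psl2c H) \<in> XB \<Otimes>\<^sub>M borel \<rightarrow>\<^sub>M XB"
    by (rule measurable_act) (use H in auto)
  from measurable_compose[OF measurable_Pair2'[of "0::real"] this]
  have "(\<lambda>x. case (x, 0 :: real) of (x, t) \<Rightarrow> x #>\<^bsub>PSL2C\<^esub> abs_psl2c H) \<in> XB \<rightarrow>\<^sub>M XB"
    using measurable_Pair1' measurable_compose[OF _ \<open>_ \<in> XB \<Otimes>\<^sub>M borel \<rightarrow>\<^sub>M XB\<close>]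
    by (metis (no_types, lifting) measurable_Pair1 measurable_Pair2' space_borel UNIV_I)
  then show ?thesis by (simp add: H)
qed

text \<open>Injectivity of \<open>pr\<close> on W means that the \<Gamma>-translates of W are
  pairwise disjoint, so a sum over \<Gamma> has at most one term from W. The norm bound makes test
  functions on W compactly supported and gives the image finite mass.\<close>

definition small :: "psl2c set \<Rightarrow> bool" where
  "small W \<longleftrightarrow> open W \<and> inj_on pr W \<and> (\<exists>r. W \<subseteq> psl_ball r)"

lemma isolated_one: obtains W where "open W" "psl_one \<in> W" "W \<inter> \<Gamma> = {psl_one}"
  using discrete one_mem unfolding discrete_def isolated_in_def
  by (metis IntE insertI1)

text \<open>If B and C are close to A and have the same image in X, then B times the inverse of C
  lies in \<Gamma> and is close to the identity, hence equal to it by discreteness. Quantifying over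
  all open subsets of T lets T be shrunk later to a member of a countable basis.\<close>

lemma small_nbhd:
  assumes "A \<in> SL" "open O'" "A \<in> O'"
  obtains T where "open T" "A \<in> T" "T \<subseteq> O'" "\<And>T'. open T' \<Longrightarrow> T' \<subseteq> T \<Longrightarrow> small (abs_psl2c ` (SL \<inter> T'))"
proof -
  obtain W where W: "open W" "psl_one \<in> W" "W \<inter> \<Gamma> = {psl_one}" by (rule isolated_one)
  define f where "f = (\<lambda>(A, B). abs_psl2c (A ** adj B))"
  have f: "continuous_on (SL \<times> SL) f"
    unfolding f_def case_prod_unfold
    by (rule continuous_on_compose2[OF continuous_on_abs])
       (auto intro!: continuous_intros SL_mult)
  then obtain Q where Q: "open Q" "Q \<inter> SL \<times> SL = f -` W \<inter> SL \<times> SL"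
    using W(1) unfolding continuous_on_open_invariant by metis
  have "(A, A) \<in> Q \<inter> SL \<times> SL"
    unfolding Q(2) using assms(1) W(2) by (simp add: f_def adj_inv flip: psl_one_abs)
  then have "(A, A) \<in> Q" by simp
  then obtain T1 T2 where T: "open T1" "open T2" "A \<in> T1" "A \<in> T2" "T1 \<times> T2 \<subseteq> Q"
    using Q(1) by (metis open_prod_elim mem_Sigma_iff)
  define T where "T = T1 \<inter> T2 \<inter> O' \<inter> ball 0 (norm A + 1)"
  show thesis
  proof (rule that[of T])
    show "open T" "A \<in> T" "T \<subseteq> O'" using T assms by (auto simp: T_def)
    fix T' assume T': "open T'" "T' \<subseteq> T"
    have "inj_on pr (abs_psl2c ` (SL \<inter> T'))"
    proof (safe intro!: inj_onI, goal_cases)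
      case (1 _ _ B C)
      then obtain \<gamma> where \<gamma>: "\<gamma> \<in> \<Gamma>" "abs_psl2c B = psl_mult \<gamma> (abs_psl2c C)"
        by (auto simp: pr_eq_iff)
      have "abs_psl2c (B ** adj C) = psl_mult (abs_psl2c B) (abs_psl2c (adj C))"
        using 1 by (simp add: abs_mult)
      also have "\<dots> = \<gamma>" using \<gamma> 1 by (simp add: psl_assoc abs_mult_adj)
      finally have "f (B, C) = \<gamma>" by (simp add: f_def)
      moreover have "(B, C) \<in> Q \<inter> SL \<times> SL" using 1 T' T by (auto simp: T_def)
      ultimately have "\<gamma> \<in> W" unfolding Q(2) by auto
      then have "\<gamma> = psl_one" using W(3) \<gamma>(1) by blast
      then show ?case using \<gamma>(2) by simp
    qed
    moreover have "abs_psl2c ` (SL \<inter> T') \<subseteq> psl_ball (norm A + 1)"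
      using T' by (auto simp: abs_in_psl_ball T_def subset_iff less_imp_le)
    ultimately show "small (abs_psl2c ` (SL \<inter> T'))"
      using T' open_abs_image by (auto simp: small_def)
  qed
qed

text \<open>A countable basis of the matrix space, pushed to the group and filtered by smallness, is
  still a basis because every point has arbitrarily fine small neighbourhoods.\<close>

lemma countable_small:
  obtains \<A> where "countable \<A>" "\<And>W. W \<in> \<A> \<Longrightarrow> small W"
    "\<And>V. open V \<Longrightarrow> V = \<Union>{W \<in> \<A>. W \<subseteq> V}"
proof -
  obtain \<B> :: "(complex^2^2) set set" where \<B>: "countable \<B>" "topological_basis \<B>"
    using ex_countable_basis by auto
  define \<A> where "\<A> = {W \<in> (\<lambda>b. abs_psl2c ` (SL \<inter> b)) ` \<B>. small W}"
  show thesis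
  proof (rule that[of \<A>])
    show "countable \<A>" using \<B>(1) by (simp add: \<A>_def)
    show "\<And>W. W \<in> \<A> \<Longrightarrow> small W" by (simp add: \<A>_def)
    fix V :: "psl2c set" assume V: "open V"
    show "V = \<Union>{W \<in> \<A>. W \<subseteq> V}"
    proof (intro equalityI subsetI)
      fix g assume g: "g \<in> V"
      obtain A where A: "A \<in> SL" "g = abs_psl2c A" by (rule abs_cases)
      obtain O' where O': "open O'" "{A \<in> SL. abs_psl2c A \<in> V} = SL \<inter> O'"
        using V unfolding open_psl_iff openin_open by auto
      have "A \<in> O'" using A g O' by auto
      then obtain T where T: "A \<in> T" "open T" "T \<subseteq> O'"
          "\<And>T'. open T' \<Longrightarrow> T' \<subseteq> T \<Longrightarrow> small (abs_psl2c ` (SL \<inter> T'))"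
        using small_nbhd[OF A(1) O'(1)] by metis
      then obtain b where b: "b \<in> \<B>" "A \<in> b" "b \<subseteq> T"
        using topological_basisE[OF \<B>(2)] by metis
      have "abs_psl2c ` (SL \<inter> b) \<in> \<A>"
        using b T(4) topological_basis_open[OF \<B>(2)] by (auto simp: \<A>_def)
      moreover have "abs_psl2c ` (SL \<inter> b) \<subseteq> V" using b T(3) O'(2) by blast
      ultimately show "g \<in> \<Union>{W \<in> \<A>. W \<subseteq> V}" using A b by blast
    qed auto
  qed
qed

text \<open>Images of small sets form a generator of the Borel sets of X that is closed under
  intersection and contains a countable cover of finite mass, so the uniqueness theorem for measures
  applies.\<close>

lemma measure_eq_of_small:
  assumes M: "sets M = sets XB" and N: "sets N = sets XB"
    and eq: "\<And>W. small W \<Longrightarrow> emeasure M (pr ` W) = emeasure N (pr ` W)"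
    and fin: "\<And>W. small W \<Longrightarrow> emeasure M (pr ` W) \<noteq> \<infinity>"
  shows "M = N"
proof -
  define E where "E = {pr ` W | W. small W}"
  obtain \<A> where \<A>: "countable \<A>" "\<And>W. W \<in> \<A> \<Longrightarrow> small W"
    "\<And>V. open V \<Longrightarrow> V = \<Union>{W \<in> \<A>. W \<subseteq> V}" by (rule countable_small; blast)
  have E_open: "openin (X_top \<Gamma>) U" if "U \<in> E" for U
    using that by (auto simp: E_def small_def intro: openin_pr)
  have sets_E: "sets XB = sigma_sets (range pr) E"
  proof
    show "sigma_sets (range pr) E \<subseteq> sets XB"
      unfolding sets_XB by (rule sigma_sets_mono) (auto intro: E_open)
    show "sets XB \<subseteq> sigma_sets (range pr) E"
      unfolding sets_XB
    proof (rule sigma_sets_mono, safe)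
      fix U assume U: "openin (X_top \<Gamma>) U"
      define V where "V = {g. pr g \<in> U}"
      have "U = pr ` V" using U by (auto simp: V_def openin_X)
      also have "\<dots> = \<Union>((`) pr ` {W \<in> \<A>. W \<subseteq> V})"
        using \<A>(3)[of V] U unfolding openin_X V_def[symmetric] by blast
      finally have U_eq: "U = \<Union>((`) pr ` {W \<in> \<A>. W \<subseteq> V})" .
      have "\<Union>((`) pr ` {W \<in> \<A>. W \<subseteq> V}) \<in> sigma_sets (range pr) E"
        using \<A>(1,2) by (intro sigma_sets_UNION) (auto simp: E_def)
      then show "U \<in> sigma_sets (range pr) E" using U_eq by simp
    qed
  qed
  show ?thesis
  proof (rule measure_eqI_generator_eq_countable)
    show "Int_stable E"
    proof (rule Int_stableI)
      fix a b assume "a \<in> E" "b \<in> E"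
      then obtain V W where VW: "a = pr ` V" "b = pr ` W" "small V" "small W" by (auto simp: E_def)
      \<comment> \<open>Intersecting the two images in X amounts to shrinking V, which keeps
        \<open>pr\<close> injective and the norm bounded.\<close>
      define V' where "V' = V \<inter> {g. pr g \<in> pr ` W}"
      have "open V'"
        using VW openin_pr[of W] by (auto simp: V'_def small_def openin_X)
      then have "small V'"
        using VW(3) by (auto simp: small_def V'_def inj_on_Int)
      moreover have "a \<inter> b = pr ` V'" using VW by (auto simp: V'_def)
      ultimately show "a \<inter> b \<in> E" by (auto simp: E_def)
    qed
  next
    show "E \<subseteq> Pow (range pr)" using E_open by (auto dest!: E_open simp: openin_X)
    show "\<And>X. X \<in> E \<Longrightarrow> emeasure M X = emeasure N X" using eq by (auto simp: E_def)
    show "sets M = sigma_sets (range pr) E" "sets N = sigma_sets (range pr) E"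
      using M N sets_E by auto
    show "(`) pr ` \<A> \<subseteq> E" "countable ((`) pr ` \<A>)"
      using \<A> by (auto simp: E_def)
    have "(UNIV :: psl2c set) = \<Union>\<A>" using \<A>(3)[of UNIV] by simp
    then show "\<Union>((`) pr ` \<A>) = range pr" by (metis image_Union)
    show "\<And>a. a \<in> (`) pr ` \<A> \<Longrightarrow> emeasure M a \<noteq> \<infinity>" using fin \<A> by auto
  qed
qed

end

section \<open>Invariance of the Burger--Roblin measure\<close>

lemma lborel_integral_translate:
  fixes f :: "'a::euclidean_space \<Rightarrow> real"
  assumes "f \<in> borel_measurable borel"
  shows "(\<integral>z. f (z + w) \<partial>lborel) = (\<integral>z. f z \<partial>lborel)"
proof -
  have "(\<integral>z. f z \<partial>lborel) = (\<integral>z. f z \<partial>(distr lborel borel ((+) w)))"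
    by (simp add: lborel_distr_plus)
  also have "\<dots> = (\<integral>z. f (w + z) \<partial>lborel)"
    by (intro integral_distr) (auto intro: assms)
  finally show ?thesis by (simp add: add.commute)
qed

lemma lborel_integral_scale:
  fixes f :: "'a::euclidean_space \<Rightarrow> real"
  assumes "f \<in> borel_measurable borel" "c > 0"
  shows "(\<integral>z. f z \<partial>lborel) = c ^ DIM('a) * (\<integral>z. f (c *\<^sub>R z) \<partial>lborel)"
proof -
  have "(\<integral>z. f z \<partial>lborel) =
      (\<integral>z. f z \<partial>(density (distr lborel borel (\<lambda>x. 0 + c *\<^sub>R x)) (\<lambda>_. ennreal (\<bar>c\<bar> ^ DIM('a)))))"
    using lborel_affine[of c "0 :: 'a"] assms(2) by simp
  also have "\<dots> = (\<integral>z. \<bar>c\<bar> ^ DIM('a) * f z \<partial>(distr lborel borel (\<lambda>x. 0 + c *\<^sub>R x)))"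
    using assms by (subst integral_density) auto
  also have "\<dots> = (\<integral>z. \<bar>c\<bar> ^ DIM('a) * f (c *\<^sub>R z) \<partial>lborel)"
    using assms by (subst integral_distr) auto
  finally show ?thesis using assms(2) by simp
qed

lemma continuous_on_n_orbit:
  assumes "continuous_on UNIV (\<psi> :: psl2c \<Rightarrow> real)"
  shows "continuous_on UNIV (\<lambda>z. \<psi> (psl_mult g (n_elt z)))"
proof -
  obtain A where A: "A \<in> SL" "g = abs_psl2c A" by (rule abs_cases)
  have "continuous_on UNIV (\<lambda>z. \<psi> (abs_psl2c (A ** n_mat z)))"
    by (rule continuous_on_compose2[OF assms continuous_on_compose2[OF continuous_on_abs]])
       (auto intro!: continuous_intros SL_mult A)
  then show ?thesis by (simp add: A n_elt_abs abs_mult)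
qed

text \<open>Only the innermost variable is affected, and Lebesgue measure on the complex plane is
  translation invariant.\<close>

lemma BR_lift_translate_n:
  assumes "continuous_on UNIV \<psi>"
  shows "BR_lift \<delta> \<nu>o (\<lambda>g. \<psi> (psl_mult g (n_elt w))) = BR_lift \<delta> \<nu>o \<psi>"
proof -
  have "(\<integral>z. \<psi> (psl_mult (psl_mult g (n_elt z)) (n_elt w)) \<partial>lborel) =
        (\<integral>z. \<psi> (psl_mult g (n_elt z)) \<partial>lborel)" for g
    using lborel_integral_translate[of "\<lambda>z. \<psi> (psl_mult g (n_elt z))" w]
      borel_measurable_continuous_onI[OF continuous_on_n_orbit[OF assms, of g]]
    by (simp add: psl_assoc n_elt_add)
  then show ?thesis by (simp add: BR_lift_def)
qed

text \<open>Moving a_t to the left past n_z replaces z by exp t times z, which costs exp (-2 t) in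
  the plane integral, and turns s into s + t, which the weight compensates by exp (\<delta> t). No
  integrability enters: all changes of variable hold for Bochner integrals as they stand.\<close>

lemma BR_lift_translate_a:
  assumes "continuous_on UNIV \<psi>"
  shows "BR_lift \<delta> \<nu>o (\<lambda>g. \<psi> (psl_mult g (a_elt t))) = exp ((\<delta> - 2) * t) * BR_lift \<delta> \<nu>o \<psi>"
proof -
  define F where "F k s = (\<integral>z. \<psi> (psl_mult (psl_mult k (a_elt s)) (n_elt z)) * exp (- \<delta> * s)
       \<partial>(lborel :: complex measure))" for k s
  have inner: "(\<integral>z. \<psi> (psl_mult (psl_mult (psl_mult k (a_elt s)) (n_elt z)) (a_elt t)) * exp (- \<delta> * s)
       \<partial>(lborel :: complex measure)) = exp ((\<delta> - 2) * t) * F k (t + s)" for k s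
  proof -
    define f where "f z = \<psi> (psl_mult (psl_mult k (a_elt (t + s))) (n_elt z)) * exp (- \<delta> * s)" for z
    have f: "f \<in> borel_measurable borel"
      unfolding f_def
      using borel_measurable_continuous_onI[OF continuous_on_n_orbit[OF assms, of "psl_mult k (a_elt (t + s))"]]
      by simp
    have eq: "psl_mult (psl_mult (psl_mult k (a_elt s)) (n_elt z)) (a_elt t) =
        psl_mult (psl_mult k (a_elt (t + s))) (n_elt (exp t *\<^sub>R z))" for z
      by (simp add: psl_assoc n_a_elt) (metis a_elt_add add.commute psl_assoc)
    have "exp t ^ 2 * exp ((\<delta> - 2) * t) * exp (- \<delta> * (t + s)) = exp (- \<delta> * s)"
      by (simp add: power2_eq_square algebra_simps flip: exp_add)
    then have "exp ((\<delta> - 2) * t) * F k (t + s) * exp t ^ 2 = (\<integral>z. f z \<partial>lborel)"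
      by (simp add: F_def f_def) (simp add: mult_ac)
    also have "\<dots> = exp t ^ 2 * (\<integral>z. f (exp t *\<^sub>R z) \<partial>lborel)"
      using lborel_integral_scale[OF f, of "exp t"] by simp
    finally show ?thesis by (simp add: eq f_def)
  qed
  have "(\<integral>s. exp ((\<delta> - 2) * t) * F k (t + s) \<partial>lborel) = exp ((\<delta> - 2) * t) * (\<integral>s. F k s \<partial>lborel)" for k
    using lborel_integral_real_affine[of 1 "F k" t] by simp
  then show ?thesis
    unfolding BR_lift_def PSL2C_simps inner F_def[symmetric] int_K_def by simp
qed

locale br = kleinian +
  fixes \<nu> :: "complex \<times> real \<Rightarrow> complex option measure" and \<mu> :: "psl2c set measure"
  assumes BR: "is_BR_measure \<Gamma> \<nu> \<mu>"
begin

abbreviation "\<delta> \<equiv> critical_exponent \<Gamma>"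

lemma sets_mu: "sets \<mu> = sets XB" and loc_fin: "locally_finite_measure (X_top \<Gamma>) \<mu>"
  and BR_integral: "\<psi> \<in> Cc_G \<Longrightarrow>
     (\<And>g. \<Psi> (pr g) = (\<Sum>\<^sub>\<infinity>\<gamma>\<in>\<Gamma>. \<psi> (psl_mult \<gamma> g))) \<Longrightarrow>
     (\<integral>x. \<Psi> x \<partial>\<mu>) = BR_lift \<delta> (\<nu> base_pt) \<psi>"
  using BR by (auto simp: is_BR_measure_def XB_def pr_def)

lemma space_mu: "space \<mu> = range pr"
  using sets_eq_imp_space_eq[OF sets_mu] by (simp add: space_XB)

lemma small_sets: "small W \<Longrightarrow> pr ` W \<in> sets \<mu>"
  by (auto simp: sets_mu small_def intro: open_sets_XB openin_pr)

text \<open>Local finiteness passes to a compact set through a finite subcover. An open U is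
  produced because monotonicity of \<open>emeasure\<close> asks measurability of the larger set
  only; arbitrary bounded subsets can then be estimated.\<close>

lemma finite_ball: "\<exists>U. openin (X_top \<Gamma>) U \<and> pr ` psl_ball r \<subseteq> U \<and> emeasure \<mu> U < \<infinity>"
proof -
  define \<U> where "\<U> = {U. openin (X_top \<Gamma>) U \<and> emeasure \<mu> U < \<infinity>}"
  have "\<exists>U\<in>\<U>. pr g \<in> U" for g
    using loc_fin by (auto simp: locally_finite_measure_def \<U>_def topspace_X)
  then have "psl_ball r \<subseteq> (\<Union>U\<in>\<U>. {g. pr g \<in> U})" by auto
  moreover have "open {g. pr g \<in> U}" if "U \<in> \<U>" for U
    using that by (simp add: \<U>_def openin_X)
  ultimately obtain \<F> where \<F>: "\<F> \<subseteq> \<U>" "finite \<F>" "psl_ball r \<subseteq> (\<Union>U\<in>\<F>. {g. pr g \<in> U})"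
    using compactE_image[OF compact_psl_ball] by metis
  have "emeasure \<mu> (\<Union>\<F>) \<le> (\<Sum>U\<in>\<F>. emeasure \<mu> U)"
    using \<F> emeasure_subadditive_finite[of \<F> "\<lambda>U. U" \<mu>]
    by (auto simp: \<U>_def sets_mu intro: open_sets_XB)
  also have "\<dots> < \<infinity>"
    using \<F> by (auto simp: \<U>_def)
  finally have "emeasure \<mu> (\<Union>\<F>) < \<infinity>" .
  moreover have "openin (X_top \<Gamma>) (\<Union>\<F>)" using \<F> by (auto simp: \<U>_def)
  ultimately show ?thesis using \<F>(3) by (intro exI[of _ "\<Union>\<F>"]) auto
qed

lemma emeasure_fin:
  assumes "W \<subseteq> psl_ball r" shows "emeasure \<mu> (pr ` W) < \<infinity>"
proof -
  obtain U where U: "openin (X_top \<Gamma>) U" "pr ` psl_ball r \<subseteq> U" "emeasure \<mu> U < \<infinity>"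
    using finite_ball by metis
  have "emeasure \<mu> (pr ` W) \<le> emeasure \<mu> U"
    using U assms by (intro emeasure_mono) (auto simp: sets_mu intro: open_sets_XB)
  then show ?thesis using U(3) by (rule le_less_trans)
qed

lemma small_fin: "small W \<Longrightarrow> emeasure \<mu> (pr ` W) < \<infinity>"
  using emeasure_fin by (auto simp: small_def)

text \<open>On a small set the sum over \<open>\<Gamma>\<close> has at most one non-zero term, so indicators of images of
  small sets are limits of the functions that test \<^term>\<open>\<mu>\<close>.\<close>

lemma small_mass_limit:
  assumes W: "small W" and \<psi>: "\<And>k. \<psi> k \<in> Cc_G" "\<And>k g. 0 \<le> \<psi> k g" "\<And>k g. \<psi> k g \<le> 1"
    "\<And>k g. g \<notin> W \<Longrightarrow> \<psi> k g = 0" "\<And>g. g \<in> W \<Longrightarrow> (\<lambda>k. \<psi> k g) \<longlonglongrightarrow> 1"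
  shows "(\<lambda>k. BR_lift \<delta> (\<nu> base_pt) (\<psi> k)) \<longlonglongrightarrow> measure \<mu> (pr ` W)"
proof -
  have inj: "inj_on pr W" and opn: "open W" using W by (auto simp: small_def)
  \<comment> \<open>The function on X that corresponds to \<psi> k: on the image of W it is read off
    through the inverse of the injective projection.\<close>
  define \<Psi> where "\<Psi> k x = (if x \<in> pr ` W then \<psi> k (the_inv_into W pr x) else 0)" for k x
  have \<Psi>_W: "\<Psi> k (pr w) = \<psi> k w" if "w \<in> W" for k w
    using that by (auto simp: \<Psi>_def the_inv_into_f_f[OF inj])
  have \<Psi>_sum: "\<Psi> k (pr g) = (\<Sum>\<^sub>\<infinity>\<gamma>\<in>\<Gamma>. \<psi> k (psl_mult \<gamma> g))" for k g
  proof (cases "\<exists>\<gamma>\<in>\<Gamma>. psl_mult \<gamma> g \<in> W")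
    case True
    then obtain \<gamma>0 where \<gamma>0: "\<gamma>0 \<in> \<Gamma>" "psl_mult \<gamma>0 g \<in> W" by auto
    have "\<psi> k (psl_mult \<gamma> g) = 0" if "\<gamma> \<in> \<Gamma>" "\<gamma> \<noteq> \<gamma>0" for \<gamma>
    proof (rule \<psi>(4), rule notI)
      assume "psl_mult \<gamma> g \<in> W"
      moreover have "pr (psl_mult \<gamma> g) = pr (psl_mult \<gamma>0 g)" using that \<gamma>0 pr_mult by simp
      ultimately have "psl_mult \<gamma> g = psl_mult \<gamma>0 g" using inj \<gamma>0 by (auto dest: inj_onD)
      then have "\<gamma> = \<gamma>0" using psl.right_cancel[of g \<gamma> \<gamma>0] by simp
      then show False using that by simp
    qed
    then have "(\<Sum>\<^sub>\<infinity>\<gamma>\<in>\<Gamma>. \<psi> k (psl_mult \<gamma> g)) = (\<Sum>\<^sub>\<infinity>\<gamma>\<in>{\<gamma>0}. \<psi> k (psl_mult \<gamma> g))"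
      using \<gamma>0 by (intro infsum_cong_neutral) auto
    then show ?thesis using \<Psi>_W[OF \<gamma>0(2)] by (simp add: pr_mult[OF \<gamma>0(1)])
  next
    case False
    then have "pr g \<notin> pr ` W" by (auto simp: pr_eq_iff) (metis inv_mem psl_assoc psl_one_simps(2))
    moreover have "(\<Sum>\<^sub>\<infinity>\<gamma>\<in>\<Gamma>. \<psi> k (psl_mult \<gamma> g)) = 0"
      using False \<psi>(4) by (intro infsum_0) auto
    ultimately show ?thesis by (simp add: \<Psi>_def)
  qed
  have \<psi>_cont: "continuous_on UNIV (\<psi> k)" for k using \<psi>(1) by (simp add: Cc_G_def)
  \<comment> \<open>For c \<ge> 0 the superlevel set is the image of an open subset of W; for c < 0
    it is the whole space.\<close>
  have meas: "\<Psi> k \<in> borel_measurable \<mu>" for k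
  proof (rule borel_measurableI_greater)
    fix c :: real
    show "{x \<in> space \<mu>. c < \<Psi> k x} \<in> sets \<mu>"
    proof (cases "c < 0")
      case True
      moreover have "\<Psi> k x \<ge> 0" for x using \<psi>(2) by (simp add: \<Psi>_def)
      ultimately have "{x \<in> space \<mu>. c < \<Psi> k x} = space \<mu>"
        by (auto intro: less_le_trans)
      then show ?thesis by simp
    next
      case False
      then have "{x \<in> space \<mu>. c < \<Psi> k x} = pr ` (W \<inter> {w. c < \<psi> k w})"
        using \<Psi>_W by (auto simp: space_mu) (auto simp: \<Psi>_def split: if_splits)
      moreover have "open (W \<inter> {w. c < \<psi> k w})"
        using \<psi>_cont[of k] opn by (auto intro!: open_Int open_Collect_less continuous_intros)
      ultimately show ?thesis by (simp add: sets_mu open_sets_XB openin_pr)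
    qed
  qed
  have "(\<lambda>k. \<integral>x. \<Psi> k x \<partial>\<mu>) \<longlonglongrightarrow> (\<integral>x. indicator (pr ` W) x \<partial>\<mu>)"
  proof (rule integral_dominated_convergence)
    show "(indicator (pr ` W) :: _ \<Rightarrow> real) \<in> borel_measurable \<mu>" using small_sets[OF W] by simp
    show "integrable \<mu> (indicator (pr ` W) :: _ \<Rightarrow> real)"
      using small_sets[OF W] small_fin[OF W] by (simp add: integrable_indicator_iff)
    show "\<Psi> k \<in> borel_measurable \<mu>" for k by (rule meas)
    show "AE x in \<mu>. (\<lambda>k. \<Psi> k x) \<longlonglongrightarrow> indicator (pr ` W) x"
    proof (rule AE_I2)
      fix x show "(\<lambda>k. \<Psi> k x) \<longlonglongrightarrow> indicator (pr ` W) x"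
      proof (cases "x \<in> pr ` W")
        case True
        then show ?thesis using \<psi>(5) by (auto simp: \<Psi>_W)
      qed (auto simp: \<Psi>_def)
    qed
    show "AE x in \<mu>. norm (\<Psi> k x) \<le> indicator (pr ` W) x" for k
      using \<psi>(2,3) by (intro AE_I2) (auto simp: \<Psi>_def indicator_def)
  qed
  moreover have "pr ` W \<inter> range pr = pr ` W" by auto
  ultimately show ?thesis
    using BR_integral[OF \<psi>(1) \<Psi>_sum] small_sets[OF W] by (simp add: space_mu)
qed

text \<open>Both the image of \<mu> under right translation by h and c times \<mu> are measures, so
  they need to be compared on images of small sets only. There both masses are limits of
  \<open>BR_lift\<close> along one sequence of test functions, translated and untranslated, and the
  assumed law relates the two limits.\<close>

lemma nn_integral_translate:
  assumes c: "c \<ge> 0" and BRc: "\<And>\<psi>. continuous_on UNIV \<psi> \<Longrightarrow>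
      BR_lift \<delta> (\<nu> base_pt) (\<lambda>g. \<psi> (psl_mult g h)) = c * BR_lift \<delta> (\<nu> base_pt) \<psi>"
    and f: "f \<in> borel_measurable \<mu>"
  shows "(\<integral>\<^sup>+x. f (x #>\<^bsub>PSL2C\<^esub> h) \<partial>\<mu>) = ennreal c * (\<integral>\<^sup>+x. f x \<partial>\<mu>)"
proof -
  obtain H where H: "H \<in> SL" "h = abs_psl2c H" by (rule abs_cases)
  define h' where "h' = abs_psl2c (adj H)"
  have hh: "psl_mult h' h = psl_one" "psl_mult h h' = psl_one"
    using H by (simp_all add: h'_def abs_mult_adj)
  have act: "(\<lambda>x. x #>\<^bsub>PSL2C\<^esub> h) \<in> \<mu> \<rightarrow>\<^sub>M XB"
    using measurable_act_const measurable_cong_sets[OF sets_mu refl] by blast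
  have eq: "emeasure (distr \<mu> XB (\<lambda>x. x #>\<^bsub>PSL2C\<^esub> h)) (pr ` W) = emeasure (scale_measure (ennreal c) \<mu>) (pr ` W)"
    if W: "small W" for W
  proof -
    \<comment> \<open>V is W translated by the inverse of h. It is small again, and its image is the
      preimage of the image of W under the action of h.\<close>
    define V where "V = {g. psl_mult g h \<in> W}"
    have "open V"
      using continuous_on_psl_mult_right[of h] W
      by (simp add: V_def small_def continuous_on_open_vimage vimage_def)
    moreover have "inj_on pr V"
    proof (rule inj_onI)
      fix x y assume xy: "x \<in> V" "y \<in> V" "pr x = pr y"
      then have "pr (psl_mult x h) = pr (psl_mult y h)" by (metis pr_act)
      moreover have "inj_on pr W" using W by (simp add: small_def)
      ultimately have "psl_mult x h = psl_mult y h"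
        using xy(1,2) by (simp add: V_def inj_on_eq_iff)
      then show "x = y" using psl.right_cancel[of h x y] by simp
    qed
    moreover have "\<exists>r'. V \<subseteq> psl_ball r'"
    proof -
      obtain r where r: "W \<subseteq> psl_ball r" using W by (auto simp: small_def)
      have "compact {adj H}" "{adj H} \<subseteq> SL" using H by auto
      then obtain r' where r': "\<And>A B. A \<in> SL \<Longrightarrow> norm A \<le> r \<Longrightarrow> B \<in> {adj H} \<Longrightarrow> norm (A ** B) \<le> r'"
        by (rule psl_ball_mult[of _ r]) blast
      have "V \<subseteq> psl_ball r'"
      proof
        fix g assume g: "g \<in> V"
        then obtain A where A: "A \<in> SL" "psl_mult g h = abs_psl2c A" "norm A \<le> r"
          using r by (auto simp: V_def psl_ball_def)
        have "g = psl_mult (psl_mult g h) h'" by (simp add: psl_assoc hh)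
        also have "\<dots> = abs_psl2c (A ** adj H)" using A H by (simp add: h'_def abs_mult)
        finally show "g \<in> psl_ball r'" using A r' H by (simp add: abs_in_psl_ball SL_mult)
      qed
      then show ?thesis by blast
    qed
    ultimately have V: "small V" by (simp add: small_def)
    obtain r where r: "V \<subseteq> psl_ball r" using V by (auto simp: small_def)
    obtain r0 where "W \<subseteq> psl_ball r0" "open W" using W by (auto simp: small_def)
    from open_psl_approx[OF this(2,1)] obtain \<psi> :: "nat \<Rightarrow> psl2c \<Rightarrow> real" where
      \<psi>: "\<And>k. \<psi> k \<in> Cc_G" "\<And>k g. 0 \<le> \<psi> k g" "\<And>k g. \<psi> k g \<le> 1" "\<And>k g. g \<notin> W \<Longrightarrow> \<psi> k g = 0"
      "\<And>g. g \<in> W \<Longrightarrow> (\<lambda>k. \<psi> k g) \<longlonglongrightarrow> 1" by metis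
    have \<psi>_cont: "continuous_on UNIV (\<psi> k)" for k using \<psi>(1) by (simp add: Cc_G_def)
    have "(\<lambda>k. BR_lift \<delta> (\<nu> base_pt) (\<lambda>g. \<psi> k (psl_mult g h))) \<longlonglongrightarrow> measure \<mu> (pr ` V)"
    proof (rule small_mass_limit[OF V])
      fix k
      show "(\<lambda>g. \<psi> k (psl_mult g h)) \<in> Cc_G"
      proof (rule Cc_GI)
        show "continuous_on UNIV (\<lambda>g. \<psi> k (psl_mult g h))"
          using \<psi>_cont continuous_on_psl_mult_right by (rule continuous_on_compose2) auto
        show "{g. \<psi> k (psl_mult g h) \<noteq> 0} \<subseteq> psl_ball r"
          using r \<psi>(4) by (auto simp: V_def)
      qed
    qed (use \<psi> in \<open>auto simp: V_def\<close>)
    moreover have "(\<lambda>k. c * BR_lift \<delta> (\<nu> base_pt) (\<psi> k)) \<longlonglongrightarrow> c * measure \<mu> (pr ` W)"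
      using small_mass_limit[OF W \<psi>] by (intro tendsto_intros)
    ultimately have m: "measure \<mu> (pr ` V) = c * measure \<mu> (pr ` W)"
      unfolding BRc[OF \<psi>_cont] by (rule LIMSEQ_unique)
    have pre: "(\<lambda>x. x #>\<^bsub>PSL2C\<^esub> h) -` (pr ` W) \<inter> space \<mu> = pr ` V"
    proof (intro equalityI subsetI)
      fix x assume "x \<in> (\<lambda>x. x #>\<^bsub>PSL2C\<^esub> h) -` (pr ` W) \<inter> space \<mu>"
      then obtain g w where g: "x = pr g" "w \<in> W" "pr (psl_mult g h) = pr w"
        by (auto simp: space_mu pr_act)
      then have "pr (psl_mult w h') = pr (psl_mult (psl_mult g h) h')" by (metis pr_act)
      then have "x = pr (psl_mult w h')" using g by (simp add: psl_assoc hh)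
      moreover have "psl_mult w h' \<in> V" using g by (simp add: V_def psl_assoc hh)
      ultimately show "x \<in> pr ` V" by blast
    qed (auto simp: V_def space_mu pr_act)
    have "emeasure (distr \<mu> XB (\<lambda>x. x #>\<^bsub>PSL2C\<^esub> h)) (pr ` W) = emeasure \<mu> (pr ` V)"
      using small_sets[OF W] by (simp add: emeasure_distr[OF act] sets_mu pre)
    also have "\<dots> = ennreal (c * measure \<mu> (pr ` W))"
      using small_fin[OF V] m by (simp add: emeasure_eq_ennreal_measure)
    also have "\<dots> = ennreal c * emeasure \<mu> (pr ` W)"
      using small_fin[OF W] c by (simp add: emeasure_eq_ennreal_measure ennreal_mult)
    finally show ?thesis by simp
  qed
  have "scale_measure (ennreal c) \<mu> = distr \<mu> XB (\<lambda>x. x #>\<^bsub>PSL2C\<^esub> h)"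
  proof (rule measure_eq_of_small)
    fix W assume W: "small W"
    show "emeasure (scale_measure (ennreal c) \<mu>) (pr ` W) = emeasure (distr \<mu> XB (\<lambda>x. x #>\<^bsub>PSL2C\<^esub> h)) (pr ` W)"
      using eq[OF W] by simp
    show "emeasure (scale_measure (ennreal c) \<mu>) (pr ` W) \<noteq> \<infinity>"
      using small_fin[OF W] by (simp add: ennreal_mult_eq_top_iff)
  qed (simp_all add: sets_mu)
  moreover have "(\<integral>\<^sup>+x. f (x #>\<^bsub>PSL2C\<^esub> h) \<partial>\<mu>) = (\<integral>\<^sup>+x. f x \<partial>(distr \<mu> XB (\<lambda>x. x #>\<^bsub>PSL2C\<^esub> h)))"
    using f act by (subst nn_integral_distr) (auto cong: measurable_cong_sets simp: sets_mu)
  ultimately show ?thesis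
    using f by (metis nn_integral_scale_measure)
qed

lemma nn_integral_n:
  "f \<in> borel_measurable \<mu> \<Longrightarrow> (\<integral>\<^sup>+x. f (x #>\<^bsub>PSL2C\<^esub> n_elt w) \<partial>\<mu>) = (\<integral>\<^sup>+x. f x \<partial>\<mu>)"
  using nn_integral_translate[of 1 "n_elt w" f] by (simp add: BR_lift_translate_n)

lemma nn_integral_a:
  "f \<in> borel_measurable \<mu> \<Longrightarrow>
     (\<integral>\<^sup>+x. f (x #>\<^bsub>PSL2C\<^esub> a_elt t) \<partial>\<mu>) = ennreal (exp ((\<delta> - 2) * t)) * (\<integral>\<^sup>+x. f x \<partial>\<mu>)"
  using nn_integral_translate[of "exp ((\<delta> - 2) * t)" "a_elt t" f] by (simp add: BR_lift_translate_a)

end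

section \<open>Limit sets and the compact subgroups\<close>

lemma moebius_abs: "A \<in> SL \<Longrightarrow> moebius (abs_psl2c A) = moebius_mat A"
  and hact_abs: "A \<in> SL \<Longrightarrow> hact (abs_psl2c A) = hact_mat A"
  by (simp_all add: moebius.abs_eq hact.abs_eq SL_rel)

text \<open>Continuity of \<open>bdry_pt\<close>, on the two kinds of open sets of a one-point
  compactification. For neighbourhoods of infinity the compact complement is cut with the boundary
  plane, which leaves a compact set.\<close>

lemma openin_bdry_of_H3_closure:
  assumes "openin H3_closure_top V"
  shows "openin bdry_top {\<xi>. bdry_pt \<xi> \<in> V}"
proof -
  let ?H = "top_of_set {p :: complex \<times> real. snd p \<ge> 0}"
  consider (1) U where "openin ?H U" "V = Some ` U"
    | (2) C where "compactin ?H C" "V = insert None (Some ` (topspace ?H - C))"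
    using assms by (auto simp: H3_closure_top_def openin_Alexandroff_compactification)
  then show ?thesis
  proof cases
    case 1
    then obtain T where T: "open T" "U = {p. snd p \<ge> 0} \<inter> T" by (auto simp: openin_open)
    have "bdry_pt \<xi> \<in> V \<longleftrightarrow> \<xi> \<in> Some ` {w. (w, 0) \<in> T}" for \<xi>
      using T 1 by (cases \<xi>) (auto simp: bdry_pt_def)
    then have "{\<xi>. bdry_pt \<xi> \<in> V} = Some ` {w. (w, 0) \<in> T}" by blast
    moreover have "open ((\<lambda>w. (w, 0)) -` T)"
      using T(1) by (intro open_vimage continuous_intros)
    ultimately show ?thesis
      by (auto simp: bdry_top_def openin_Alexandroff_compactification vimage_def)
  next
    case 2
    define C' where "C' = {w. (w, 0) \<in> C}"
    have "bdry_pt \<xi> \<in> V \<longleftrightarrow> \<xi> \<in> insert None (Some ` (- C'))" for \<xi>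
      using 2 by (cases \<xi>) (auto simp: bdry_pt_def C'_def)
    then have "{\<xi>. bdry_pt \<xi> \<in> V} = insert None (Some ` (- C'))" by blast
    moreover have "compact C'"
    proof -
      have "compact C" using 2 by (simp add: compactin_subtopology)
      then have "compact (C \<inter> {p. snd p = 0})"
        by (intro compact_Int_closed closed_Collect_eq continuous_intros)
      then have "compact (fst ` (C \<inter> {p. snd p = 0}))"
        by (intro compact_continuous_image continuous_intros)
      also have "fst ` (C \<inter> {p. snd p = 0}) = C'" by (force simp: C'_def)
      finally show ?thesis .
    qed
    ultimately show ?thesis
      by (auto simp: bdry_top_def openin_Alexandroff_compactification Compl_eq_Diff_UNIV
            compact_imp_closed intro!: exI[of _ C'])
  qed
qed

text \<open>Continuity of g to g(0). Near infinity division is avoided: g(0) lies in the compact set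
  C exactly when b = w d for some w in C, and projecting a closed condition along a compact factor
  is closed.\<close>

lemma open_moebius_0:
  assumes "openin bdry_top V"
  shows "open {g. moebius g (Some 0) \<in> V}"
proof -
  consider (1) U where "open U" "V = Some ` U"
    | (2) C where "compact C" "V = insert None (Some ` (- C))"
    using assms by (auto simp: bdry_top_def openin_Alexandroff_compactification Compl_eq_Diff_UNIV)
  then show ?thesis
  proof cases
    case 1
    have "open ({A :: complex^2^2. A$2$2 \<noteq> 0} \<inter> (\<lambda>A. A$1$2 / A$2$2) -` U)"
      by (intro continuous_open_preimage 1 open_Collect_neq continuous_intros) auto
    moreover have "{A \<in> SL. abs_psl2c A \<in> {g. moebius g (Some 0) \<in> V}} =
        SL \<inter> ({A. A$2$2 \<noteq> 0} \<inter> (\<lambda>A. A$1$2 / A$2$2) -` U)"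
      using 1 by (auto simp: moebius_abs moebius_mat_def Let_def split: if_splits)
    ultimately show ?thesis by (auto simp: open_psl_iff openin_open_Int)
  next
    case 2
    define T where "T = {A :: complex^2^2. \<exists>w. w \<in> C \<and> (w, A) \<in> {p. snd p$1$2 = fst p * snd p$2$2}}"
    have "closed T"
      unfolding T_def
      by (intro closed_compact_projection 2 closed_Collect_eq continuous_intros)
    moreover have "moebius (abs_psl2c A) (Some 0) \<in> V \<longleftrightarrow> A \<notin> T" if A: "A \<in> SL" for A
    proof (cases "A$2$2 = 0")
      case True
      then have "A$1$2 \<noteq> 0" using A by (auto simp: SL_iff)
      then show ?thesis using 2 True A by (simp add: moebius_abs moebius_mat_def T_def)
    next
      case False
      then have "A$1$2 = w * A$2$2 \<longleftrightarrow> w = A$1$2 / A$2$2" for w by (auto simp: field_simps)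
      then have "A \<in> T \<longleftrightarrow> A$1$2 / A$2$2 \<in> C" unfolding T_def by simp
      then show ?thesis using 2 False by (auto simp: moebius_abs[OF A] moebius_mat_def)
    qed
    then have "{A \<in> SL. abs_psl2c A \<in> {g. moebius g (Some 0) \<in> V}} = SL \<inter> - T"
      by blast
    ultimately show ?thesis by (auto simp: open_psl_iff openin_open_Int)
  qed
qed

lemma hact_den_pos:
  assumes "p \<in> H3" "A \<in> SL"
  shows "(cmod (A$2$1 * fst p + A$2$2))\<^sup>2 + (cmod (A$2$1))\<^sup>2 * (snd p)\<^sup>2 > 0"
proof (cases "A$2$1 = 0")
  case True
  then have "A$2$2 \<noteq> 0" using assms(2) by (auto simp: SL_iff)
  then show ?thesis using True by simp
next
  case False
  then show ?thesis using assms(1) by (simp add: H3_def add_nonneg_pos)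
qed

lemma horbit_H3:
  assumes "p \<in> H3" "A \<in> SL" shows "hact (abs_psl2c A) p \<in> H3"
  using assms(1) hact_den_pos[OF assms]
  by (simp add: hact_abs[OF assms(2)] hact_mat_def H3_def Let_def case_prod_unfold)

text \<open>Orbit points lie in the open half-space and limit points on the boundary, so being an
  accumulation point of the orbit means meeting it in every neighbourhood. The complement is thus
  the trace of an open set, the union of all open sets that miss the orbit.\<close>

lemma closed_limit_set: "openin bdry_top (- limit_set \<Gamma>)"
proof -
  define O' where "O' = \<Union>{V. openin H3_closure_top V \<and> V \<inter> Some ` horbit \<Gamma> base_pt = {}}"
  have "\<xi> \<notin> limit_set \<Gamma> \<longleftrightarrow> bdry_pt \<xi> \<in> O'" for \<xi>
  proof -
    have top: "bdry_pt \<xi> \<in> topspace H3_closure_top"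
      by (cases \<xi>) (auto simp: bdry_pt_def H3_closure_top_def)
    have nin: "bdry_pt \<xi> \<notin> Some ` horbit \<Gamma> base_pt"
    proof
      assume "bdry_pt \<xi> \<in> Some ` horbit \<Gamma> base_pt"
      then obtain g where "bdry_pt \<xi> = Some (hact g base_pt)" by (auto simp: horbit_def)
      moreover have "hact g base_pt \<in> H3"
        using horbit_H3[of base_pt] by (metis abs_cases H3_def base_pt_def mem_Collect_eq snd_conv zero_less_one)
      ultimately show False by (cases \<xi>) (auto simp: bdry_pt_def H3_def, metis less_irrefl snd_conv)
    qed
    have aux: "b \<notin> S \<Longrightarrow> (P \<and> b \<in> V \<and> (\<forall>y\<in>S. y \<in> V \<longrightarrow> y = b)) \<longleftrightarrow> (P \<and> b \<in> V \<and> V \<inter> S = {})"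
      for b :: "(complex \<times> real) option" and S V P by auto
    have "\<xi> \<notin> limit_set \<Gamma> \<longleftrightarrow> (\<exists>V. openin H3_closure_top V \<and> bdry_pt \<xi> \<in> V \<and>
        (\<forall>y\<in>Some ` horbit \<Gamma> base_pt. y \<in> V \<longrightarrow> y = bdry_pt \<xi>))"
      unfolding limit_set_def derived_set_of_def using top by blast
    also have "\<dots> \<longleftrightarrow> (\<exists>V. openin H3_closure_top V \<and> bdry_pt \<xi> \<in> V \<and> V \<inter> Some ` horbit \<Gamma> base_pt = {})"
      by (intro ex_cong1 aux nin)
    also have "\<dots> \<longleftrightarrow> bdry_pt \<xi> \<in> O'" by (auto simp only: O'_def)
    finally show ?thesis .
  qed
  then have "- limit_set \<Gamma> = {\<xi>. bdry_pt \<xi> \<in> O'}" by auto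
  moreover have "openin H3_closure_top O'" unfolding O'_def by auto
  ultimately show ?thesis using openin_bdry_of_H3_closure by simp
qed

lemma sets_bdry: "openin bdry_top V \<Longrightarrow> V \<in> sets (borel_of_top bdry_top)"
  unfolding borel_of_top_def
  by (subst sets_measure_of) (auto dest: openin_subset)

text \<open>The choice in \<open>k_rep\<close> is backed by explicit unitary matrices that carry 0
  to the given point.\<close>

lemma k_rep: "k_rep \<xi> \<in> K_grp" "moebius (k_rep \<xi>) (Some 0) = \<xi>"
proof -
  have "\<exists>k. k \<in> K_grp \<and> moebius k (Some 0) = \<xi>"
  proof (cases \<xi>)
    case None
    have "mat2 0 1 (- 1) 0 \<in> SL" by (simp add: SL_mat2)
    then show ?thesis
      by (intro exI[of _ "abs_psl2c (mat2 0 1 (- 1) 0)"])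
         (simp add: K_grp_def hact_abs moebius_abs hact_mat_def moebius_mat_def base_pt_def None)
  next
    case (Some w)
    \<comment> \<open>The normalisation that gives determinant 1 to the matrix with rows (1, w) and
      (- cnj w, 1).\<close>
    define r where "r = 1 / sqrt (1 + (cmod w)\<^sup>2)"
    define A where "A = mat2 (of_real r) (w * of_real r) (- cnj w * of_real r) (of_real r)"
    have pos: "1 + (cmod w)\<^sup>2 > 0" by (simp add: add_pos_nonneg)
    then have r: "r > 0" "r\<^sup>2 * (1 + (cmod w)\<^sup>2) = 1"
      by (auto simp: r_def power_divide)
    have "complex_of_real (r\<^sup>2 * (1 + (cmod w)\<^sup>2)) = 1" using r(2) by simp
    then have A: "A \<in> SL"
      unfolding A_def SL_mat2 of_real_mult of_real_add complex_norm_square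
      by (simp add: algebra_simps power2_eq_square)
    have "(cmod (of_real r))\<^sup>2 + (cmod (- cnj w * of_real r))\<^sup>2 = 1"
      using r by (simp add: norm_mult power_mult_distrib algebra_simps)
    then have "hact_mat A (0, 1) = (0, 1)"
      by (simp add: hact_mat_def A_def Let_def norm_mult power_mult_distrib)
    moreover have "moebius_mat A (Some 0) = Some w"
      using r by (simp add: moebius_mat_def A_def)
    ultimately show ?thesis
      using Some by (intro exI[of _ "abs_psl2c A"]) (simp add: K_grp_def hact_abs moebius_abs A base_pt_def)
  qed
  from someI_ex[OF this] show "k_rep \<xi> \<in> K_grp" "moebius (k_rep \<xi>) (Some 0) = \<xi>"
    by (auto simp: k_rep_def)
qed

section \<open>The circle group M and the topology of the group\<close>

definition m_mat :: "real \<Rightarrow> complex^2^2" where "m_mat \<theta> = mat2 (cis \<theta>) 0 0 (cis (- \<theta>))"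

definition m_elt :: "real \<Rightarrow> psl2c" where "m_elt \<theta> = abs_psl2c (m_mat \<theta>)"

lemma m_mat_SL [simp]: "m_mat \<theta> \<in> SL"
  by (simp add: m_mat_def SL_mat2 cis_mult)

lemma m_elt_add: "psl_mult (m_elt \<theta>) (m_elt \<phi>) = m_elt (\<theta> + \<phi>)"
  by (simp add: m_elt_def abs_mult) (simp add: m_mat_def mat2_mult cis_mult)

lemma m_elt_periodic: "m_elt (2 * pi + \<theta>) = m_elt \<theta>"
proof -
  have "cis (2 * pi + \<theta>) = cis \<theta>" "cis (- (2 * pi) - \<theta>) = cis (- \<theta>)"
    by (simp_all add: complex_eq_iff cos_diff sin_diff cos_add sin_add)
  then show ?thesis by (simp add: m_elt_def m_mat_def)
qed

text \<open>Commuting with one nontrivial a_s already forces a diagonal matrix, and fixing the base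
  point forces unimodular entries.\<close>

lemma M_grp_eq: "M_grp = range m_elt"
proof (intro equalityI subsetI)
  fix m assume "m \<in> range m_elt"
  then obtain \<theta> where m: "m = m_elt \<theta>" by auto
  have "m \<in> K_grp"
    unfolding m K_grp_def m_elt_def mem_Collect_eq hact_abs[OF m_mat_SL]
    by (simp add: hact_mat_def m_mat_def base_pt_def)
  moreover have "psl_mult m (a_elt s) = psl_mult (a_elt s) m" for s
    by (simp add: m m_elt_def a_elt_abs abs_mult) (simp add: m_mat_def a_mat_def mat2_mult mult.commute)
  ultimately show "m \<in> M_grp" by (simp add: M_grp_def)
next
  fix m assume m: "m \<in> M_grp"
  obtain A where A: "A \<in> SL" "m = abs_psl2c A" by (rule abs_cases)
  \<comment> \<open>The value 2 gives diagonal entries exp 1 and exp (-1). In the quotient the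
    commutation holds up to sign, so both exp (-1) \<noteq> exp 1 and exp (-1) \<noteq> - exp 1 are
    used.\<close>
  have "psl_mult m (a_elt 2) = psl_mult (a_elt 2) m" using m by (simp add: M_grp_def)
  then have "A ** a_mat 2 = a_mat 2 ** A \<or> A ** a_mat 2 = - (a_mat 2 ** A)"
    by (simp add: A a_elt_abs abs_mult abs_eq_iff SL_mult)
  then have b: "A$1$2 * exp (- 1) = A$1$2 * exp 1 \<or> A$1$2 * exp (- 1) = - (A$1$2 * exp 1)"
    and c: "A$2$1 * exp 1 = A$2$1 * exp (- 1) \<or> A$2$1 * exp 1 = - (A$2$1 * exp (- 1))"
    by (auto simp: mat_eq_2 mult_nth a_mat_def mult.commute exp_of_real[symmetric])
  have "exp (- 1 :: real) < 1" "1 < exp (1 :: real)" "0 < exp (- 1 :: real)" by simp_all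
  then have "exp (- 1 :: real) \<noteq> exp 1" "exp (- 1 :: real) \<noteq> - exp 1" by linarith+
  then have "complex_of_real (exp (- 1)) \<noteq> complex_of_real (exp 1)"
    "complex_of_real (exp (- 1)) \<noteq> complex_of_real (- exp 1)"
    unfolding of_real_eq_iff by auto
  then have ne: "exp (- 1 :: complex) \<noteq> exp 1" "exp (- 1 :: complex) \<noteq> - exp 1"
    by (simp_all flip: exp_of_real)
  have "A$1$2 * (exp (- 1) - exp 1) = 0 \<or> A$1$2 * (exp (- 1) - - exp 1) = 0"
    using b by (simp only: right_diff_distrib mult_minus_right) auto
  then have b0: "A$1$2 = 0" using ne by (auto simp: eq_neg_iff_add_eq_0)
  have "A$2$1 * (exp (- 1) - exp 1) = 0 \<or> A$2$1 * (exp (- 1) - - exp 1) = 0"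
    using c by (simp only: right_diff_distrib mult_minus_right) auto
  then have c0: "A$2$1 = 0" using ne by (auto simp: eq_neg_iff_add_eq_0)
  have "hact m base_pt = base_pt" using m by (simp add: M_grp_def K_grp_def)
  then have "inverse ((cmod (A$2$2))\<^sup>2) = 1"
    using b0 c0 by (simp add: A hact_abs[OF A(1)] hact_mat_def base_pt_def Let_def divide_inverse)
  then have "cmod (A$2$2) = 1"
    by (simp add: inverse_eq_1_iff power2_eq_1_iff) (metis norm_ge_zero not_one_le_zero minus_equation_iff neg_0_le_iff_le zero_le_one le_minus_one_simps(3))
  then obtain \<theta> where \<theta>: "A$2$2 = cis \<theta>"
    by (metis complex_norm_eq_1_exp cis_conv_exp)
  moreover have "A$1$1 * A$2$2 = 1" using A(1) b0 by (simp add: SL_iff)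
  then have "A$1$1 = cis (- \<theta>)"
    unfolding \<theta> by (metis cis_inverse inverse_unique mult.commute)
  ultimately have "A = m_mat (- \<theta>)"
    using b0 c0 by (simp add: mat_eq_2 m_mat_def)
  then show "m \<in> range m_elt" by (auto simp: A m_elt_def)
qed

text \<open>Serves \<open>borel_prod\<close>: the Borel sets of a product with the group are
  generated by measurable rectangles.\<close>

instance psl2c :: second_countable_topology
proof
  obtain \<B> :: "(complex^2^2) set set" where \<B>: "countable \<B>" "topological_basis \<B>"
    using ex_countable_basis by auto
  have "topological_basis ((\<lambda>b. abs_psl2c ` (SL \<inter> b)) ` \<B>)"
  proof (rule topological_basisI)
    show "\<And>B'. B' \<in> (\<lambda>b. abs_psl2c ` (SL \<inter> b)) ` \<B> \<Longrightarrow> open B'"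
      using topological_basis_open[OF \<B>(2)] by (auto intro: open_abs_image)
    fix V and g :: psl2c assume V: "open V" "g \<in> V"
    obtain A where A: "A \<in> SL" "g = abs_psl2c A" by (rule abs_cases)
    obtain T where T: "open T" "{A \<in> SL. abs_psl2c A \<in> V} = SL \<inter> T"
      using V unfolding open_psl_iff openin_open by auto
    then have "A \<in> T" using A V by auto
    then obtain b where "b \<in> \<B>" "A \<in> b" "b \<subseteq> T"
      using topological_basisE[OF \<B>(2) T(1)] by metis
    then show "\<exists>B'\<in>(\<lambda>b. abs_psl2c ` (SL \<inter> b)) ` \<B>. g \<in> B' \<and> B' \<subseteq> V"
      using A T(2) by (intro bexI[of _ "abs_psl2c ` (SL \<inter> b)"]) auto
  qed
  then show "\<exists>B :: psl2c set set. countable B \<and> open = generate_topology B"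
    using \<B>(1) topological_basis_imp_subbasis by (metis countable_image)
qed

text \<open>A product of a quotient map with an identity need not be a quotient map, so joint
  continuity is not read off from matrices directly; openness of the projection
  (\<open>open_abs_image\<close>) carries product neighbourhoods down.\<close>

lemma continuous_on_m_mult: "continuous_on UNIV (\<lambda>(\<theta>, g). psl_mult (m_elt \<theta>) g)"
  unfolding continuous_on_open_vimage[OF open_UNIV]
proof (intro allI impI)
  fix U :: "psl2c set" assume U: "open U"
  define f where "f = (\<lambda>(\<theta>, A). abs_psl2c (m_mat \<theta> ** A))"
  have f: "continuous_on (UNIV \<times> SL) f"
    unfolding f_def case_prod_unfold
    by (rule continuous_on_compose2[OF continuous_on_abs])
       (auto simp: m_mat_def intro!: continuous_intros SL_mult[OF m_mat_SL, unfolded m_mat_def])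
  then obtain Q where Q: "open Q" "Q \<inter> UNIV \<times> SL = f -` U \<inter> UNIV \<times> SL"
    using U unfolding continuous_on_open_invariant by metis
  have "open ((\<lambda>(\<theta>, g). psl_mult (m_elt \<theta>) g) -` U)"
  proof (rule open_prod_intro)
    fix p assume "p \<in> (\<lambda>(\<theta>, g). psl_mult (m_elt \<theta>) g) -` U"
    then obtain \<theta> A where p: "p = (\<theta>, abs_psl2c A)" "A \<in> SL" "psl_mult (m_elt \<theta>) (abs_psl2c A) \<in> U"
      by (metis (mono_tags, lifting) abs_cases case_prod_conv surj_pair vimageD)
    then have "(\<theta>, A) \<in> Q \<inter> UNIV \<times> SL" unfolding Q(2) by (simp add: f_def m_elt_def abs_mult)
    then obtain T1 T2 where T: "open T1" "open T2" "\<theta> \<in> T1" "A \<in> T2" "T1 \<times> T2 \<subseteq> Q"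
      using Q(1) by (metis IntE open_prod_elim mem_Sigma_iff)
    have "T1 \<times> abs_psl2c ` (SL \<inter> T2) \<subseteq> (\<lambda>(\<theta>, g). psl_mult (m_elt \<theta>) g) -` U"
    proof safe
      fix \<phi> B assume "\<phi> \<in> T1" "B \<in> T2" "B \<in> SL"
      then have "(\<phi>, B) \<in> Q \<inter> UNIV \<times> SL" using T by auto
      then show "(\<phi>, abs_psl2c B) \<in> (\<lambda>(\<theta>, g). psl_mult (m_elt \<theta>) g) -` U"
        unfolding Q(2) using \<open>B \<in> SL\<close> by (simp add: f_def m_elt_def abs_mult)
    qed
    then show "\<exists>A B. open A \<and> open B \<and> p \<in> A \<times> B \<and> A \<times> B \<subseteq> (\<lambda>(\<theta>, g). psl_mult (m_elt \<theta>) g) -` U"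
      using T p open_abs_image[OF T(2)]
      by (intro exI[of _ T1] exI[of _ "abs_psl2c ` (SL \<inter> T2)"]) auto
  qed
  then show "open ((\<lambda>(\<theta>, g). psl_mult (m_elt \<theta>) g) -` U \<inter> UNIV)" by simp
qed

section \<open>Haar measure on M and the support of the Burger--Roblin measure\<close>

abbreviation "M_sets \<equiv> restrict_space borel M_grp"

lemma space_M_sets [simp]: "space M_sets = M_grp"
  by (simp add: space_restrict_space)

lemma m_elt_mult_mem: "x \<in> M_grp \<Longrightarrow> psl_mult (m_elt \<theta>) x \<in> M_grp"
  by (auto simp: M_grp_eq m_elt_add)

lemma measurable_m_elt: "m_elt \<in> borel \<rightarrow>\<^sub>M M_sets"
proof (rule measurable_restrict_space2)
  show "m_elt \<in> space borel \<rightarrow> M_grp" by (auto simp: M_grp_eq)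
  have "continuous_on UNIV (\<lambda>\<theta>. psl_mult (m_elt \<theta>) psl_one)"
    using continuous_on_compose2[OF continuous_on_m_mult, of UNIV "\<lambda>\<theta>. (\<theta>, psl_one)"]
    by (simp add: continuous_intros)
  then show "m_elt \<in> borel_measurable borel"
    by (simp add: borel_measurable_continuous_onI)
qed

lemma measurable_m_mult: "(\<lambda>(\<theta>, x). psl_mult (m_elt \<theta>) x) \<in> borel \<Otimes>\<^sub>M M_sets \<rightarrow>\<^sub>M M_sets"
proof (rule measurable_restrict_space2)
  show "(\<lambda>(\<theta>, x). psl_mult (m_elt \<theta>) x) \<in> space (borel \<Otimes>\<^sub>M M_sets) \<rightarrow> M_grp"
    by (auto simp: space_pair_measure m_elt_mult_mem)
  have 1: "(\<lambda>(\<theta>, x). psl_mult (m_elt \<theta>) x) \<in> borel_measurable (borel \<Otimes>\<^sub>M borel)"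
    using borel_measurable_continuous_onI[OF continuous_on_m_mult] by (simp add: borel_prod)
  have 2: "(\<lambda>p. (fst p, snd p)) \<in> borel \<Otimes>\<^sub>M M_sets \<rightarrow>\<^sub>M borel \<Otimes>\<^sub>M borel"
    by (intro measurable_Pair measurable_fst measurable_compose[OF measurable_snd]
        measurable_restrict_space1 measurable_ident_sets refl)
  show "(\<lambda>(\<theta>, x). psl_mult (m_elt \<theta>) x) \<in> borel_measurable (borel \<Otimes>\<^sub>M M_sets)"
    using measurable_compose[OF 2 1] by (simp add: case_prod_unfold)
qed

lemma measurable_m_mult': "psl_mult (m_elt \<theta>) \<in> M_sets \<rightarrow>\<^sub>M M_sets"
  using measurable_compose[OF measurable_Pair1' measurable_m_mult, of \<theta>] by simp

lemma nn_integral_periodic: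
  fixes f :: "real \<Rightarrow> ennreal"
  assumes f [measurable]: "f \<in> borel_measurable borel" and per: "\<And>\<theta>. f (2 * pi + \<theta>) = f \<theta>"
  shows "(\<integral>\<^sup>+\<theta>\<in>{0..<2*pi}. f (\<alpha> + \<theta>) \<partial>lborel) = (\<integral>\<^sup>+\<theta>\<in>{0..<2*pi}. f \<theta> \<partial>lborel)"
proof -
  have shift: "(\<integral>\<^sup>+\<theta>\<in>{a..<b}. f \<theta> \<partial>lborel) = (\<integral>\<^sup>+\<theta>\<in>{a - c..<b - c}. f (c + \<theta>) \<partial>lborel)" for a b c
    by (subst nn_integral_real_affine[where c=1 and t=c])
       (auto intro!: nn_integral_cong simp: indicator_def)
  have split: "(\<integral>\<^sup>+\<theta>\<in>{a..<c}. f \<theta> \<partial>lborel) = (\<integral>\<^sup>+\<theta>\<in>{a..<b}. f \<theta> \<partial>lborel) + (\<integral>\<^sup>+\<theta>\<in>{b..<c}. f \<theta> \<partial>lborel)"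
    if "a \<le> b" "b \<le> c" for a b c
    using that by (subst nn_integral_add[symmetric]) (auto intro!: nn_integral_cong simp: indicator_def)
  have small: "(\<integral>\<^sup>+\<theta>\<in>{0..<2*pi}. f (\<alpha> + \<theta>) \<partial>lborel) = (\<integral>\<^sup>+\<theta>\<in>{0..<2*pi}. f \<theta> \<partial>lborel)"
    if \<alpha>: "0 \<le> \<alpha>" "\<alpha> \<le> 2 * pi" for \<alpha>
  proof -
    have "(\<integral>\<^sup>+\<theta>\<in>{0..<2*pi}. f (\<alpha> + \<theta>) \<partial>lborel) = (\<integral>\<^sup>+\<theta>\<in>{\<alpha>..<2*pi + \<alpha>}. f \<theta> \<partial>lborel)"
      using shift[of \<alpha> "2*pi + \<alpha>" \<alpha>] by simp
    also have "\<dots> = (\<integral>\<^sup>+\<theta>\<in>{\<alpha>..<2*pi}. f \<theta> \<partial>lborel) + (\<integral>\<^sup>+\<theta>\<in>{2*pi..<2*pi + \<alpha>}. f \<theta> \<partial>lborel)"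
      by (rule split) (use \<alpha> in auto)
    also have "(\<integral>\<^sup>+\<theta>\<in>{2*pi..<2*pi + \<alpha>}. f \<theta> \<partial>lborel) = (\<integral>\<^sup>+\<theta>\<in>{0..<\<alpha>}. f \<theta> \<partial>lborel)"
      using shift[of "2*pi" "2*pi + \<alpha>" "2*pi"] by (simp add: per)
    also have "(\<integral>\<^sup>+\<theta>\<in>{\<alpha>..<2*pi}. f \<theta> \<partial>lborel) + \<dots> = (\<integral>\<^sup>+\<theta>\<in>{0..<2*pi}. f \<theta> \<partial>lborel)"
      using split[of 0 \<alpha> "2*pi"] \<alpha> by (simp add: add.commute)
    finally show ?thesis .
  qed
  have per_nat: "f (2 * pi * real n + \<theta>) = f \<theta>" for n \<theta>
  proof (induction n)
    case (Suc n)
    have "f (2 * pi * real (Suc n) + \<theta>) = f (2 * pi + (2 * pi * real n + \<theta>))"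
      by (simp add: algebra_simps)
    then show ?case using Suc per by simp
  qed simp
  have per_int: "f (2 * pi * of_int k + \<theta>) = f \<theta>" for k \<theta>
  proof (cases k)
    case (nonneg n)
    then show ?thesis using per_nat by simp
  next
    case (neg n)
    have "f \<theta> = f (2 * pi * real (Suc n) + (2 * pi * of_int k + \<theta>))"
      by (simp add: neg algebra_simps)
    also have "\<dots> = f (2 * pi * of_int k + \<theta>)" by (rule per_nat)
    finally show ?thesis by simp
  qed
  \<comment> \<open>Reduces the shift to one period, where the shifted interval is cut at 2 pi and
    the overhang is moved back.\<close>
  define k where "k = \<lfloor>\<alpha> / (2 * pi)\<rfloor>"
  define \<beta> where "\<beta> = \<alpha> - 2 * pi * of_int k"
  have "of_int k \<le> \<alpha> / (2 * pi)" "\<alpha> / (2 * pi) < of_int k + 1" unfolding k_def by linarith+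
  then have "0 \<le> \<beta>" "\<beta> \<le> 2 * pi"
    by (auto simp: \<beta>_def field_simps)
  moreover have "f (\<alpha> + \<theta>) = f (\<beta> + \<theta>)" for \<theta>
    using per_int[of k "\<beta> + \<theta>"] by (simp add: \<beta>_def algebra_simps)
  ultimately show ?thesis using small[of \<beta>] by simp
qed

text \<open>The interval winds twice around M, as \<theta> and \<theta> + pi give opposite matrices;
  division by 2 pi still yields total mass 1.\<close>

definition unif_M :: "psl2c measure" where
  "unif_M = scale_measure (ennreal (1 / (2 * pi))) (distr (restrict_space lborel {0..<2*pi}) M_sets m_elt)"

lemma sets_unif_M [simp]: "sets unif_M = sets M_sets"
  by (simp add: unif_M_def)

lemma emeasure_unif_M:
  assumes "A \<in> sets M_sets"
  shows "emeasure unif_M A = ennreal (1 / (2 * pi)) * (\<integral>\<^sup>+\<theta>\<in>{0..<2*pi}. indicator A (m_elt \<theta>) \<partial>lborel)"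
proof -
  have m: "m_elt \<in> restrict_space lborel {0..<2*pi} \<rightarrow>\<^sub>M M_sets"
    using measurable_m_elt by (intro measurable_restrict_space1) simp
  have "emeasure (distr (restrict_space lborel {0..<2*pi}) M_sets m_elt) A =
      (\<integral>\<^sup>+x. indicator A x \<partial>(distr (restrict_space lborel {0..<2*pi}) M_sets m_elt))"
    using assms by (subst nn_integral_indicator) auto
  also have "\<dots> = (\<integral>\<^sup>+\<theta>\<in>{0..<2*pi}. indicator A (m_elt \<theta>) \<partial>lborel)"
    using assms m by (subst nn_integral_distr) (auto simp: nn_integral_restrict_space)
  finally show ?thesis by (simp add: unif_M_def)
qed

text \<open>Until the description is shown to be met by exactly one measure, not even the underlying
  space of \<open>haar_M\<close> is known. Uniqueness is the usual averaging: an invariant measure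
  of A equals its mean over all rotations of A, and exchanging the integrals leaves the uniform
  measure of A.\<close>

lemma haar_M_unif: "haar_M = unif_M"
  unfolding haar_M_def
proof (rule the_equality)
  let ?c = "ennreal (1 / (2 * pi))"
  have rot: "(\<integral>\<^sup>+\<theta>\<in>{0..<2*pi}. indicator A (m_elt (\<alpha> + \<theta>)) \<partial>lborel) =
        (\<integral>\<^sup>+\<theta>\<in>{0..<2*pi}. indicator A (m_elt \<theta>) \<partial>lborel)"
    if "A \<in> sets M_sets" for A \<alpha>
    using measurable_compose[OF measurable_m_elt borel_measurable_indicator[OF that]]
    by (intro nn_integral_periodic) (simp_all add: m_elt_periodic)
  have c: "?c * (\<integral>\<^sup>+\<theta>\<in>{0..<2*pi}. 1 \<partial>lborel) = 1"
    by (simp add: ennreal_mult[symmetric])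
  show "sets unif_M = sets M_sets \<and> prob_space unif_M \<and>
     (\<forall>h\<in>M_grp. distr unif_M unif_M (\<lambda>m. h \<otimes>\<^bsub>PSL2C\<^esub> m) = unif_M)"
  proof (intro conjI ballI)
    have "M_grp \<in> sets M_sets" by (metis sets.top space_M_sets)
    moreover have "indicator M_grp (m_elt \<theta>) = (1 :: ennreal)" for \<theta>
      by (simp add: M_grp_eq)
    ultimately have "emeasure unif_M M_grp = 1"
      using c by (simp only: emeasure_unif_M)
    then show "prob_space unif_M"
      using sets_eq_imp_space_eq[OF sets_unif_M] by (intro prob_spaceI) simp
    fix h assume "h \<in> M_grp"
    then obtain \<alpha> where h: "h = m_elt \<alpha>" by (auto simp: M_grp_eq)
    have "distr unif_M unif_M (psl_mult h) = unif_M"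
    proof (rule measure_eqI)
      fix A assume "A \<in> sets (distr unif_M unif_M (psl_mult h))"
      then have A: "A \<in> sets M_sets" by simp
      have meas: "psl_mult h \<in> unif_M \<rightarrow>\<^sub>M unif_M"
        using measurable_m_mult' measurable_cong_sets[OF sets_unif_M sets_unif_M] by (auto simp: h)
      have pre: "psl_mult h -` A \<inter> space unif_M \<in> sets M_sets"
        using measurable_sets[OF meas] A by simp
      have "space unif_M = M_grp" using sets_eq_imp_space_eq[OF sets_unif_M] by simp
      then have ind: "indicator (psl_mult h -` A \<inter> space unif_M) (m_elt \<theta>) =
          (indicator A (m_elt (\<alpha> + \<theta>)) :: ennreal)" for \<theta>
        by (simp add: indicator_def h m_elt_add M_grp_eq)
      have "emeasure (distr unif_M unif_M (psl_mult h)) A = emeasure unif_M (psl_mult h -` A \<inter> space unif_M)"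
        using A by (intro emeasure_distr meas) simp
      also have "\<dots> = ?c * (\<integral>\<^sup>+\<theta>\<in>{0..<2*pi}. indicator A (m_elt (\<alpha> + \<theta>)) \<partial>lborel)"
        by (simp only: emeasure_unif_M[OF pre] ind)
      also have "\<dots> = emeasure unif_M A" by (simp only: rot[OF A] emeasure_unif_M[OF A])
      finally show "emeasure (distr unif_M unif_M (psl_mult h)) A = emeasure unif_M A" .
    qed simp
    then show "distr unif_M unif_M (\<lambda>m. h \<otimes>\<^bsub>PSL2C\<^esub> m) = unif_M" by simp
  qed simp
  fix \<mu> assume \<mu>: "sets \<mu> = sets M_sets \<and> prob_space \<mu> \<and>
     (\<forall>h\<in>M_grp. distr \<mu> \<mu> (\<lambda>m. h \<otimes>\<^bsub>PSL2C\<^esub> m) = \<mu>)"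
  then have sets_\<mu>: "sets \<mu> = sets M_sets" by simp
  then have space_\<mu>: "space \<mu> = M_grp" using sets_eq_imp_space_eq[OF sets_\<mu>] by simp
  interpret \<mu>: prob_space \<mu> using \<mu> by simp
  interpret pair_sigma_finite lborel \<mu> ..
  show "\<mu> = unif_M"
  proof (rule measure_eqI)
    fix A assume "A \<in> sets \<mu>"
    then have A: "A \<in> sets M_sets" using sets_\<mu> by simp
    have meas: "psl_mult (m_elt \<theta>) \<in> \<mu> \<rightarrow>\<^sub>M \<mu>" for \<theta>
      using measurable_m_mult' measurable_cong_sets[OF sets_\<mu> sets_\<mu>] by auto
    have "(\<lambda>(\<theta>, x). psl_mult (m_elt \<theta>) x) \<in> lborel \<Otimes>\<^sub>M \<mu> \<rightarrow>\<^sub>M M_sets"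
      using measurable_m_mult
      by (subst measurable_cong_sets[OF sets_pair_measure_cong[OF sets_lborel sets_\<mu>] refl])
    from measurable_compose[OF this borel_measurable_indicator[OF A]]
    have joint: "(\<lambda>(\<theta>, x). indicator A (psl_mult (m_elt \<theta>) x) * indicator {0..<2*pi} \<theta> :: ennreal)
        \<in> borel_measurable (lborel \<Otimes>\<^sub>M \<mu>)"
      by (auto simp: case_prod_unfold intro!: borel_measurable_times_ennreal
          measurable_compose[OF measurable_fst] borel_measurable_indicator)
    have *: "emeasure \<mu> A = (\<integral>\<^sup>+x. indicator A (psl_mult (m_elt \<theta>) x) \<partial>\<mu>)" for \<theta>
    proof -
      have "distr \<mu> \<mu> (psl_mult (m_elt \<theta>)) = \<mu>" using \<mu> by (auto simp: M_grp_eq)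
      then have "emeasure \<mu> A = (\<integral>\<^sup>+x. indicator A x \<partial>(distr \<mu> \<mu> (psl_mult (m_elt \<theta>))))"
        using A sets_\<mu> by simp
      also have "\<dots> = (\<integral>\<^sup>+x. indicator A (psl_mult (m_elt \<theta>) x) \<partial>\<mu>)"
        using A sets_\<mu> by (intro nn_integral_distr meas) auto
      finally show ?thesis .
    qed
    \<comment> \<open>A constant is written as its own mean over the circle; invariance then inserts
      a rotation depending on the integration variable.\<close>
    have "emeasure \<mu> A = ?c * (\<integral>\<^sup>+\<theta>\<in>{0..<2*pi}. emeasure \<mu> A \<partial>lborel)"
      using c by (subst nn_integral_cmult) (auto simp: mult.left_commute[of ?c])
    also have "(\<integral>\<^sup>+\<theta>\<in>{0..<2*pi}. emeasure \<mu> A \<partial>lborel) =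
        (\<integral>\<^sup>+\<theta>. \<integral>\<^sup>+x. indicator A (psl_mult (m_elt \<theta>) x) * indicator {0..<2*pi} \<theta> \<partial>\<mu> \<partial>lborel)"
    proof (rule nn_integral_cong)
      fix \<theta> :: real
      have "(\<lambda>x. indicator A (psl_mult (m_elt \<theta>) x) :: ennreal) \<in> borel_measurable \<mu>"
        using A sets_\<mu> by (intro measurable_compose[OF meas] borel_measurable_indicator) simp
      then show "emeasure \<mu> A * indicator {0..<2*pi} \<theta> =
          (\<integral>\<^sup>+x. indicator A (psl_mult (m_elt \<theta>) x) * indicator {0..<2*pi} \<theta> \<partial>\<mu>)"
        by (subst *[of \<theta>]) (simp add: nn_integral_multc)
    qed
    also have "\<dots> = (\<integral>\<^sup>+x. \<integral>\<^sup>+\<theta>. indicator A (psl_mult (m_elt \<theta>) x) * indicator {0..<2*pi} \<theta> \<partial>lborel \<partial>\<mu>)"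
      using Fubini'[OF joint] by simp
    also have "\<dots> = (\<integral>\<^sup>+x. (\<integral>\<^sup>+\<theta>\<in>{0..<2*pi}. indicator A (m_elt \<theta>) \<partial>lborel) \<partial>\<mu>)"
    proof (rule nn_integral_cong)
      fix x assume "x \<in> space \<mu>"
      then obtain \<alpha> where "x = m_elt \<alpha>" by (auto simp: space_\<mu> M_grp_eq)
      then show "(\<integral>\<^sup>+\<theta>. indicator A (psl_mult (m_elt \<theta>) x) * indicator {0..<2*pi} \<theta> \<partial>lborel) =
          (\<integral>\<^sup>+\<theta>\<in>{0..<2*pi}. indicator A (m_elt \<theta>) \<partial>lborel)"
        using rot[OF A, of \<alpha>] by (simp add: m_elt_add add.commute)
    qed
    also have "?c * \<dots> = emeasure unif_M A"
      by (simp add: emeasure_unif_M[OF A] \<mu>.emeasure_space_1)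
    finally show "emeasure \<mu> A = emeasure unif_M A" .
  qed (simp add: sets_\<mu>)
qed

lemma space_haar_M: "space haar_M = M_grp"
  using sets_eq_imp_space_eq[OF sets_unif_M] by (simp add: haar_M_unif)

text \<open>Lower triangular matrices fix 0.\<close>

lemma moebius_mult_0:
  assumes "H \<in> SL" "H$1$2 = 0"
  shows "moebius (psl_mult g (abs_psl2c H)) (Some 0) = moebius g (Some 0)"
proof -
  obtain A where A: "A \<in> SL" "g = abs_psl2c A" by (rule abs_cases)
  have "H$2$2 \<noteq> 0" using assms by (auto simp: SL_iff)
  then show ?thesis
    using A assms by (simp add: abs_mult moebius_abs SL_mult moebius_mat_def mult_nth)
qed

lemma moebius_orbit:
  assumes "m \<in> M_grp"
  shows "moebius (psl_mult (psl_mult (psl_mult k m) (a_elt s)) (n_elt z)) (Some 0) = moebius k (Some 0)"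
proof -
  obtain \<theta> where "m = abs_psl2c (m_mat \<theta>)" using assms by (auto simp: M_grp_eq m_elt_def)
  moreover have "m_mat \<theta> $ 1 $ 2 = 0" "a_mat s $ 1 $ 2 = 0" "n_mat z $ 1 $ 2 = 0"
    by (simp_all add: m_mat_def a_mat_def n_mat_def)
  ultimately show ?thesis
    by (simp only: a_elt_abs n_elt_abs moebius_mult_0 m_mat_SL a_mat_SL n_mat_SL)
qed

locale ps_br = br +
  assumes PS: "PS_density \<Gamma> \<nu>"
begin

lemma base_H3: "base_pt \<in> H3" by (simp add: H3_def base_pt_def)

lemma PS_sets: "x \<in> H3 \<Longrightarrow> sets (\<nu> x) = sets (borel_of_top bdry_top)"
  and PS_null: "x \<in> H3 \<Longrightarrow> emeasure (\<nu> x) (- limit_set \<Gamma>) = 0"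
  and PS_finite: "x \<in> H3 \<Longrightarrow> finite_measure (\<nu> x)"
  and PS_nonzero: "x \<in> H3 \<Longrightarrow> emeasure (\<nu> x) UNIV \<noteq> 0"
  using PS unfolding PS_density_def by blast+

lemma PS_AE: "x \<in> H3 \<Longrightarrow> AE \<xi> in \<nu> x. \<xi> \<in> limit_set \<Gamma>"
  using PS_null[of x] PS_sets[of x] sets_bdry[OF closed_limit_set]
  by (intro AE_I[of _ _ "- limit_set \<Gamma>"]) auto

text \<open>The decomposition k m a_s n_z sends 0 to the boundary point of k, since M, A and N are
  lower triangular. So the integrand vanishes whenever that point is in the limit set, which holds
  almost everywhere for the Patterson-Sullivan measure.\<close>

lemma BR_lift_zero:
  assumes "\<And>g. moebius g (Some 0) \<in> limit_set \<Gamma> \<Longrightarrow> \<psi> g = 0"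
  shows "BR_lift c (\<nu> base_pt) \<psi> = 0"
proof -
  have "AE \<xi> in \<nu> base_pt. (\<integral>m. (\<integral>s. (\<integral>z. \<psi> (psl_mult (psl_mult (psl_mult (k_rep \<xi>) m) (a_elt s)) (n_elt z)) * exp (- c * s)
       \<partial>(lborel :: complex measure)) \<partial>(lborel :: real measure)) \<partial>haar_M) = 0"
    using PS_AE[OF base_H3]
  proof eventually_elim
    fix \<xi> assume \<xi>: "\<xi> \<in> limit_set \<Gamma>"
    have "(\<integral>m. (\<integral>s. (\<integral>z. \<psi> (psl_mult (psl_mult (psl_mult (k_rep \<xi>) m) (a_elt s)) (n_elt z)) * exp (- c * s)
       \<partial>(lborel :: complex measure)) \<partial>(lborel :: real measure)) \<partial>haar_M) = (\<integral>m. 0 \<partial>haar_M)"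
    proof (rule Bochner_Integration.integral_cong)
      fix m assume "m \<in> space haar_M"
      then have "\<psi> (psl_mult (psl_mult (psl_mult (k_rep \<xi>) m) (a_elt s)) (n_elt z)) = 0" for s z
        using \<xi> by (intro assms) (simp add: space_haar_M moebius_orbit k_rep)
      then show "(\<integral>s. (\<integral>z. \<psi> (psl_mult (psl_mult (psl_mult (k_rep \<xi>) m) (a_elt s)) (n_elt z)) * exp (- c * s)
       \<partial>(lborel :: complex measure)) \<partial>(lborel :: real measure)) = 0" by simp
    qed simp
    then show "(\<integral>m. (\<integral>s. (\<integral>z. \<psi> (psl_mult (psl_mult (psl_mult (k_rep \<xi>) m) (a_elt s)) (n_elt z)) * exp (- c * s)
       \<partial>(lborel :: complex measure)) \<partial>(lborel :: real measure)) \<partial>haar_M) = 0" by simp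
  qed
  then show ?thesis
    unfolding BR_lift_def int_K_def PSL2C_simps by (rule integral_eq_zero_AE)
qed

text \<open>The exceptional set is the image of the open set V of group elements that send 0 off the
  limit set. V is a countable union of small sets, and each has an image of measure 0 because its
  test functions have \<open>BR_lift\<close> equal to 0.\<close>

lemma AE_limit_set: "AE x in \<mu>. \<forall>g. x = pr g \<longrightarrow> moebius g (Some 0) \<in> limit_set \<Gamma>"
proof -
  define V where "V = {g. moebius g (Some 0) \<in> - limit_set \<Gamma>}"
  have "open V" unfolding V_def by (rule open_moebius_0[OF closed_limit_set])
  obtain \<A> where \<A>: "countable \<A>" "\<And>W. W \<in> \<A> \<Longrightarrow> small W"
    "\<And>V. open V \<Longrightarrow> V = \<Union>{W \<in> \<A>. W \<subseteq> V}" by (rule countable_small; blast)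
  have null: "pr ` W \<in> null_sets \<mu>" if W: "W \<in> \<A>" "W \<subseteq> V" for W
  proof -
    have sm: "small W" using W \<A> by simp
    then obtain r where "W \<subseteq> psl_ball r" "open W" by (auto simp: small_def)
    from open_psl_approx[OF this(2,1)] obtain \<psi> :: "nat \<Rightarrow> psl2c \<Rightarrow> real" where
      \<psi>: "\<And>k. \<psi> k \<in> Cc_G" "\<And>k g. 0 \<le> \<psi> k g" "\<And>k g. \<psi> k g \<le> 1" "\<And>k g. g \<notin> W \<Longrightarrow> \<psi> k g = 0"
      "\<And>g. g \<in> W \<Longrightarrow> (\<lambda>k. \<psi> k g) \<longlonglongrightarrow> 1" by metis
    have "BR_lift \<delta> (\<nu> base_pt) (\<psi> k) = 0" for k
      using W(2) by (intro BR_lift_zero \<psi>(4)) (auto simp: V_def)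
    then have "(\<lambda>k. 0) \<longlonglongrightarrow> measure \<mu> (pr ` W)"
      using small_mass_limit[OF sm \<psi>] by simp
    then have "measure \<mu> (pr ` W) = 0" by (simp add: LIMSEQ_const_iff)
    then show ?thesis
      using small_fin[OF sm] small_sets[OF sm] by (auto simp: emeasure_eq_ennreal_measure)
  qed
  have "(\<Union>W\<in>{W \<in> \<A>. W \<subseteq> V}. pr ` W) \<in> null_sets \<mu>"
    using \<A>(1) null by (intro null_sets_UN') auto
  then show ?thesis
  proof (rule AE_I')
    show "{x \<in> space \<mu>. \<not> (\<forall>g. x = pr g \<longrightarrow> moebius g (Some 0) \<in> limit_set \<Gamma>)} \<subseteq> (\<Union>W\<in>{W \<in> \<A>. W \<subseteq> V}. pr ` W)"
    proof
      fix x assume "x \<in> {x \<in> space \<mu>. \<not> (\<forall>g. x = pr g \<longrightarrow> moebius g (Some 0) \<in> limit_set \<Gamma>)}"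
      then obtain g where "x = pr g" "g \<in> V" by (auto simp: V_def)
      moreover from this have "g \<in> \<Union>{W \<in> \<A>. W \<subseteq> V}" using \<A>(3)[OF \<open>open V\<close>] by simp
      ultimately show "x \<in> (\<Union>W\<in>{W \<in> \<A>. W \<subseteq> V}. pr ` W)" by blast
    qed
  qed
qed

end

section \<open>Hyperbolic geometry\<close>

lemma norm_mat_sq:
  "(norm (A :: complex^2^2))\<^sup>2 = (cmod (A$1$1))\<^sup>2 + (cmod (A$1$2))\<^sup>2 + (cmod (A$2$1))\<^sup>2 + (cmod (A$2$2))\<^sup>2"
  by (simp add: norm_vec_def L2_set_def sum_2)

text \<open>The quaternionic denominator of the Poincare extension at the base point.\<close>

definition den :: "complex^2^2 \<Rightarrow> real" where
  "den A = (cmod (A$2$1))\<^sup>2 + (cmod (A$2$2))\<^sup>2"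

text \<open>The hermitian product of the two rows of A; divided by \<open>den A\<close> it is the
  complex coordinate of the image of the base point.\<close>

definition znum :: "complex^2^2 \<Rightarrow> complex" where
  "znum A = A$1$2 * cnj (A$2$2) + A$1$1 * cnj (A$2$1)"

lemma den_pos: assumes "A \<in> SL" shows "den A > 0"
proof (cases "A$2$2 = 0")
  case True
  then have "A$2$1 \<noteq> 0" using assms by (auto simp: SL_iff)
  then show ?thesis by (simp add: den_def add_pos_nonneg)
qed (simp add: den_def add_nonneg_pos)

lemma hact_mat_base: "hact_mat A (0, 1) = (znum A / of_real (den A), 1 / den A)"
  by (simp add: hact_mat_def den_def znum_def Let_def add.commute)

text \<open>Lagrange's identity for the two rows: squared inner product plus squared determinant is
  the product of the squared norms.\<close>

lemma znum_den: 
  assumes "A \<in> SL"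
  shows "(cmod (znum A))\<^sup>2 + 1 = ((cmod (A$1$1))\<^sup>2 + (cmod (A$1$2))\<^sup>2) * den A"
proof -
  define a b c d where "a = A$1$1" and "b = A$1$2" and "c = A$2$1" and "d = A$2$2"
  have det: "a * d - b * c = 1" using assms by (simp add: SL_iff a_def b_def c_def d_def)
  then have "cnj a * cnj d - cnj b * cnj c = 1"
    by (metis complex_cnj_diff complex_cnj_mult complex_cnj_one)
  then have "(b * cnj d + a * cnj c) * (cnj b * d + cnj a * c) + 1 =
      (b * cnj d + a * cnj c) * (cnj b * d + cnj a * c) + (a * d - b * c) * (cnj a * cnj d - cnj b * cnj c)"
    using det by simp
  also have "\<dots> = (a * cnj a + b * cnj b) * (c * cnj c + d * cnj d)" by (simp add: algebra_simps)
  finally have "complex_of_real ((cmod (znum A))\<^sup>2 + 1) =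
      complex_of_real (((cmod (A$1$1))\<^sup>2 + (cmod (A$1$2))\<^sup>2) * den A)"
    unfolding of_real_mult of_real_add of_real_1 den_def complex_norm_square znum_def
      a_def[symmetric] b_def[symmetric] c_def[symmetric] d_def[symmetric]
    by simp
  then show ?thesis using of_real_eq_iff by blast
qed

text \<open>The action law is needed only at the base point, where the second factor yields the
  explicit point (Z / D, 1 / D).\<close>

lemma hact_mat_mult_base:
  assumes A: "A \<in> SL" and B: "B \<in> SL"
  shows "hact_mat A (hact_mat B (0, 1)) = hact_mat (A ** B) (0, 1)"
proof -
  define a b c d where "a = A$1$1" and "b = A$1$2" and "c = A$2$1" and "d = A$2$2"
  define a' b' c' d' where "a' = B$1$1" and "b' = B$1$2" and "c' = B$2$1" and "d' = B$2$2"
  define Z where "Z = b' * cnj d' + a' * cnj c'"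
  define D where "D = complex_of_real (den B)"
  define E where "E = den (A ** B)"
  have D0: "D \<noteq> 0" and dB: "den B > 0" and E0: "E > 0"
    using den_pos[OF B] den_pos[OF SL_mult[OF A B]] by (auto simp: D_def E_def)
  have cD: "cnj D = D" by (simp add: D_def)
  have D: "D = c' * cnj c' + d' * cnj d'"
    unfolding D_def den_def of_real_add complex_norm_square c'_def d'_def by simp
  have cZ: "cnj Z = cnj b' * d' + cnj a' * c'" by (simp add: Z_def)
  have key: "Z * cnj Z + 1 = (a' * cnj a' + b' * cnj b') * D"
  proof -
    have "complex_of_real ((cmod (znum B))\<^sup>2 + 1) = complex_of_real (((cmod (B$1$1))\<^sup>2 + (cmod (B$1$2))\<^sup>2) * den B)"
      by (simp only: znum_den[OF B])
    then show ?thesis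
      unfolding of_real_add of_real_mult complex_norm_square D_def[symmetric]
      by (simp add: Z_def znum_def a'_def b'_def c'_def d'_def)
  qed
  \<comment> \<open>One sesquilinear identity serves twice: with (p, q) = (r, s) = (c, d) it is the
    denominator, with (a, b) and (c, d) the numerator.\<close>
  have gen: "(p * (Z / D) + q) * cnj (r * (Z / D) + s) + p * cnj r / D\<^sup>2 =
      ((p * b' + q * d') * cnj (r * b' + s * d') + (p * a' + q * c') * cnj (r * a' + s * c')) / D" for p q r s
  proof -
    have cancel: "X * D\<^sup>2 = Y * D \<Longrightarrow> X = Y / D" for X Y
      using D0 by (simp add: power2_eq_square field_simps)
    have "((p * (Z / D) + q) * cnj (r * (Z / D) + s) + p * cnj r / D\<^sup>2) * D\<^sup>2 =
        (p * Z + q * D) * (cnj r * cnj Z + cnj s * D) + p * cnj r"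
      using D0 by (simp add: cD power2_eq_square field_simps)
    also have "\<dots> = p * cnj r * (Z * cnj Z + 1) + p * cnj s * Z * D + q * cnj r * cnj Z * D + q * cnj s * D * D"
      by (simp add: algebra_simps)
    also have "\<dots> = (p * cnj r * (a' * cnj a' + b' * cnj b') + p * cnj s * Z + q * cnj r * cnj Z + q * cnj s * D) * D"
      unfolding key by (simp add: algebra_simps)
    also have "p * cnj r * (a' * cnj a' + b' * cnj b') + p * cnj s * Z + q * cnj r * cnj Z + q * cnj s * D =
        (p * b' + q * d') * cnj (r * b' + s * d') + (p * a' + q * c') * cnj (r * a' + s * c')"
      unfolding cZ D Z_def by (simp add: algebra_simps)
    finally show ?thesis by (rule cancel)
  qed
  have hB: "hact_mat B (0, 1) = (Z / D, 1 / den B)"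
    by (simp add: hact_mat_base znum_def Z_def D_def a'_def b'_def c'_def d'_def)
  have E: "complex_of_real E = (c * b' + d * d') * cnj (c * b' + d * d') + (c * a' + d * c') * cnj (c * a' + d * c')"
    unfolding E_def den_def of_real_add complex_norm_square
    by (simp add: mult_nth a'_def b'_def c'_def d'_def c_def d_def)
  have oD: "complex_of_real ((1 / den B)\<^sup>2) = 1 / D\<^sup>2" by (simp add: D_def power_divide)
  have den2: "(cmod (c * (Z / D) + d))\<^sup>2 + (cmod c)\<^sup>2 * (1 / den B)\<^sup>2 = E / den B"
  proof -
    have "complex_of_real ((cmod (c * (Z / D) + d))\<^sup>2 + (cmod c)\<^sup>2 * (1 / den B)\<^sup>2) = complex_of_real (E / den B)"
      unfolding of_real_add of_real_mult of_real_divide complex_norm_square E D_def[symmetric] oD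
      using gen[of c d c d] by simp
    then show ?thesis using of_real_eq_iff by blast
  qed
  have hA: "hact_mat A (z, y) = (((a * z + b) * cnj (c * z + d) + a * cnj c * of_real (y\<^sup>2)) /
      of_real ((cmod (c * z + d))\<^sup>2 + (cmod c)\<^sup>2 * y\<^sup>2), y / ((cmod (c * z + d))\<^sup>2 + (cmod c)\<^sup>2 * y\<^sup>2))" for z y
    unfolding a_def b_def c_def d_def by (simp only: hact_mat_def Let_def prod.case)
  have "hact_mat A (hact_mat B (0, 1)) =
    (((a * (Z / D) + b) * cnj (c * (Z / D) + d) + a * cnj c / D\<^sup>2) / of_real (E / den B), (1 / den B) / (E / den B))"
    unfolding hB hA den2 oD by simp
  also have "\<dots> = (znum (A ** B) / of_real E, 1 / E)"
    unfolding gen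
    using dB E0 D0
    by (simp add: znum_def mult_nth a'_def b'_def c'_def d'_def a_def b_def c_def d_def) (simp add: D_def)
  also have "\<dots> = hact_mat (A ** B) (0, 1)"
    by (simp add: hact_mat_base E_def)
  finally show ?thesis .
qed

text \<open>The geodesic with endpoints \<open>g(0)\<close> and \<open>g(\<infinity>)\<close>.\<close>

definition axis :: "complex^2^2 \<Rightarrow> real \<Rightarrow> complex \<times> real" where
  "axis A u = hact_mat A (0, u)"

lemma axis_den_pos:
  assumes "A \<in> SL" "u > 0" shows "(cmod (A$2$2))\<^sup>2 + (cmod (A$2$1))\<^sup>2 * u\<^sup>2 > 0"
proof (cases "A$2$2 = 0")
  case True
  then have "A$2$1 \<noteq> 0" using assms by (auto simp: SL_iff)
  then show ?thesis using assms by (simp add: add_nonneg_pos)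
qed (simp add: add_pos_nonneg)

lemma axis_eq: "axis A u =
   ((A$1$2 * cnj (A$2$2) + A$1$1 * cnj (A$2$1) * of_real (u\<^sup>2)) / of_real ((cmod (A$2$2))\<^sup>2 + (cmod (A$2$1))\<^sup>2 * u\<^sup>2),
    u / ((cmod (A$2$2))\<^sup>2 + (cmod (A$2$1))\<^sup>2 * u\<^sup>2))"
  by (simp add: axis_def hact_mat_def Let_def)

lemma axis_H3: "A \<in> SL \<Longrightarrow> u > 0 \<Longrightarrow> axis A u \<in> H3"
  using axis_den_pos by (simp add: axis_eq H3_def)

text \<open>The argument of \<open>arcosh\<close> comes out independent of A: it is the value (u / v
  + v / u) / 2 of the vertical axis, which is cosh (ln u - ln v).\<close>

lemma axis_dist:
  assumes A: "A \<in> SL" and u: "u > 0" and v: "v > 0"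
  shows "hdist (axis A u) (axis A v) = \<bar>ln u - ln v\<bar>"
proof -
  define a b c d where "a = A$1$1" and "b = A$1$2" and "c = A$2$1" and "d = A$2$2"
  define C D where "C = (cmod c)\<^sup>2" and "D = (cmod d)\<^sup>2"
  define P where "P u = D + C * u\<^sup>2" for u
  have P: "P u > 0" "P v > 0" using axis_den_pos[OF A] u v by (simp_all add: P_def C_def D_def c_def d_def)
  have cC: "complex_of_real C = c * cnj c" "complex_of_real D = d * cnj d"
    unfolding C_def D_def complex_norm_square by simp_all
  have ax: "axis A u = ((b * cnj d + a * cnj c * of_real (u\<^sup>2)) / of_real (P u), u / P u)" for u
    by (simp add: axis_eq a_def b_def c_def d_def P_def C_def D_def)
  have det: "a * d - b * c = 1" using A by (simp add: SL_iff a_def b_def c_def d_def)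
  have num: "(b * cnj d + a * cnj c * of_real (u\<^sup>2)) * of_real (P v) - (b * cnj d + a * cnj c * of_real (v\<^sup>2)) * of_real (P u)
      = of_real (u\<^sup>2 - v\<^sup>2) * (cnj c * cnj d) * (a * d - b * c)"
    unfolding P_def of_real_add of_real_mult of_real_diff cC by (simp add: algebra_simps)
  have "fst (axis A u) - fst (axis A v) = of_real (u\<^sup>2 - v\<^sup>2) * (cnj c * cnj d) / of_real (P u * P v)"
    using P num[unfolded det] by (simp add: ax field_simps)
  then have "(cmod (fst (axis A u) - fst (axis A v)))\<^sup>2 = (u\<^sup>2 - v\<^sup>2)\<^sup>2 * (C * D) / (P u * P v)\<^sup>2"
    by (simp only:) (simp add: norm_divide norm_mult power_divide power_mult_distrib C_def D_def del: of_real_mult of_real_diff)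
  moreover have "snd (axis A u) - snd (axis A v) = (u - v) * (D - u * v * C) / (P u * P v)"
  proof -
    have "u * P v - v * P u = (u - v) * (D - u * v * C)" by (simp add: P_def algebra_simps power2_eq_square)
    then show ?thesis using P by (simp add: ax field_simps)
  qed
  then have "(snd (axis A u) - snd (axis A v))\<^sup>2 = ((u - v) * (D - u * v * C))\<^sup>2 / (P u * P v)\<^sup>2"
    by (simp add: power_divide)
  ultimately have "(cmod (fst (axis A u) - fst (axis A v)))\<^sup>2 + (snd (axis A u) - snd (axis A v))\<^sup>2 =
      ((u\<^sup>2 - v\<^sup>2)\<^sup>2 * (C * D) + ((u - v) * (D - u * v * C))\<^sup>2) / (P u * P v)\<^sup>2"
    by (simp add: add_divide_distrib)
  \<comment> \<open>The identity that removes the dependence on A: horizontal and vertical parts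
    recombine into the product of the two denominators.\<close>
  also have "(u\<^sup>2 - v\<^sup>2)\<^sup>2 * (C * D) + ((u - v) * (D - u * v * C))\<^sup>2 = (u - v)\<^sup>2 * (P u * P v)"
    by (simp add: P_def algebra_simps power2_eq_square)
  also have "(u - v)\<^sup>2 * (P u * P v) / (P u * P v)\<^sup>2 = (u - v)\<^sup>2 / (P u * P v)"
    using P by (simp add: power2_eq_square)
  finally have "((cmod (fst (axis A u) - fst (axis A v)))\<^sup>2 + (snd (axis A u) - snd (axis A v))\<^sup>2)
      / (2 * snd (axis A u) * snd (axis A v)) = (u - v)\<^sup>2 / (P u * P v) / (2 * (u / P u) * (v / P v))"
    by (simp add: ax)
  also have "\<dots> = (u - v)\<^sup>2 / (2 * u * v)" using P u v by (simp add: field_simps)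
  finally have "hdist (axis A u) (axis A v) = arcosh (1 + (u - v)\<^sup>2 / (2 * u * v))"
    by (simp add: hdist_def)
  also have "1 + (u - v)\<^sup>2 / (2 * u * v) = (u / v + v / u) / 2"
    using u v by (simp add: field_simps power2_eq_square)
  also have "\<dots> = cosh (ln u - ln v)"
    using u v by (simp add: cosh_def exp_diff exp_minus field_simps)
  also have "\<dots> = cosh \<bar>ln u - ln v\<bar>" by (simp add: abs_if flip: cosh_minus[of "ln u - ln v"])
  finally show ?thesis by (simp only: arcosh_cosh_real abs_ge_zero)
qed

section \<open>Limits at the boundary as ordinary limits\<close>

lemma limitin_H3_closure_Some:
  assumes "(f \<longlongrightarrow> (w, 0 :: real)) F" "eventually (\<lambda>x. f x \<in> H3) F"
  shows "tends_to_bdry f (Some w) F"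
  unfolding tends_to_bdry_def limitin_def
proof (intro conjI allI impI)
  show "bdry_pt (Some w) \<in> topspace H3_closure_top"
    by (auto simp: bdry_pt_def H3_closure_top_def)
  fix V assume V: "openin H3_closure_top V \<and> bdry_pt (Some w) \<in> V"
  let ?H = "top_of_set {p :: complex \<times> real. snd p \<ge> 0}"
  have "openin ?H {p \<in> topspace ?H. Some p \<in> V}"
    using V by (intro openin_continuous_map_preimage[of _ H3_closure_top])
      (auto simp: H3_closure_top_def continuous_map_Some)
  then obtain T where T: "open T" "{p \<in> topspace ?H. Some p \<in> V} = {p. snd p \<ge> 0} \<inter> T"
    by (auto simp: openin_open)
  have "(w, 0) \<in> {p \<in> topspace ?H. Some p \<in> V}" using V by (simp add: bdry_pt_def)
  then have "(w, 0) \<in> T" unfolding T(2) by simp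
  with assms(1) T(1) have "eventually (\<lambda>x. f x \<in> T) F" by (simp add: tendsto_def)
  with assms(2) show "eventually (\<lambda>x. Some (f x) \<in> V) F"
  proof eventually_elim
    case (elim x)
    then have "f x \<in> {p. snd p \<ge> 0} \<inter> T" by (auto simp: H3_def)
    then show ?case using T(2) by blast
  qed
qed

lemma tendsto_of_bdry_Some:
  assumes "tends_to_bdry f (Some w) F"
  shows "(f \<longlongrightarrow> (w, 0 :: real)) F"
  unfolding tendsto_def
proof (intro allI impI)
  fix T assume T: "open T" "(w, 0 :: real) \<in> T"
  let ?H = "top_of_set {p :: complex \<times> real. snd p \<ge> 0}"
  have "openin H3_closure_top (Some ` ({p. snd p \<ge> 0} \<inter> T))"
    using T by (simp add: H3_closure_top_def openin_open_Int)
  moreover have "bdry_pt (Some w) \<in> Some ` ({p. snd p \<ge> 0} \<inter> T)"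
    using T by (auto simp: bdry_pt_def)
  ultimately have "eventually (\<lambda>x. Some (f x) \<in> Some ` ({p. snd p \<ge> 0} \<inter> T)) F"
    using assms unfolding tends_to_bdry_def limitin_def by blast
  then show "eventually (\<lambda>x. f x \<in> T) F" by (rule eventually_mono) auto
qed

lemma limitin_H3_closure_None:
  assumes "filterlim (\<lambda>x. norm (f x)) at_top F" "eventually (\<lambda>x. f x \<in> H3) F"
  shows "tends_to_bdry f None F"
  unfolding tends_to_bdry_def limitin_def
proof (intro conjI allI impI)
  show "bdry_pt None \<in> topspace H3_closure_top"
    by (auto simp: bdry_pt_def H3_closure_top_def)
  fix V assume V: "openin H3_closure_top V \<and> bdry_pt None \<in> V"
  then obtain C where C: "compact C" "V = insert None (Some ` ({p. snd p \<ge> 0} - C))"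
    by (auto simp: H3_closure_top_def openin_Alexandroff_compactification bdry_pt_def compactin_subtopology)
  then obtain B where B: "\<And>p. p \<in> C \<Longrightarrow> norm p \<le> B" using compact_imp_bounded bounded_iff by metis
  have "eventually (\<lambda>x. norm (f x) > B) F"
    using assms(1) by (simp add: filterlim_at_top_dense)
  with assms(2) show "eventually (\<lambda>x. Some (f x) \<in> V) F"
  proof eventually_elim
    case (elim x)
    then show ?case using B[of "f x"] C(2) by (auto simp: H3_def)
  qed
qed

lemma norm_at_top_of_bdry_None:
  assumes "tends_to_bdry f None F"
  shows "filterlim (\<lambda>x. norm (f x)) at_top F"
  unfolding filterlim_at_top_dense
proof
  fix B :: real
  let ?H = "top_of_set {p :: complex \<times> real. snd p \<ge> 0}"
  define C where "C = {p :: complex \<times> real. snd p \<ge> 0} \<inter> cball 0 B"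
  have cl: "closed {p :: complex \<times> real. snd p \<ge> 0}" by (intro closed_Collect_le continuous_intros)
  then have "compact C" unfolding C_def by (simp add: closed_Int_compact)
  then have "compactin ?H C" "closedin ?H C"
    by (auto simp: compactin_subtopology C_def closed_subset closedin_closed_Int)
  have b: "bdry_pt None = None" by (simp add: bdry_pt_def)
  have "openin H3_closure_top (insert None (Some ` (topspace ?H - C)))"
    using \<open>compactin ?H C\<close> \<open>closedin ?H C\<close>
    unfolding H3_closure_top_def openin_Alexandroff_compactification by blast
  then have "eventually (\<lambda>x. Some (f x) \<in> insert None (Some ` (topspace ?H - C))) F"
    using assms b unfolding tends_to_bdry_def limitin_def by (metis insertI1)
  then show "eventually (\<lambda>x. norm (f x) > B) F"
    by (rule eventually_mono) (auto simp: C_def)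
qed

text \<open>If d = 0, then A sends 0 to infinity and the height is 1 / (|c|^2 u), which blows up;
  otherwise the coordinates have the finite limit (b / d, 0).\<close>

lemma axis_tends_0:
  assumes A: "A \<in> SL" and u: "(u \<longlongrightarrow> 0) F" "\<And>x. u x > 0"
  shows "tends_to_bdry (\<lambda>x. axis A (u x)) (moebius (abs_psl2c A) (Some 0)) F"
proof (cases "A$2$2 = 0")
  case True
  then have c: "A$2$1 \<noteq> 0" using A by (auto simp: SL_iff)
  have "snd (axis A (u x)) = (1 / (cmod (A$2$1))\<^sup>2) * inverse (u x)" for x
    using True u(2)[of x] by (simp add: axis_eq field_simps power2_eq_square)
  moreover have "filterlim (\<lambda>x. inverse (u x)) at_top F"
    using u by (intro filterlim_inverse_at_top) auto
  then have "filterlim (\<lambda>x. (1 / (cmod (A$2$1))\<^sup>2) * inverse (u x)) at_top F"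
    using c by (intro filterlim_tendsto_pos_mult_at_top[OF tendsto_const]) auto
  ultimately have "filterlim (\<lambda>x. snd (axis A (u x))) at_top F" by simp
  then have "filterlim (\<lambda>x. norm (axis A (u x))) at_top F"
  proof (rule filterlim_at_top_mono, intro always_eventually allI)
    fix x show "snd (axis A (u x)) \<le> norm (axis A (u x))"
      using norm_snd_le[of "snd (axis A (u x))" "fst (axis A (u x))"] by simp
  qed
  then show ?thesis
    using True A u by (simp add: moebius_abs moebius_mat_def limitin_H3_closure_None axis_H3)
next
  case False
  have "((\<lambda>x. axis A (u x)) \<longlongrightarrow>
     ((A$1$2 * cnj (A$2$2) + A$1$1 * cnj (A$2$1) * of_real (0\<^sup>2)) / of_real ((cmod (A$2$2))\<^sup>2 + (cmod (A$2$1))\<^sup>2 * 0\<^sup>2),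
    0 / ((cmod (A$2$2))\<^sup>2 + (cmod (A$2$1))\<^sup>2 * 0\<^sup>2))) F"
    unfolding axis_eq by (intro tendsto_intros u) (use False in auto)
  moreover have "A$1$2 * cnj (A$2$2) / of_real ((cmod (A$2$2))\<^sup>2) = A$1$2 / A$2$2"
    unfolding complex_norm_square using False by simp
  ultimately have "((\<lambda>x. axis A (u x)) \<longlongrightarrow> (A$1$2 / A$2$2, 0)) F" by simp
  then show ?thesis
    using False A u by (simp add: moebius_abs moebius_mat_def limitin_H3_closure_Some axis_H3)
qed

text \<open>Exchanges 0 and infinity and reverses the axis by u to 1 / u, so that the end at
  infinity is deduced from the end at 0.\<close>

definition swap_mat :: "complex^2^2" where "swap_mat = mat2 0 1 (- 1) 0"

lemma swap_SL [simp]: "swap_mat \<in> SL"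
  by (simp add: swap_mat_def SL_mat2)

lemma axis_swap:
  assumes "A \<in> SL" "u > 0" shows "axis (A ** swap_mat) (1 / u) = axis A u"
proof -
  have pos: "(cmod (A$2$2))\<^sup>2 + (cmod (A$2$1))\<^sup>2 * u\<^sup>2 > 0" by (rule axis_den_pos[OF assms])
  have den: "(cmod (A$2$1))\<^sup>2 + (cmod (A$2$2))\<^sup>2 * (1 / u)\<^sup>2 = ((cmod (A$2$2))\<^sup>2 + (cmod (A$2$1))\<^sup>2 * u\<^sup>2) / u\<^sup>2"
    using assms(2) by (simp add: field_simps)
  have num: "A$1$1 * cnj (A$2$1) + A$1$2 * cnj (A$2$2) * of_real ((1 / u)\<^sup>2) =
      (A$1$2 * cnj (A$2$2) + A$1$1 * cnj (A$2$1) * of_real (u\<^sup>2)) / of_real (u\<^sup>2)"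
    using assms(2) by (simp add: field_simps)
  have "axis (A ** swap_mat) (1 / u) =
    ((A$1$1 * cnj (A$2$1) + A$1$2 * cnj (A$2$2) * of_real ((1 / u)\<^sup>2)) / of_real ((cmod (A$2$1))\<^sup>2 + (cmod (A$2$2))\<^sup>2 * (1 / u)\<^sup>2),
      (1 / u) / ((cmod (A$2$1))\<^sup>2 + (cmod (A$2$2))\<^sup>2 * (1 / u)\<^sup>2))"
    by (simp add: axis_eq mult_nth swap_mat_def)
  also have "\<dots> = axis A u"
    unfolding den num axis_eq using assms(2) pos by (simp add: power2_eq_square)
  finally show ?thesis .
qed

lemma moebius_swap: "A \<in> SL \<Longrightarrow> moebius (abs_psl2c (A ** swap_mat)) (Some 0) = moebius (abs_psl2c A) None"
  by (simp add: moebius_abs SL_mult) (simp add: moebius_mat_def mult_nth swap_mat_def Let_def)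

lemma axis_geodesic:
  assumes A: "A \<in> SL"
  shows "hgeodesic I (\<lambda>t. axis A (exp t))"
    and "tends_to_bdry (\<lambda>t. axis A (exp t)) (moebius (abs_psl2c A) (Some 0)) at_bot"
    and "tends_to_bdry (\<lambda>t. axis A (exp t)) (moebius (abs_psl2c A) None) at_top"
proof -
  show "hgeodesic I (\<lambda>t. axis A (exp t))"
    using A by (auto simp: hgeodesic_def axis_H3 axis_dist)
  show "tends_to_bdry (\<lambda>t. axis A (exp t)) (moebius (abs_psl2c A) (Some 0)) at_bot"
    by (rule axis_tends_0[OF A exp_at_bot]) simp
  have "tends_to_bdry (\<lambda>t. axis (A ** swap_mat) (1 / exp t)) (moebius (abs_psl2c (A ** swap_mat)) (Some 0)) at_top"
    by (rule axis_tends_0) (use A in \<open>auto simp: SL_mult intro!: tendsto_divide_0[OF tendsto_const] filterlim_at_top_imp_at_infinity exp_at_top\<close>)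
  then show "tends_to_bdry (\<lambda>t. axis A (exp t)) (moebius (abs_psl2c A) None) at_top"
    by (simp add: axis_swap[OF A] moebius_swap[OF A])
qed

section \<open>The Busemann function\<close>

text \<open>With arcosh E = ln (E + sqrt (E^2 - 1)), the factor g moves inside the logarithm, where
  E g converges and g itself disappears.\<close>

lemma arcosh_add_ln_tendsto:
  fixes E g :: "'x \<Rightarrow> real"
  assumes g: "(g \<longlongrightarrow> 0) F" "eventually (\<lambda>x. g x > 0) F" and E: "eventually (\<lambda>x. E x \<ge> 1) F"
    and lim: "((\<lambda>x. E x * g x) \<longlongrightarrow> c) F" and c: "c > 0"
  shows "((\<lambda>x. arcosh (E x) + ln (g x)) \<longlongrightarrow> ln (2 * c)) F"
proof -
  have "((\<lambda>x. ln (E x * g x + sqrt ((E x * g x)\<^sup>2 - (g x)\<^sup>2))) \<longlongrightarrow> ln (c + sqrt (c\<^sup>2 - 0\<^sup>2))) F"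
    using c by (intro tendsto_intros lim g) auto
  moreover have "eventually (\<lambda>x. ln (E x * g x + sqrt ((E x * g x)\<^sup>2 - (g x)\<^sup>2)) = arcosh (E x) + ln (g x)) F"
    using g(2) E
  proof eventually_elim
    case (elim x)
    have "sqrt ((E x)\<^sup>2 - 1) * g x = sqrt (((E x)\<^sup>2 - 1) * (g x)\<^sup>2)"
      using elim by (simp add: real_sqrt_mult)
    also have "((E x)\<^sup>2 - 1) * (g x)\<^sup>2 = (E x * g x)\<^sup>2 - (g x)\<^sup>2" by (simp add: algebra_simps power_mult_distrib)
    finally have "E x * g x + sqrt ((E x * g x)\<^sup>2 - (g x)\<^sup>2) = (E x + sqrt ((E x)\<^sup>2 - 1)) * g x"
      by (simp add: algebra_simps)
    moreover have "E x + sqrt ((E x)\<^sup>2 - 1) > 0" using elim by (intro add_pos_nonneg) auto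
    ultimately show ?case using elim by (simp add: arcosh_real_def ln_mult)
  qed
  ultimately have "((\<lambda>x. arcosh (E x) + ln (g x)) \<longlongrightarrow> ln (c + sqrt (c\<^sup>2 - 0\<^sup>2))) F"
    by (rule Lim_transform_eventually)
  then show ?thesis using c by simp
qed

text \<open>The inverse of the Poisson kernel of the upper half-space, up to normalisation: its
  logarithm is the Busemann function up to a constant depending on \<xi>.\<close>

definition bus_c :: "complex option \<Rightarrow> complex \<times> real \<Rightarrow> real" where
  "bus_c \<xi> p = (case \<xi> of None \<Rightarrow> 1 / snd p | Some w \<Rightarrow> ((cmod (fst p - w))\<^sup>2 + (snd p)\<^sup>2) / snd p)"

lemma bus_c_pos: "p \<in> H3 \<Longrightarrow> bus_c \<xi> p > 0"
  by (auto simp: bus_c_def H3_def split: option.splits intro!: divide_pos_pos add_nonneg_pos)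

text \<open>The renormalising function g depends on the path and not on x, so it cancels in a
  difference of two distances.\<close>

lemma hdist_scaled_tendsto:
  assumes r: "tends_to_bdry r \<xi> F" "eventually (\<lambda>s. r s \<in> H3) F"
  obtains g :: "'a \<Rightarrow> real" where "\<And>x. x \<in> H3 \<Longrightarrow>
    ((\<lambda>s. hdist x (r s) + ln (g s)) \<longlongrightarrow> ln (2 * bus_c \<xi> x)) F"
proof -
  have E1: "eventually (\<lambda>s. 1 + ((cmod (fst x - fst (r s)))\<^sup>2 + (snd x - snd (r s))\<^sup>2) / (2 * snd x * snd (r s)) \<ge> 1) F"
    if "x \<in> H3" for x
    using r(2) by eventually_elim (use that in \<open>auto simp: H3_def\<close>)
  show thesis
  proof (cases \<xi>)
    case (Some w)
    have lim: "(r \<longlongrightarrow> (w, 0)) F" using tendsto_of_bdry_Some r(1) Some by simp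
    have l1: "((\<lambda>s. fst (r s)) \<longlongrightarrow> w) F" and l2: "((\<lambda>s. snd (r s)) \<longlongrightarrow> 0) F"
      using tendsto_fst[OF lim] tendsto_snd[OF lim] by simp_all
    show thesis
    \<comment> \<open>At a finite endpoint the distance grows like minus the logarithm of the height
      of r s.\<close>
    proof (rule that[of "\<lambda>s. 2 * snd (r s)"])
      fix x assume x: "x \<in> H3"
      show "((\<lambda>s. hdist x (r s) + ln (2 * snd (r s))) \<longlongrightarrow> ln (2 * bus_c \<xi> x)) F"
        unfolding hdist_def
      proof (rule arcosh_add_ln_tendsto[OF _ _ E1[OF x] _ bus_c_pos[OF x]])
        show "((\<lambda>s. 2 * snd (r s)) \<longlongrightarrow> 0) F" using tendsto_mult_right_zero[OF l2] .
        show "eventually (\<lambda>s. 0 < 2 * snd (r s)) F"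
          using r(2) by eventually_elim (simp add: H3_def)
        have "((\<lambda>s. 2 * snd (r s) + ((cmod (fst x - fst (r s)))\<^sup>2 + (snd x - snd (r s))\<^sup>2) / snd x) \<longlongrightarrow>
            2 * 0 + ((cmod (fst x - w))\<^sup>2 + (snd x - 0)\<^sup>2) / snd x) F"
          using x by (intro tendsto_intros l1 l2) (auto simp: H3_def)
        then have "((\<lambda>s. 2 * snd (r s) + ((cmod (fst x - fst (r s)))\<^sup>2 + (snd x - snd (r s))\<^sup>2) / snd x) \<longlongrightarrow> bus_c \<xi> x) F"
          by (simp add: bus_c_def Some)
        then show "((\<lambda>s. (1 + ((cmod (fst x - fst (r s)))\<^sup>2 + (snd x - snd (r s))\<^sup>2) / (2 * snd x * snd (r s))) * (2 * snd (r s))) \<longlongrightarrow> bus_c \<xi> x) F"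
        proof (rule Lim_transform_eventually)
          show "eventually (\<lambda>s. 2 * snd (r s) + ((cmod (fst x - fst (r s)))\<^sup>2 + (snd x - snd (r s))\<^sup>2) / snd x =
             (1 + ((cmod (fst x - fst (r s)))\<^sup>2 + (snd x - snd (r s))\<^sup>2) / (2 * snd x * snd (r s))) * (2 * snd (r s))) F"
            using r(2)
          proof eventually_elim
            case (elim s)
            have "(1 + e / (2 * snd x * snd (r s))) * (2 * snd (r s)) = 2 * snd (r s) + e / snd x" for e
              using elim x by (simp add: H3_def field_simps)
            then show ?case by simp
          qed
        qed
      qed
    qed
  next
    case None
    have n: "filterlim (\<lambda>s. norm (r s)) at_top F" using norm_at_top_of_bdry_None r(1) None by simp
    have inv: "((\<lambda>s. inverse (norm (r s))) \<longlongrightarrow> 0) F"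
      by (rule tendsto_inverse_0_at_top[OF n])
    have pos: "eventually (\<lambda>s. norm (r s) > 0) F" using n unfolding filterlim_at_top_dense by blast
    \<comment> \<open>At infinity the height need not grow along r, so the height is taken relative
      to the squared norm; this tends to 0 like 1 / norm at worst.\<close>
    define g where "g s = 2 * snd (r s) / (norm (r s))\<^sup>2" for s
    have g0: "(g \<longlongrightarrow> 0) F"
    proof (rule Lim_null_comparison)
      show "((\<lambda>s. 2 * inverse (norm (r s))) \<longlongrightarrow> 0) F" using tendsto_mult_right_zero[OF inv] .
      show "eventually (\<lambda>s. norm (g s) \<le> 2 * inverse (norm (r s))) F"
        using pos
      proof eventually_elim
        case (elim s)
        have "\<bar>snd (r s)\<bar> \<le> norm (r s)" using norm_snd_le[of "snd (r s)" "fst (r s)"] by simp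
        then show ?case using elim by (simp add: g_def power2_eq_square field_simps abs_mult)
      qed
    qed
    show thesis
    proof (rule that[of g])
      fix x assume x: "x \<in> H3"
      have "((\<lambda>s. norm (x - r s) / norm (r s) - 1) \<longlongrightarrow> 0) F"
      proof (rule Lim_null_comparison)
        show "((\<lambda>s. norm x * inverse (norm (r s))) \<longlongrightarrow> 0) F" using tendsto_mult_right_zero[OF inv] .
        show "eventually (\<lambda>s. norm (norm (x - r s) / norm (r s) - 1) \<le> norm x * inverse (norm (r s))) F"
          using pos
        proof eventually_elim
          case (elim s)
          have "norm (x - r s) / norm (r s) - 1 = (norm (x - r s) - norm (r s)) / norm (r s)"
            using elim by (simp add: field_simps)
          moreover have "\<bar>norm (x - r s) - norm (r s)\<bar> \<le> norm x"
            using norm_triangle_ineq3[of "r s - x" "r s"] by (simp add: norm_minus_commute)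
          ultimately show ?case using elim by (simp add: abs_divide field_simps)
        qed
      qed
      then have q: "((\<lambda>s. norm (x - r s) / norm (r s)) \<longlongrightarrow> 1) F" by (simp add: LIM_zero_iff)
      show "((\<lambda>s. hdist x (r s) + ln (g s)) \<longlongrightarrow> ln (2 * bus_c \<xi> x)) F"
        unfolding hdist_def
      proof (rule arcosh_add_ln_tendsto[OF g0 _ E1[OF x] _ bus_c_pos[OF x]])
        show "eventually (\<lambda>s. 0 < g s) F"
          using r(2) pos by eventually_elim (simp add: H3_def g_def)
        have "((\<lambda>s. g s + (norm (x - r s) / norm (r s))\<^sup>2 / snd x) \<longlongrightarrow> 0 + 1\<^sup>2 / snd x) F"
          using x by (intro tendsto_intros g0 q) (auto simp: H3_def)
        then have "((\<lambda>s. g s + (norm (x - r s) / norm (r s))\<^sup>2 / snd x) \<longlongrightarrow> bus_c \<xi> x) F"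
          by (simp add: bus_c_def None)
        then show "((\<lambda>s. (1 + ((cmod (fst x - fst (r s)))\<^sup>2 + (snd x - snd (r s))\<^sup>2) / (2 * snd x * snd (r s))) * g s) \<longlongrightarrow> bus_c \<xi> x) F"
        proof (rule Lim_transform_eventually)
          show "eventually (\<lambda>s. g s + (norm (x - r s) / norm (r s))\<^sup>2 / snd x =
             (1 + ((cmod (fst x - fst (r s)))\<^sup>2 + (snd x - snd (r s))\<^sup>2) / (2 * snd x * snd (r s))) * g s) F"
            using r(2) pos
          proof eventually_elim
            case (elim s)
            have "(1 + e / (2 * snd x * snd (r s))) * g s = g s + e / (norm (r s))\<^sup>2 / snd x" for e
              using elim x by (simp add: H3_def g_def field_simps)
            moreover have "(cmod (fst x - fst (r s)))\<^sup>2 + (snd x - snd (r s))\<^sup>2 = (norm (x - r s))\<^sup>2"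
              by (simp add: norm_prod_def)
            ultimately show ?case by (simp add: power_divide)
          qed
        qed
      qed
    qed
  qed
qed

text \<open>All rays to \<xi> give the same limit; uniqueness in the description also needs that
  some ray to \<xi> exists.\<close>

lemma busemann_eq:
  assumes x: "x \<in> H3" and y: "y \<in> H3"
  shows "busemann \<xi> x y = ln (bus_c \<xi> x) - ln (bus_c \<xi> y)"
  unfolding busemann_def
proof (rule the_equality)
  have conv: "((\<lambda>s. hdist x (r s) - hdist y (r s)) \<longlongrightarrow> ln (bus_c \<xi> x) - ln (bus_c \<xi> y)) at_top"
    if "hgeodesic {0..} r \<and> tends_to_bdry r \<xi> at_top" for r
  proof -
    have "eventually (\<lambda>s. r s \<in> H3) at_top"
      using eventually_ge_at_top[of "0::real"]
    proof eventually_elim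
      case (elim s)
      have "r ` {0..} \<subseteq> H3" using that by (simp add: hgeodesic_def)
      then show ?case using elim by (simp add: image_subset_iff)
    qed
    with that obtain g :: "real \<Rightarrow> real" where
      g: "\<And>x. x \<in> H3 \<Longrightarrow> ((\<lambda>s. hdist x (r s) + ln (g s)) \<longlongrightarrow> ln (2 * bus_c \<xi> x)) at_top"
      using hdist_scaled_tendsto[of r \<xi> at_top] by blast
    from tendsto_diff[OF g[OF x] g[OF y]]
    show ?thesis using bus_c_pos[OF x, of \<xi>] bus_c_pos[OF y, of \<xi>] by (simp add: ln_mult)
  qed
  then show "\<forall>r. hgeodesic {0..} r \<and> tends_to_bdry r \<xi> at_top \<longrightarrow>
      ((\<lambda>s. hdist x (r s) - hdist y (r s)) \<longlongrightarrow> ln (bus_c \<xi> x) - ln (bus_c \<xi> y)) at_top"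
    by blast
  fix b assume b: "\<forall>r. hgeodesic {0..} r \<and> tends_to_bdry r \<xi> at_top \<longrightarrow>
      ((\<lambda>s. hdist x (r s) - hdist y (r s)) \<longlongrightarrow> b) at_top"
  obtain A where A: "A \<in> SL" "k_rep \<xi> = abs_psl2c A" by (rule abs_cases)
  \<comment> \<open>The axis of \<open>k_rep \<xi>\<close>, run towards its endpoint \<xi>.\<close>
  define r where "r s = axis A (exp (- s))" for s :: real
  have "tends_to_bdry r (moebius (abs_psl2c A) (Some 0)) at_top"
    unfolding r_def
    by (rule axis_tends_0[OF A(1)]) (auto intro!: filterlim_compose[OF exp_at_bot] filterlim_uminus_at_bot_at_top)
  moreover have "hgeodesic {0..} r"
    using A by (auto simp: hgeodesic_def r_def axis_H3 axis_dist)
  ultimately have "hgeodesic {0..} r \<and> tends_to_bdry r \<xi> at_top"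
    using k_rep(2)[of \<xi>] A by simp
  then show "b = ln (bus_c \<xi> x) - ln (bus_c \<xi> y)"
    using b conv tendsto_unique[OF trivial_limit_at_top_linorder] by blast
qed

text \<open>A fixed boundary point is an eigenline of the matrix. Moving the base point changes its
  horosphere by the squared modulus of an eigenvalue, so preserving the horosphere makes the
  eigenvalue unimodular.\<close>

lemma eigenvector_of_fixed:
  assumes A: "A \<in> SL" and fix_xi: "moebius_mat A \<xi> = \<xi>" and bus: "bus_c \<xi> (hact_mat A (0, 1)) = bus_c \<xi> (0, 1)"
  obtains v1 v2 l where "cmod l = 1" "(v1, v2) = (case \<xi> of None \<Rightarrow> (1, 0) | Some w \<Rightarrow> (w, 1))"
    "A$1$1 * v1 + A$1$2 * v2 = l * v1" "A$2$1 * v1 + A$2$2 * v2 = l * v2"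
proof -
  define a b c d where "a = A$1$1" and "b = A$1$2" and "c = A$2$1" and "d = A$2$2"
  have det: "a * d - b * c = 1" using A by (simp add: SL_iff a_def b_def c_def d_def)
  have dp: "den A > 0" by (rule den_pos[OF A])
  show thesis
  proof (cases \<xi>)
    case None
    then have c: "c = 0" using fix_xi by (simp add: moebius_mat_def c_def Let_def split: if_splits)
    have "den A = 1" using bus dp by (simp add: None bus_c_def hact_mat_base)
    then have "(cmod d)\<^sup>2 = 1" using c by (simp add: den_def c_def d_def)
    then have "cmod d = 1" by (simp add: power2_eq_1_iff) (use norm_ge_zero[of d] in linarith)
    moreover have "cmod a * cmod d = 1" using det c by (simp flip: norm_mult)
    ultimately have "cmod a = 1" by simp
    then show thesis using c None by (intro that[of a 1 0]) (auto simp: a_def c_def)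
  next
    case (Some w)
    define l where "l = c * w + d"
    have l: "l \<noteq> 0" "a * w + b = l * w"
      using fix_xi by (auto simp: Some moebius_mat_def Let_def l_def a_def b_def c_def d_def field_simps split: if_splits)
    define m where "m = a - w * c"
    have bm: "b - w * d = - w * m" using l(2) by (simp add: l_def m_def algebra_simps)
    have "m * l = 1"
    proof -
      have "m * l = a * d + c * (a * w) - c * w * l" by (simp add: m_def l_def algebra_simps)
      also have "a * w = l * w - b" using l(2) by (simp add: algebra_simps)
      finally show ?thesis using det by (simp add: algebra_simps)
    qed
    then have ml: "cmod m * cmod l = 1" by (metis norm_mult norm_one)
    have "bus_c \<xi> (hact_mat A (0, 1)) = (cmod (znum A / of_real (den A) - w))\<^sup>2 * den A + 1 / den A"
      using dp by (simp add: Some bus_c_def hact_mat_base field_simps power2_eq_square)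
    also have "\<dots> = ((cmod (znum A - w * of_real (den A)))\<^sup>2 + 1) / den A"
    proof -
      have "znum A / of_real (den A) - w = (znum A - w * of_real (den A)) / of_real (den A)"
        using dp by (simp add: field_simps)
      then have "cmod (znum A / of_real (den A) - w) = cmod (znum A - w * of_real (den A)) / den A"
        using dp by (simp add: norm_divide)
      moreover have "(X / t)\<^sup>2 * t + 1 / t = (X\<^sup>2 + 1) / t" if "t > 0" for X t :: real
        using that by (simp add: field_simps power2_eq_square)
      ultimately show ?thesis using dp by simp
    qed
    also have "(cmod (znum A - w * of_real (den A)))\<^sup>2 + 1 = ((cmod m)\<^sup>2 + (cmod (w * m))\<^sup>2) * den A"
    proof -
      \<comment> \<open>A followed by the translation by -w. Its first row is m (1, -w) by the
        eigenvector equation, so the identity for the rows evaluates the Busemann term in closed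
        form.\<close>
      define B where "B = mat2 (a - w * c) (b - w * d) c d"
      have "B \<in> SL" using det by (simp add: B_def SL_mat2 algebra_simps)
      moreover have "znum B = znum A - w * of_real (den A)"
        unfolding znum_def den_def of_real_add complex_norm_square
        by (simp add: B_def a_def b_def c_def d_def algebra_simps)
      moreover have "den B = den A" by (simp add: den_def B_def c_def d_def)
      ultimately show ?thesis
        using znum_den[of B] by (simp add: B_def bm flip: m_def) 
    qed
    also have "\<dots> / den A = (cmod m)\<^sup>2 * (1 + (cmod w)\<^sup>2)"
      using dp by (simp add: norm_mult power_mult_distrib field_simps)
    finally have "(cmod m)\<^sup>2 * (1 + (cmod w)\<^sup>2) = 1 + (cmod w)\<^sup>2"
      using bus by (simp add: Some bus_c_def)
    moreover have "1 + (cmod w)\<^sup>2 > 0" by (simp add: add_pos_nonneg)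
    ultimately have "(cmod m)\<^sup>2 = 1" by simp
    then have "cmod m = 1" by (simp add: power2_eq_1_iff) (use norm_ge_zero[of m] in linarith)
    then have "cmod l = 1" using ml by simp
    then show thesis
      using l by (intro that[of l w 1]) (auto simp: Some l_def a_def b_def c_def d_def)
  qed
qed

section \<open>Two limit points\<close>

text \<open>These need no measurability of \<open>f\<close>: \<^const>\<open>measure_of\<close> either returns the given set function or the
  zero measure.\<close>

lemma emeasure_distr_nonzero:
  assumes "emeasure (distr M N f) C \<noteq> 0" "B \<in> sets N"
  shows "emeasure (distr M N f) B = emeasure M (f -` B \<inter> space M)"
  using assms unfolding distr_def emeasure_measure_of_conv
  by (simp add: sets.sigma_sets_eq split: if_splits)

lemma emeasure_density_nonzero:
  assumes "emeasure (density M f) C \<noteq> 0" "B \<in> sets M"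
  shows "emeasure (density M f) B = (\<integral>\<^sup>+x. f x * indicator B x \<partial>M)"
  using assms unfolding density_def emeasure_measure_of_conv
  by (simp add: sets.sigma_sets_eq split: if_splits)

section \<open>Elliptic elements and groups with a common eigenvector\<close>

lemma norm_mat_le:
  fixes A :: "complex^2^2"
  assumes "\<And>i j. cmod (A$i$j) \<le> r" "r \<ge> 0" shows "norm A \<le> 2 * r"
proof (rule power2_le_imp_le)
  have "(cmod (A$i$j))\<^sup>2 \<le> r\<^sup>2" for i j using assms(1)[of i j] by (intro power_mono) auto
  from this[of 1 1] this[of 1 2] this[of 2 1] this[of 2 2]
  show "(norm A)\<^sup>2 \<le> (2 * r)\<^sup>2" by (simp add: norm_mat_sq power_mult_distrib)
qed (use assms in simp)

text \<open>A has the two distinct unimodular eigenvalues l and 1 / l, hence is diagonalisable with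
  bounded powers.\<close>

lemma bounded_powers:
  assumes A: "A \<in> SL" and l: "cmod l = 1" "l\<^sup>2 \<noteq> 1"
    and char: "A$1$1 + A$2$2 = l + 1 / l"
  obtains r where "\<And>n :: nat. abs_psl2c A [^]\<^bsub>PSL2C\<^esub> n \<in> psl_ball r"
proof -
  define k where "k = 1 / l"
  have l0: "l \<noteq> 0" using l(1) by auto
  then have lk: "l * k = 1" by (simp add: k_def)
  have ne: "l - k \<noteq> 0" using l(2) l0 by (auto simp: k_def field_simps power2_eq_square)
  have kn: "cmod k = 1" using l(1) by (simp add: k_def norm_divide)
  have det: "A$1$1 * A$2$2 - A$1$2 * A$2$1 = 1" using A by (simp add: SL_iff)
  have tr: "A$2$2 = l + k - A$1$1" using char by (simp add: k_def algebra_simps)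
  have bc: "A$1$2 * A$2$1 = A$1$1 * (l + k - A$1$1) - 1" using det by (simp add: tr algebra_simps)
  define e :: "complex^2^2" where "e = mat 1"
  have e: "e$1$1 = 1" "e$1$2 = 0" "e$2$1 = 0" "e$2$2 = 1" by (simp_all add: e_def mat_def)
  \<comment> \<open>Sylvester's interpolation formula for the n-th power of A with eigenvalues l and
    k.\<close>
  define B where "B n = (\<chi> i j. (l^n * (A$i$j - k * e$i$j) + k^n * (l * e$i$j - A$i$j)) / (l - k))" for n
  have B_step: "A ** B n = B (Suc n)" for n
  proof -
    \<comment> \<open>The Cayley-Hamilton equation (A - l)(A - k) = 0, written entrywise.\<close>
    have eqs: "A$1$1 * (A$1$1 - k) + A$1$2 * A$2$1 = l * (A$1$1 - k)"
      "A$1$1 * (l - A$1$1) - A$1$2 * A$2$1 = k * (l - A$1$1)"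
      "A$2$1 * A$1$2 + A$2$2 * (A$2$2 - k) = l * (A$2$2 - k)"
      "A$2$2 * (l - A$2$2) - A$2$1 * A$1$2 = k * (l - A$2$2)"
      using lk bc by (simp_all add: tr algebra_simps)
    have dist: "a1 * ((P * x1 + Q * y1) / m) + a2 * ((P * x2 + Q * y2) / m) =
        (P * (a1 * x1 + a2 * x2) + Q * (a1 * y1 + a2 * y2)) / m" for a1 a2 x1 x2 y1 y2 P Q m :: complex
      by (simp add: algebra_simps add_divide_distrib)
    have "(A ** B n) $ i $ j = (l^n * (A$i$1 * (A$1$j - k * e$1$j) + A$i$2 * (A$2$j - k * e$2$j))
        + k^n * (A$i$1 * (l * e$1$j - A$1$j) + A$i$2 * (l * e$2$j - A$2$j))) / (l - k)" for i j
      by (simp only: mult_nth B_def vec_lambda_beta dist)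
    moreover have "A$i$1 * (A$1$j - k * e$1$j) + A$i$2 * (A$2$j - k * e$2$j) = l * (A$i$j - k * e$i$j)"
      and "A$i$1 * (l * e$1$j - A$1$j) + A$i$2 * (l * e$2$j - A$2$j) = k * (l * e$i$j - A$i$j)" for i j
      using exhaust_2[of i] exhaust_2[of j] eqs by (auto simp: e tr algebra_simps)
    ultimately show ?thesis by (simp add: vec_eq_iff B_def mult.assoc mult.left_commute)
  qed
  have B0: "B 0 = mat 1"
    using ne by (simp add: mat_eq_2 B_def e flip: e_def)
  have pow: "B n \<in> SL \<and> abs_psl2c A [^]\<^bsub>PSL2C\<^esub> n = abs_psl2c (B n)" for n :: nat
  proof (induction n)
    case 0
    then show ?case by (simp add: B0 SL_one psl_one_abs)
  next
    case (Suc n)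
    have "abs_psl2c A [^]\<^bsub>PSL2C\<^esub> Suc n = psl_mult (abs_psl2c A) (abs_psl2c A [^]\<^bsub>PSL2C\<^esub> n)"
      using psl.nat_pow_Suc2[of "abs_psl2c A" n] by simp
    then show ?case using Suc A by (simp add: abs_mult SL_mult flip: B_step)
  qed
  define r where "r = (\<Sum>i\<in>UNIV. \<Sum>j\<in>UNIV. (cmod (A$i$j - k * e$i$j) + cmod (l * e$i$j - A$i$j)) / cmod (l - k))"
  have "cmod (B n $ i $ j) \<le> r" for n i j
  proof -
    have "cmod (B n $ i $ j) \<le> (cmod (A$i$j - k * e$i$j) + cmod (l * e$i$j - A$i$j)) / cmod (l - k)"
      unfolding B_def vec_lambda_beta norm_divide
      by (intro divide_right_mono order_trans[OF norm_triangle_ineq])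
         (simp_all add: norm_mult norm_power l kn)
    also have "\<dots> \<le> (\<Sum>j\<in>UNIV. (cmod (A$i$j - k * e$i$j) + cmod (l * e$i$j - A$i$j)) / cmod (l - k))"
      by (rule member_le_sum) auto
    also have "\<dots> \<le> r"
      unfolding r_def by (rule member_le_sum) (auto intro!: sum_nonneg)
    finally show ?thesis .
  qed
  moreover have "r \<ge> 0" unfolding r_def by (auto intro!: sum_nonneg)
  ultimately have "norm (B n) \<le> 2 * r" for n by (intro norm_mat_le)
  then show thesis using pow by (intro that[of "2 * r"]) (simp add: abs_in_psl_ball)
qed

context kleinian
begin

text \<open>All elements of \<Gamma> have the same image in X, so a small set contains at most one
  of them; finitely many small sets cover a compact ball.\<close>

lemma finite_ball_inter: "finite (\<Gamma> \<inter> psl_ball r)"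
proof -
  obtain \<A> where \<A>: "countable \<A>" "\<And>W. W \<in> \<A> \<Longrightarrow> small W"
    "\<And>V. open V \<Longrightarrow> V = \<Union>{W \<in> \<A>. W \<subseteq> V}" by (rule countable_small; blast)
  have "psl_ball r \<subseteq> \<Union>\<A>" using \<A>(3)[of UNIV] by auto
  moreover have "\<And>W. W \<in> \<A> \<Longrightarrow> open W" using \<A>(2) by (simp add: small_def)
  ultimately obtain \<F> where \<F>: "\<F> \<subseteq> \<A>" "finite \<F>" "psl_ball r \<subseteq> \<Union>\<F>"
    using compactE[OF compact_psl_ball] by metis
  have "finite (\<Gamma> \<inter> W)" if "W \<in> \<F>" for W
  proof -
    have inj: "inj_on pr W" using that \<F> \<A>(2) by (auto simp: small_def)
    have "x = y" if "x \<in> \<Gamma> \<inter> W" "y \<in> \<Gamma> \<inter> W" for x y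
    proof -
      have "pr x = pr y" using that pr_mult[of x psl_one] pr_mult[of y psl_one] by simp
      then show ?thesis using inj that by (auto dest: inj_onD)
    qed
    then have "\<exists>x. \<Gamma> \<inter> W \<subseteq> {x}" by blast
    then show ?thesis using finite_subset by blast
  qed
  then have "finite (\<Union>W\<in>\<F>. \<Gamma> \<inter> W)" using \<F>(2) by blast
  then show ?thesis by (rule finite_subset[rotated]) (use \<F>(3) in auto)
qed

text \<open>Otherwise the powers stay in a ball, which contains finitely many elements of \<Gamma>,
  so two of them agree. Torsion-freeness makes the element trivial, and trace 2 or -2 gives l = 1 or
  l = -1.\<close>

lemma unimodular_eigenvalue:
  assumes tf: "torsion_free \<Gamma>" and A: "A \<in> SL" "abs_psl2c A \<in> \<Gamma>"
    and l: "cmod l = 1" and char: "A$1$1 + A$2$2 = l + 1 / l"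
  shows "l\<^sup>2 = 1"
proof (rule ccontr)
  assume l2: "l\<^sup>2 \<noteq> 1"
  obtain r where r: "\<And>n :: nat. abs_psl2c A [^]\<^bsub>PSL2C\<^esub> n \<in> psl_ball r"
    using bounded_powers[OF A(1) l l2 char] by metis
  let ?g = "abs_psl2c A"
  have pow_mem: "?g [^]\<^bsub>PSL2C\<^esub> n \<in> \<Gamma>" for n :: nat
    by (induction n) (auto simp: one_mem intro: mult_mem A)
  have "range (\<lambda>n :: nat. ?g [^]\<^bsub>PSL2C\<^esub> n) \<subseteq> \<Gamma> \<inter> psl_ball r" using r pow_mem by auto
  then have "finite (range (\<lambda>n :: nat. ?g [^]\<^bsub>PSL2C\<^esub> n))"
    using finite_ball_inter finite_subset by blast
  then have "\<not> inj (\<lambda>n :: nat. ?g [^]\<^bsub>PSL2C\<^esub> n)" using finite_imageD infinite_UNIV_nat by blast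
  then obtain m n :: nat where mn: "m < n" "?g [^]\<^bsub>PSL2C\<^esub> m = ?g [^]\<^bsub>PSL2C\<^esub> n"
    unfolding inj_def by (metis nat_neq_iff)
  then have "?g [^]\<^bsub>PSL2C\<^esub> (n - m) = psl_one"
    using psl.pow_eq_div2[of ?g n m] by simp
  then have "?g = psl_one" using tf mn A(2) by (auto simp: torsion_free_def)
  then have "A = mat 1 \<or> A = - mat 1" using A(1) SL_one by (simp add: psl_one_abs abs_eq_iff)
  then have "l + 1 / l = 2 \<or> l + 1 / l = - 2" using char by (auto simp: mat_def)
  moreover have "l \<noteq> 0" using l by auto
  ultimately have "l * l + 1 = 2 * l \<or> l * l + 1 = - (2 * l)" by (auto simp: field_simps)
  moreover have "(l - 1)\<^sup>2 = (l * l + 1) - 2 * l" "(l + 1)\<^sup>2 = (l * l + 1) + 2 * l"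
    by (simp_all add: power2_eq_square algebra_simps)
  ultimately have "(l - 1)\<^sup>2 = 0 \<or> (l + 1)\<^sup>2 = 0" by auto
  then have "l = 1 \<or> l = - 1" by (auto simp: eq_neg_iff_add_eq_0)
  then show False using l2 by auto
qed

text \<open>The eigenvalue is 1 or -1 for every element, so all of them are scalar plus a multiple
  of one fixed nilpotent matrix and commute. An abelian \<Gamma> is virtually abelian with itself as
  the subgroup of finite index.\<close>

lemma not_common_eigenvector:
  assumes tf: "torsion_free \<Gamma>" and ne: "non_elementary \<Gamma>"
    and ev: "\<And>A. A \<in> SL \<Longrightarrow> abs_psl2c A \<in> \<Gamma> \<Longrightarrow> \<exists>l. cmod l = 1 \<and>
      A$1$1 * v1 + A$1$2 * v2 = l * v1 \<and> A$2$1 * v1 + A$2$2 * v2 = l * v2"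
    and v: "(v1, v2) = (1, 0) \<or> v2 = 1"
  shows False
proof -
  have comm: "psl_mult x y = psl_mult y x" if xy: "x \<in> \<Gamma>" "y \<in> \<Gamma>" for x y
  proof -
    \<comment> \<open>The nilpotent matrix is the column (v1, v2) times the row (v2, -v1), which
      annihilates (v1, v2).\<close>
    have shape: "\<exists>s t. A$1$1 = s + t * (v1 * v2) \<and> A$1$2 = - t * v1\<^sup>2 \<and>
        A$2$1 = t * v2\<^sup>2 \<and> A$2$2 = s - t * (v1 * v2)" if A: "A \<in> SL" "abs_psl2c A \<in> \<Gamma>" for A
    proof -
      obtain l where l: "cmod l = 1" "A$1$1 * v1 + A$1$2 * v2 = l * v1" "A$2$1 * v1 + A$2$2 * v2 = l * v2"
        using ev[OF A] by auto
      have l0: "l \<noteq> 0" using l(1) by auto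
      have det: "A$1$1 * A$2$2 - A$1$2 * A$2$1 = 1" using A(1) by (simp add: SL_iff)
      show ?thesis
      proof (cases "v2 = 1")
        case True
        have d: "A$2$2 = l - A$2$1 * v1" and b: "A$1$2 = l * v1 - A$1$1 * v1"
          using l True by (simp_all add: algebra_simps)
        have "l * (A$1$1 - A$2$1 * v1) = 1"
          using det by (simp add: d b algebra_simps)
        then have a: "A$1$1 - A$2$1 * v1 = 1 / l" using l0 by (simp add: field_simps)
        then have "A$1$1 + A$2$2 = l + 1 / l" by (simp add: d algebra_simps)
        then have "l\<^sup>2 = 1" by (rule unimodular_eigenvalue[OF tf A l(1)])
        then have "1 / l = l" using l0 by (simp add: field_simps power2_eq_square)
        then have "A$1$1 = l + A$2$1 * v1" using a by (simp add: algebra_simps)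
        then show ?thesis
          using True d b by (intro exI[of _ l] exI[of _ "A$2$1"]) (simp add: algebra_simps power2_eq_square)
      next
        case False
        then have v': "v1 = 1" "v2 = 0" using v by auto
        then have a: "A$1$1 = l" and c: "A$2$1 = 0" using l by auto
        then have d: "A$2$2 = 1 / l" using det l0 by (simp add: field_simps)
        then have "l\<^sup>2 = 1" using a by (intro unimodular_eigenvalue[OF tf A l(1)]) simp
        then have "1 / l = l" using l0 by (simp add: field_simps power2_eq_square)
        then show ?thesis using a c d v' by (intro exI[of _ l] exI[of _ "- A$1$2"]) simp
      qed
    qed
    obtain A B where A: "A \<in> SL" "x = abs_psl2c A" and B: "B \<in> SL" "y = abs_psl2c B"
      using abs_cases by metis
    obtain s t where st: "A$1$1 = s + t * (v1 * v2)" "A$1$2 = - t * v1\<^sup>2"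
        "A$2$1 = t * v2\<^sup>2" "A$2$2 = s - t * (v1 * v2)" using shape[of A] A xy by auto
    obtain s' t' where st': "B$1$1 = s' + t' * (v1 * v2)" "B$1$2 = - t' * v1\<^sup>2"
        "B$2$1 = t' * v2\<^sup>2" "B$2$2 = s' - t' * (v1 * v2)" using shape[of B] B xy by auto
    have "A ** B = B ** A"
      by (simp add: mat_eq_2 mult_nth st st' algebra_simps power2_eq_square)
    then show ?thesis using A B by (simp add: abs_mult)
  qed
  let ?G = "PSL2C\<lparr>carrier := \<Gamma>\<rparr>"
  have grp: "group ?G" using subgroup.subgroup_is_group[OF subgroup group_PSL2C] .
  have "comm_group ?G"
    by (rule group.group_comm_groupI[OF grp]) (simp add: comm)
  moreover have self: "subgroup \<Gamma> ?G" using group.subgroup_self[OF grp] by simp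
  moreover have "rcosets\<^bsub>?G\<^esub> \<Gamma> \<subseteq> {\<Gamma>}"
    using group.coset_join2[OF grp _ self] by (auto simp: RCOSETS_def)
  then have "finite (rcosets\<^bsub>?G\<^esub> \<Gamma>)" using finite_subset by blast
  ultimately have "virtually_abelian ?G"
    unfolding virtually_abelian_def by (intro exI[of _ \<Gamma>]) simp
  then show False using ne by (simp add: non_elementary_def)
qed

end

section \<open>The limit set is not a single point\<close>

context ps_br
begin

lemma space_PS: "x \<in> H3 \<Longrightarrow> space (\<nu> x) = UNIV"
  using sets_eq_imp_space_eq[OF PS_sets, of x]
  by (simp add: borel_of_top_def bdry_top_def space_measure_of_conv UNIV_option_conv)

text \<open>A one-point limit set turns each \<nu> x into a point mass at \<xi>. Pushing forward by
  \<gamma> keeps the total mass, whereas the density multiplies it by exp (- \<delta> b); for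
  \<delta> \<noteq> 0 the Busemann term b must vanish.\<close>

lemma limit_set_two_points:
  assumes tf: "torsion_free \<Gamma>" and ne: "non_elementary \<Gamma>" and \<delta>: "\<delta> \<noteq> 0"
  shows "\<exists>\<eta>\<in>limit_set \<Gamma>. \<eta> \<noteq> \<xi>"
proof (rule ccontr)
  assume "\<not> (\<exists>\<eta>\<in>limit_set \<Gamma>. \<eta> \<noteq> \<xi>)"
  then have sub: "limit_set \<Gamma> \<subseteq> {\<xi>}" by auto
  let ?N = "borel_of_top bdry_top"
  have UNIV_N: "UNIV \<in> sets ?N"
    using sets.top[of "\<nu> base_pt"] PS_sets[OF base_H3] space_PS[OF base_H3] by simp
  have AE_xi: "AE \<zeta> in \<nu> x. \<zeta> = \<xi>" if "x \<in> H3" for x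
    using PS_AE[OF that] by eventually_elim (use sub in auto)
  have "limit_set \<Gamma> \<noteq> {}" using PS_null[OF base_H3] PS_nonzero[OF base_H3] by auto
  then have L: "limit_set \<Gamma> = {\<xi>}" using sub by auto
  then have co: "- {\<xi>} \<in> sets ?N" using sets_bdry[OF closed_limit_set] by metis
  then have xi_N: "{\<xi>} \<in> sets ?N"
    using sets.Diff[OF UNIV_N, of "- {\<xi>}"] by (simp add: Diff_eq)
  have null: "emeasure (\<nu> x) (- {\<xi>}) = 0" if "x \<in> H3" for x using PS_null[OF that] L by simp
  have full: "emeasure (\<nu> x) {\<xi>} = emeasure (\<nu> x) UNIV" if x: "x \<in> H3" for x
    using AE_xi[OF x] xi_N UNIV_N PS_sets[OF x]
    by (intro emeasure_eq_AE) auto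
  have fixed: "moebius \<gamma> \<xi> = \<xi>" and bus: "busemann \<xi> (hact \<gamma> base_pt) base_pt = 0" if \<gamma>: "\<gamma> \<in> \<Gamma>" for \<gamma>
  proof -
    have x: "hact \<gamma> base_pt \<in> H3" using horbit_H3[OF base_H3] abs_cases by metis
    have distr: "distr (\<nu> base_pt) ?N (moebius \<gamma>) = \<nu> (hact \<gamma> base_pt)"
      using PS \<gamma> base_H3 unfolding PS_density_def by blast
    \<comment> \<open>A nonzero pushforward is evaluated by the preimage formula, with measurability
      of \<open>moebius \<gamma>\<close> left open.\<close>
    have nz: "emeasure (distr (\<nu> base_pt) ?N (moebius \<gamma>)) UNIV \<noteq> 0"
      using PS_nonzero[OF x] distr by simp
    have pre: "emeasure (\<nu> (hact \<gamma> base_pt)) B = emeasure (\<nu> base_pt) (moebius \<gamma> -` B)" if "B \<in> sets ?N" for B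
      using emeasure_distr_nonzero[OF nz that] by (simp add: distr space_PS[OF base_H3])
    show "moebius \<gamma> \<xi> = \<xi>"
    proof (rule ccontr)
      assume "moebius \<gamma> \<xi> \<noteq> \<xi>"
      then have "moebius \<gamma> -` {\<xi>} \<subseteq> - {\<xi>}" by auto
      then have "emeasure (\<nu> base_pt) (moebius \<gamma> -` {\<xi>}) \<le> emeasure (\<nu> base_pt) (- {\<xi>})"
        using co PS_sets[OF base_H3] by (intro emeasure_mono) auto
      then have "emeasure (\<nu> (hact \<gamma> base_pt)) {\<xi>} = 0" using pre[OF xi_N] null[OF base_H3] by simp
      then show False using full[OF x] PS_nonzero[OF x] by simp
    qed
    have mass: "emeasure (\<nu> (hact \<gamma> base_pt)) UNIV = emeasure (\<nu> base_pt) UNIV"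
      using pre[OF UNIV_N] by simp
    define b where "b = busemann \<xi> (hact \<gamma> base_pt) base_pt"
    define f where "f = (\<lambda>\<zeta>. ennreal (exp (- \<delta> * busemann \<zeta> (hact \<gamma> base_pt) base_pt)))"
    have dens: "\<nu> (hact \<gamma> base_pt) = density (\<nu> base_pt) f"
      using PS x base_H3 unfolding PS_density_def f_def by blast
    have "emeasure (density (\<nu> base_pt) f) UNIV \<noteq> 0" using PS_nonzero[OF x] dens by simp
    then have "emeasure (density (\<nu> base_pt) f) UNIV = (\<integral>\<^sup>+\<zeta>. f \<zeta> * indicator UNIV \<zeta> \<partial>\<nu> base_pt)"
      by (rule emeasure_density_nonzero) (simp add: PS_sets[OF base_H3] UNIV_N)
    also have "\<dots> = (\<integral>\<^sup>+\<zeta>. ennreal (exp (- \<delta> * b)) \<partial>\<nu> base_pt)"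
      by (rule nn_integral_cong_AE) (use AE_xi[OF base_H3] in eventually_elim, simp add: f_def b_def)
    also have "\<dots> = ennreal (exp (- \<delta> * b)) * emeasure (\<nu> base_pt) UNIV"
      by (simp add: space_PS[OF base_H3])
    finally have eq: "emeasure (\<nu> base_pt) UNIV = ennreal (exp (- \<delta> * b)) * emeasure (\<nu> base_pt) UNIV"
      using mass dens by simp
    define m where "m = measure (\<nu> base_pt) UNIV"
    interpret finite_measure "\<nu> base_pt" by (rule PS_finite[OF base_H3])
    have m: "emeasure (\<nu> base_pt) UNIV = ennreal m" unfolding m_def by (simp add: emeasure_eq_measure)
    have "m \<ge> 0" by (simp add: m_def)
    then have "ennreal m = ennreal (exp (- \<delta> * b) * m)"
      using eq unfolding m by (simp add: ennreal_mult)
    then have "m = exp (- \<delta> * b) * m" using \<open>m \<ge> 0\<close> by (simp add: ennreal_inj)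
    moreover have "m \<noteq> 0" using m PS_nonzero[OF base_H3] by auto
    ultimately have "exp (- \<delta> * b) = 1" by simp
    then show "busemann \<xi> (hact \<gamma> base_pt) base_pt = 0" using \<delta> by (simp add: b_def)
  qed
  obtain v1 v2 :: complex where v: "(v1, v2) = (case \<xi> of None \<Rightarrow> (1, 0) | Some w \<Rightarrow> (w, 1))"
    by (metis surj_pair)
  show False
  proof (rule not_common_eigenvector[OF tf ne])
    show "(v1, v2) = (1, 0) \<or> v2 = 1" using v by (cases \<xi>) auto
    fix A assume A: "A \<in> SL" "abs_psl2c A \<in> \<Gamma>"
    have "moebius_mat A \<xi> = \<xi>" using fixed[OF A(2)] moebius_abs[OF A(1)] by simp
    moreover have "hact_mat A (0, 1) \<in> H3"
      using horbit_H3[OF base_H3 A(1)] by (simp add: hact_abs[OF A(1)] base_pt_def)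
    then have "ln (bus_c \<xi> (hact_mat A (0, 1))) = ln (bus_c \<xi> (0, 1))"
      using bus[OF A(2)] busemann_eq[of "hact_mat A (0, 1)" base_pt \<xi>] base_H3
      by (simp add: hact_abs[OF A(1)] base_pt_def)
    then have "bus_c \<xi> (hact_mat A (0, 1)) = bus_c \<xi> (0, 1)"
      using bus_c_pos[OF \<open>hact_mat A (0, 1) \<in> H3\<close>, of \<xi>] bus_c_pos[OF base_H3, of \<xi>]
      by (simp add: base_pt_def)
    ultimately obtain v1' v2' l where "cmod l = 1" "(v1', v2') = (case \<xi> of None \<Rightarrow> (1, 0) | Some w \<Rightarrow> (w, 1))"
      "A$1$1 * v1' + A$1$2 * v2' = l * v1'" "A$2$1 * v1' + A$2$2 * v2' = l * v2'"
      by (rule eigenvector_of_fixed[OF A(1)])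
    then show "\<exists>l. cmod l = 1 \<and> A$1$1 * v1 + A$1$2 * v2 = l * v1 \<and> A$2$1 * v1 + A$2$2 * v2 = l * v2"
      using v by (metis prod.inject)
  qed
qed

end

section \<open>Conical limit points and conservativity\<close>

lemma continuous_on_hact: "continuous_on H3 (hact g)"
proof -
  obtain A where A: "A \<in> SL" "g = abs_psl2c A" by (rule abs_cases)
  have "complex_of_real ((cmod (A$2$1 * fst p + A$2$2))\<^sup>2 + (cmod (A$2$1))\<^sup>2 * (snd p)\<^sup>2) \<noteq> 0" if "p \<in> H3" for p
    using hact_den_pos[OF that A(1)] unfolding of_real_eq_0_iff by simp
  moreover have "(cmod (A$2$1 * fst p + A$2$2))\<^sup>2 + (cmod (A$2$1))\<^sup>2 * (snd p)\<^sup>2 \<noteq> 0" if "p \<in> H3" for p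
    using hact_den_pos[OF that A(1)] by simp
  ultimately show ?thesis
    unfolding A(2) hact_abs[OF A(1)] hact_mat_def case_prod_unfold Let_def
    by (intro continuous_intros) blast+
qed

lemma open_H3: "open H3"
  unfolding H3_def by (intro open_Collect_less continuous_intros)

lemma hconvex_hull_H3: "hconvex_hull L \<subseteq> H3"
proof -
  have "hconvex H3" by (auto simp: hconvex_def hgeodesic_def)
  then show ?thesis unfolding hconvex_hull_def by (intro Inter_lower) (auto simp: hgeodesic_def)
qed

lemma axis_hull:
  assumes A: "A \<in> SL" and "moebius (abs_psl2c A) (Some 0) \<in> L" "moebius (abs_psl2c A) None \<in> L"
  shows "axis A (exp t) \<in> hconvex_hull L"
proof -
  have "axis A (exp t) \<in> C"
    if "\<forall>c. hgeodesic UNIV c \<and> (\<exists>\<xi>\<in>L. tends_to_bdry c \<xi> at_bot) \<and> (\<exists>\<eta>\<in>L. tends_to_bdry c \<eta> at_top) \<longrightarrow> range c \<subseteq> C" for C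
  proof -
    have "range (\<lambda>t. axis A (exp t)) \<subseteq> C"
      using that axis_geodesic[OF A] assms(2,3) by blast
    then show ?thesis by auto
  qed
  then show ?thesis by (simp add: hconvex_hull_def)
qed

text \<open>Open boxes with compact closure in the half-space; for n \<ge> 1 they increase and
  exhaust it.\<close>

definition core_box :: "nat \<Rightarrow> (complex \<times> real) set" where
  "core_box n = {p. cmod (fst p) < real n \<and> 1 / real n < snd p \<and> snd p < real n}"

lemma open_core_box: "open (core_box n)"
  unfolding core_box_def by (intro open_Collect_conj open_Collect_less continuous_intros)

lemma core_box_mono: "0 < m \<Longrightarrow> m \<le> n \<Longrightarrow> core_box m \<subseteq> core_box n"
proof
  fix p assume "0 < m" "m \<le> n" "p \<in> core_box m"
  moreover from this have "1 / real n \<le> 1 / real m" by (simp add: frac_le)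
  ultimately show "p \<in> core_box n" by (simp add: core_box_def)
qed

lemma core_box_cover: "p \<in> H3 \<Longrightarrow> \<exists>n>0. p \<in> core_box n"
proof -
  assume p: "p \<in> H3"
  obtain n :: nat where n: "cmod (fst p) + snd p + 1 / snd p < real n" using reals_Archimedean2 by auto
  have pos: "snd p > 0" "1 / snd p > 0" using p by (auto simp: H3_def)
  moreover have "real n > 1 / snd p" using n pos norm_ge_zero[of "fst p"] by linarith
  then have "1 / real n < snd p" using pos by (metis divide_less_eq mult.commute order_less_trans pos_divide_less_eq)
  moreover have "real n > 0" using \<open>real n > 1 / snd p\<close> pos by linarith
  moreover have "cmod (fst p) < real n" "snd p < real n"
    using n pos norm_ge_zero[of "fst p"] by linarith+
  ultimately show ?thesis by (intro exI[of _ n]) (simp add: core_box_def)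
qed

text \<open>Properness of the orbit map: the position of A applied to the base point controls A.
  With Z and D as below, the squared norm is (Z^2 + 1) / D + D.\<close>

lemma norm_of_core_box:
  assumes A: "A \<in> SL" and box: "hact_mat A (0, 1) \<in> core_box n"
  shows "norm A \<le> real n ^ 3 + 2 * real n + 1"
proof -
  define D Z where "D = den A" and "Z = cmod (znum A)"
  have D: "D > 0" using den_pos[OF A] by (simp add: D_def)
  have "Z / D < n" "1 / real n < 1 / D" "1 / D < n"
    using box D by (simp_all add: core_box_def hact_mat_base norm_divide D_def Z_def)
  moreover have n: "real n > 0" using \<open>1 / D < n\<close> D by (metis divide_pos_pos order_less_trans zero_less_one)
  ultimately have b: "Z \<le> n * D" "D \<le> n" "1 / D \<le> n" using D by (simp_all add: field_simps)
  have Z: "Z \<ge> 0" by (simp add: Z_def)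
  have S: "(cmod (A$1$1))\<^sup>2 + (cmod (A$1$2))\<^sup>2 = (Z\<^sup>2 + 1) / D"
    using znum_den[OF A] D by (simp add: eq_divide_eq D_def Z_def)
  have "(norm A)\<^sup>2 = ((cmod (A$1$1))\<^sup>2 + (cmod (A$1$2))\<^sup>2) + D"
    by (simp add: norm_mat_sq D_def den_def)
  also note S
  also have "(Z\<^sup>2 + 1) / D = Z * (Z / D) + 1 / D" by (simp add: power2_eq_square add_divide_distrib)
  also have "Z * (Z / D) \<le> (real n * real n) * real n"
  proof (rule mult_mono)
    show "Z \<le> real n * real n" using b n by (meson mult_left_mono order_trans less_imp_le)
    show "Z / D \<le> n" using \<open>Z / D < n\<close> by simp
  qed (use Z D in auto)
  also have "(real n * real n) * real n + 1 / D + D \<le> real n ^ 3 + 2 * real n"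
    using b by (simp add: power3_eq_cube)
  finally have sq: "(norm A)\<^sup>2 \<le> real n ^ 3 + 2 * real n" by simp
  \<comment> \<open>Trades the bound on the square for a linear one without a square root.\<close>
  have "2 * norm A \<le> (norm A)\<^sup>2 + 1" using sum_squares_bound[of "norm A" 1] by simp
  then show ?thesis using sq norm_ge_zero[of A] by linarith
qed

context kleinian
begin

text \<open>Compactness of the core gives one box that meets every orbit in the hull, since the
  orbits meeting a given box form an open set of the core.\<close>

lemma hull_cover:
  assumes "convex_cocompact \<Gamma>"
  shows "\<exists>n. \<forall>p\<in>hconvex_hull (limit_set \<Gamma>). \<exists>\<gamma>\<in>\<Gamma>. hact \<gamma> p \<in> core_box n"
proof -
  let ?H = "hconvex_hull (limit_set \<Gamma>)" and ?Y = "convex_core_top \<Gamma>"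
  have top: "topspace ?Y = horbit \<Gamma> ` ?H" by (simp add: convex_core_top_def)
  define U where "U n = {T \<in> topspace ?Y. T \<inter> core_box n \<noteq> {}}" for n
  have U_open: "openin ?Y (U n)" for n
  proof -
    have "{p \<in> ?H. horbit \<Gamma> p \<in> U n} = ?H \<inter> (\<Union>\<gamma>\<in>\<Gamma>. H3 \<inter> hact \<gamma> -` core_box n)"
      using hconvex_hull_H3 by (auto simp: U_def top horbit_def)
    moreover have "open (H3 \<inter> hact \<gamma> -` core_box n)" for \<gamma>
      by (rule continuous_open_preimage[OF continuous_on_hact open_H3 open_core_box])
    then have "open (\<Union>\<gamma>\<in>\<Gamma>. H3 \<inter> hact \<gamma> -` core_box n)" by (intro open_UN) auto
    ultimately have "openin (top_of_set ?H) {p \<in> ?H. horbit \<Gamma> p \<in> U n}"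
      by (simp only: openin_open_Int)
    then show ?thesis
      unfolding convex_core_top_def openin_quotient_top by (auto simp: U_def top)
  qed
  have U_cover: "topspace ?Y \<subseteq> \<Union>(U ` {0<..})"
  proof
    fix T assume T: "T \<in> topspace ?Y"
    then obtain p where p: "p \<in> ?H" "T = horbit \<Gamma> p" by (auto simp: top)
    then have "p \<in> H3" using hconvex_hull_H3 by blast
    then have "hact psl_one p \<in> H3" unfolding psl_one_abs by (rule horbit_H3[OF _ SL_one])
    then obtain n where "n > 0" "hact psl_one p \<in> core_box n" using core_box_cover by blast
    then have "T \<in> U n" using T p one_mem by (auto simp: U_def horbit_def)
    then show "T \<in> \<Union>(U ` {0<..})" using \<open>n > 0\<close> by auto
  qed
  have "compactin ?Y (topspace ?Y)"
    using assms by (simp add: convex_cocompact_def compact_space_def)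
  then obtain \<F> where "finite \<F>" "\<F> \<subseteq> U ` {0<..}" "topspace ?Y \<subseteq> \<Union>\<F>"
    using U_open U_cover unfolding compactin_def by (metis (no_types, lifting) imageE)
  then obtain I where I: "finite I" "I \<subseteq> {0<..}" "topspace ?Y \<subseteq> \<Union>(U ` I)"
    by (metis finite_subset_image)
  show ?thesis
  proof (intro exI ballI)
    fix p assume p: "p \<in> ?H"
    then have "horbit \<Gamma> p \<in> \<Union>(U ` I)" using I(3) top by auto
    then obtain m where m: "m \<in> I" "horbit \<Gamma> p \<inter> core_box m \<noteq> {}" by (auto simp: U_def)
    have "core_box m \<subseteq> core_box (Max I)" using I m by (intro core_box_mono) auto
    then show "\<exists>\<gamma>\<in>\<Gamma>. hact \<gamma> p \<in> core_box (Max I)" using m(2) by (auto simp: horbit_def)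
  qed
qed

text \<open>The open counterpart of \<open>psl_ball\<close>, whose image in X is open and therefore
  measurable.\<close>

definition norm_ball :: "nat \<Rightarrow> psl2c set" where
  "norm_ball k = abs_psl2c ` (SL \<inter> ball 0 (real k))"

lemma open_norm_ball: "open (norm_ball k)"
  unfolding norm_ball_def by (intro open_abs_image open_ball)

lemma norm_ball_subset: "norm_ball k \<subseteq> psl_ball (real k)"
  by (auto simp: norm_ball_def abs_in_psl_ball)

lemma norm_ball_abs: "A \<in> SL \<Longrightarrow> norm A < real k \<Longrightarrow> abs_psl2c A \<in> norm_ball k"
  by (auto simp: norm_ball_def)

text \<open>Right multiplication by n_z keeps the endpoint g(0) and can move the other endpoint of
  the axis to any boundary point different from g(0), here a second limit point. Along the backward
  flow the correction by n_z shrinks, so the bound for the new axis carries over to g.\<close>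

lemma conical:
  assumes cc: "convex_cocompact \<Gamma>" and two: "\<And>\<xi>. \<exists>\<eta>\<in>limit_set \<Gamma>. \<eta> \<noteq> \<xi>"
    and g: "moebius g (Some 0) \<in> limit_set \<Gamma>"
  shows "\<exists>k. \<forall>s::nat. pr (psl_mult g (a_elt (- real s))) \<in> pr ` norm_ball k"
proof -
  obtain A where A: "A \<in> SL" "g = abs_psl2c A" by (rule abs_cases)
  obtain \<eta> where \<eta>: "\<eta> \<in> limit_set \<Gamma>" "\<eta> \<noteq> moebius g (Some 0)" using two by blast
  define a b c d where "a = A$1$1" and "b = A$1$2" and "c = A$2$1" and "d = A$2$2"
  have det: "a * d - b * c = 1" using A(1) by (simp add: SL_iff a_def b_def c_def d_def)
  have m0: "moebius g (Some 0) = (if d = 0 then None else Some (b / d))"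
    by (simp add: A moebius_abs moebius_mat_def b_def d_def Let_def)
  have "\<exists>z. moebius_mat (A ** n_mat z) None = \<eta>"
  proof (cases \<eta>)
    case None
    then have "d \<noteq> 0" using \<eta>(2) m0 by auto
    then show ?thesis
      by (intro exI[of _ "- c / d"]) (simp add: moebius_mat_def mult_nth n_mat_def None Let_def flip: a_def b_def c_def d_def)
  next
    case (Some e)
    have ne: "b - e * d \<noteq> 0"
    proof
      assume *: "b - e * d = 0"
      then have "d \<noteq> 0" using det by auto
      then show False using * \<eta>(2) m0 Some by (auto simp: field_simps)
    qed
    \<comment> \<open>The solution of (a + b z) / (c + d z) = e; the denominator is nonzero because
      e is not g(0).\<close>
    define z where "z = (e * c - a) / (b - e * d)"
    have z: "a + b * z = e * (c + d * z)" using ne by (simp add: z_def field_simps)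
    have "c + d * z \<noteq> 0"
    proof
      assume *: "c + d * z = 0"
      then have "a + b * z = 0" using z by simp
      then have "(a + b * z) * d - b * (c + d * z) = 0" using * by simp
      then show False using det by (simp add: algebra_simps)
    qed
    then show ?thesis using z
      by (intro exI[of _ z]) (simp add: moebius_mat_def mult_nth n_mat_def Some Let_def flip: a_def b_def c_def d_def)
  qed
  then obtain z where z: "moebius_mat (A ** n_mat z) None = \<eta>" by auto
  define A' where "A' = A ** n_mat z"
  have A': "A' \<in> SL" unfolding A'_def by (intro SL_mult A n_mat_SL)
  have inf': "moebius (abs_psl2c A') None = \<eta>" using z by (simp add: moebius_abs[OF A'] A'_def[symmetric])
  have zero': "moebius (abs_psl2c A') (Some 0) = moebius g (Some 0)"
    using moebius_mult_0[of "n_mat z" g] by (simp add: A'_def A abs_mult) (simp add: n_mat_def)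
  obtain n where n: "\<And>p. p \<in> hconvex_hull (limit_set \<Gamma>) \<Longrightarrow> \<exists>\<gamma>\<in>\<Gamma>. hact \<gamma> p \<in> core_box n"
    using hull_cover[OF cc] by metis
  let ?N = "n_mat ` cball 0 (cmod z)"
  have "compact ?N" "?N \<subseteq> SL"
    by (auto intro!: compact_continuous_image continuous_intros)
  then obtain r where r: "\<And>E B. E \<in> SL \<Longrightarrow> norm E \<le> real n ^ 3 + 2 * real n + 1 \<Longrightarrow> B \<in> ?N \<Longrightarrow> norm (E ** B) \<le> r"
    by (rule psl_ball_mult[of _ "real n ^ 3 + 2 * real n + 1"]) blast
  obtain k :: nat where k: "r < real k" using reals_Archimedean2 by auto
  show ?thesis
  proof (intro exI allI)
    fix s :: nat
    let ?a = "a_mat (- real s)"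
    have "den ?a = exp (real s)"
      by (simp add: den_def a_mat_def norm_exp_eq_Re power2_eq_square flip: exp_add)
    then have "hact_mat ?a (0, 1) = (0, exp (- real s))"
      by (simp add: hact_mat_base znum_def a_mat_def exp_minus field_simps)
    then have ax: "axis A' (exp (- real s)) = hact_mat (A' ** ?a) (0, 1)"
      using hact_mat_mult_base[OF A' a_mat_SL, of "- real s"] by (simp add: axis_def)
    have "axis A' (exp (- real s)) \<in> hconvex_hull (limit_set \<Gamma>)"
      by (rule axis_hull[OF A']) (use inf' zero' \<eta> g in auto)
    then obtain \<gamma> where \<gamma>: "\<gamma> \<in> \<Gamma>" "hact \<gamma> (axis A' (exp (- real s))) \<in> core_box n" using n by blast
    obtain C where C: "C \<in> SL" "\<gamma> = abs_psl2c C" by (rule abs_cases)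
    define E where "E = C ** (A' ** ?a)"
    have E: "E \<in> SL" unfolding E_def by (intro SL_mult C A' a_mat_SL)
    have "hact_mat E (0, 1) \<in> core_box n"
      using \<gamma>(2) hact_mat_mult_base[OF C(1) SL_mult[OF A' a_mat_SL]]
      by (simp add: C hact_abs ax E_def)
    then have nE: "norm E \<le> real n ^ 3 + 2 * real n + 1" by (rule norm_of_core_box[OF E])
    \<comment> \<open>The correction -z after it is moved past a_{-s}; its modulus never exceeds
      that of z, so one compact set serves all s.\<close>
    define w where "w = exp (- real s) *\<^sub>R (- z)"
    have "cmod w \<le> cmod z" by (simp add: w_def mult_left_le_one_le)
    then have wN: "n_mat w \<in> ?N" by simp
    have "A = A' ** n_mat (- z)" by (simp add: A'_def n_mat_add flip: matrix_mul_assoc) (simp add: n_mat_def mat_eq_2 mult_nth)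
    then have "C ** (A ** ?a) = E ** n_mat w"
      by (simp add: E_def w_def n_a_mat flip: matrix_mul_assoc)
    then have "psl_mult \<gamma> (psl_mult g (a_elt (- real s))) = abs_psl2c (E ** n_mat w)"
      using A C by (simp add: a_elt_abs abs_mult SL_mult)
    moreover have "abs_psl2c (E ** n_mat w) \<in> norm_ball k"
      using r[OF E nE wN] k by (intro norm_ball_abs SL_mult E n_mat_SL) simp
    ultimately show "pr (psl_mult g (a_elt (- real s))) \<in> pr ` norm_ball k"
      using pr_mult[OF \<gamma>(1)] by (metis imageI)
  qed
qed

text \<open>Provides the enlarged compact set that absorbs all contracted displacements, uniformly
  in s.\<close>

lemma norm_ball_mult_box:
  "\<exists>k'. \<forall>g\<in>norm_ball k. \<forall>t u. \<bar>t\<bar> \<le> 1 \<and> \<bar>u\<bar> \<le> 1 \<longrightarrow> psl_mult g (n_elt (Complex t u)) \<in> norm_ball k'"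
proof -
  let ?N = "(\<lambda>(t, u). n_mat (Complex t u)) ` ({-1..1} \<times> {-1..1})"
  have "compact ?N" "?N \<subseteq> SL"
    by (auto simp: case_prod_unfold intro!: compact_continuous_image continuous_intros compact_Times)
  then obtain r where r: "\<And>E B. E \<in> SL \<Longrightarrow> norm E \<le> real k \<Longrightarrow> B \<in> ?N \<Longrightarrow> norm (E ** B) \<le> r"
    by (rule psl_ball_mult[of _ "real k"]) blast
  obtain k' :: nat where k': "r < real k'" using reals_Archimedean2 by auto
  show ?thesis
  proof (intro exI ballI allI impI)
    fix g and t u :: real assume g: "g \<in> norm_ball k" and tu: "\<bar>t\<bar> \<le> 1 \<and> \<bar>u\<bar> \<le> 1"
    then obtain A where A: "A \<in> SL" "g = abs_psl2c A" "norm A < real k" by (auto simp: norm_ball_def)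
    have "n_mat (Complex t u) \<in> ?N" using tu by (auto intro!: image_eqI[of _ _ "(t, u)"])
    then have "norm (A ** n_mat (Complex t u)) < real k'" using r[of A] A k' by force
    then show "psl_mult g (n_elt (Complex t u)) \<in> norm_ball k'"
      using A by (simp add: n_elt_abs abs_mult norm_ball_abs SL_mult)
  qed
qed

end

section \<open>Transient sets are null\<close>

context br
begin

lemma norm_ball_sets: "pr ` norm_ball k \<in> sets \<mu>"
  by (auto simp: sets_mu intro: open_sets_XB openin_pr open_norm_ball)

lemma sigma_finite_mu: "sigma_finite_measure \<mu>"
proof
  show "\<exists>A. countable A \<and> A \<subseteq> sets \<mu> \<and> \<Union>A = space \<mu> \<and> (\<forall>a\<in>A. emeasure \<mu> a \<noteq> \<infinity>)"
  proof (intro exI conjI ballI)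
    show "countable (range (\<lambda>k. pr ` norm_ball k))" by simp
    show "range (\<lambda>k. pr ` norm_ball k) \<subseteq> sets \<mu>" using norm_ball_sets by auto
    have "\<exists>k. g \<in> norm_ball k" for g
    proof -
      obtain A where A: "A \<in> SL" "g = abs_psl2c A" by (rule abs_cases)
      obtain k :: nat where "norm A < real k" using reals_Archimedean2 by auto
      then show ?thesis using A norm_ball_abs by blast
    qed
    then show "\<Union>(range (\<lambda>k. pr ` norm_ball k)) = space \<mu>" by (auto simp: space_mu) (metis imageI)
    show "\<And>a. a \<in> range (\<lambda>k. pr ` norm_ball k) \<Longrightarrow> emeasure \<mu> a \<noteq> \<infinity>"
      using emeasure_fin[OF norm_ball_subset] by (auto simp: less_top)
  qed
qed

text \<open>Integer times make this a countable intersection of measurable sets, and they suffice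
  for a limit s to infinity.\<close>

definition returning :: "nat \<Rightarrow> psl2c set set" where
  "returning k = {x \<in> space \<mu>. \<forall>s::nat. x #>\<^bsub>PSL2C\<^esub> a_elt (- real s) \<in> pr ` norm_ball k}"

lemma act_measurable: "(\<lambda>x. x #>\<^bsub>PSL2C\<^esub> h) \<in> \<mu> \<rightarrow>\<^sub>M \<mu>"
  using measurable_act_const measurable_cong_sets[OF sets_mu sets_mu] by blast

lemma act_joint_measurable:
  fixes h :: "'p::{second_countable_topology} \<Rightarrow> complex^2^2"
  assumes "continuous_on UNIV h" "\<And>t. h t \<in> SL"
  shows "(\<lambda>(x, t). x #>\<^bsub>PSL2C\<^esub> abs_psl2c (h t)) \<in> \<mu> \<Otimes>\<^sub>M borel \<rightarrow>\<^sub>M \<mu>"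
  using measurable_act[OF assms] measurable_cong_sets[OF sets_pair_measure_cong[OF sets_mu refl] sets_mu] by blast

lemma returning_sets: "returning k \<in> sets \<mu>"
proof -
  have "returning k = (\<Inter>s::nat. (\<lambda>x. x #>\<^bsub>PSL2C\<^esub> a_elt (- real s)) -` (pr ` norm_ball k) \<inter> space \<mu>)"
    by (auto simp: returning_def)
  moreover have "\<dots> \<in> sets \<mu>"
    using measurable_sets[OF act_measurable norm_ball_sets] by (intro sets.countable_INT) auto
  ultimately show ?thesis by (simp only:)
qed

lemma act_comp: "x \<in> space \<mu> \<Longrightarrow> (x #>\<^bsub>PSL2C\<^esub> g) #>\<^bsub>PSL2C\<^esub> h = x #>\<^bsub>PSL2C\<^esub> psl_mult g h"
  by (auto simp: space_mu pr_act psl_assoc)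

lemma act_space: "x \<in> space \<mu> \<Longrightarrow> x #>\<^bsub>PSL2C\<^esub> g \<in> space \<mu>"
  by (auto simp: space_mu pr_act)

text \<open>The double integral J over X and the square Q is evaluated in both orders. With x
  outside, \<open>slice\<close> bounds it from above; with p outside, invariance makes it exactly
  \<mu>(Y) times the area 4 R^2. A factor 1/2 is dropped in the final bound.\<close>

lemma transient_null_estimate:
  assumes Y: "Y \<in> sets \<mu>" "Y \<subseteq> returning k" and N: "N \<ge> 0"
    and trans: "\<And>x. x \<in> space \<mu> \<Longrightarrow> (\<integral>\<^sup>+t. indicator Y (x #>\<^bsub>PSL2C\<^esub> u_elt t) \<partial>(lborel :: real measure)) \<le> ennreal N"
    and k': "\<And>g t u. g \<in> norm_ball k \<Longrightarrow> \<bar>t\<bar> \<le> 1 \<Longrightarrow> \<bar>u\<bar> \<le> 1 \<Longrightarrow> psl_mult g (n_elt (Complex t u)) \<in> norm_ball k'"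
  shows "emeasure \<mu> Y \<le> ennreal (N * measure \<mu> (pr ` norm_ball k') * exp ((1 - \<delta>) * real s))"
proof -
  interpret sigma_finite_measure \<mu> by (rule sigma_finite_mu)
  interpret pair_sigma_finite \<mu> "lborel :: (real \<times> real) measure" ..
  define R where "R = exp (real s)"
  have R: "R > 0" by (simp add: R_def)
  define Q where "Q = {-R..R} \<times> {-R..R}"
  define W where "W = pr ` norm_ball k'"
  let ?a = "a_elt (- real s)"
  \<comment> \<open>The first coordinate is transversal and the second runs along U, so the inner
    integral of the product measure is an orbit integral.\<close>
  define n where "n p = n_elt (Complex (snd p) (fst p))" for p
  have W: "W \<in> sets \<mu>" unfolding W_def by (rule norm_ball_sets)
  define m where "m = measure \<mu> W"
  have m: "emeasure \<mu> W = ennreal m" "m \<ge> 0"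
    using emeasure_fin[OF norm_ball_subset] by (simp_all add: W_def m_def emeasure_eq_ennreal_measure less_top)
  have "(\<lambda>(x, p). x #>\<^bsub>PSL2C\<^esub> n p) \<in> \<mu> \<Otimes>\<^sub>M borel \<rightarrow>\<^sub>M \<mu>"
    unfolding n_def n_elt_abs by (rule act_joint_measurable) (auto intro!: continuous_intros)
  then have joint: "(\<lambda>(x, p). indicator Y (x #>\<^bsub>PSL2C\<^esub> n p) :: ennreal) \<in> borel_measurable (\<mu> \<Otimes>\<^sub>M borel)"
    using measurable_compose[OF _ borel_measurable_indicator[OF Y(1)]] by (simp add: case_prod_unfold)
  have Q: "Q \<in> sets borel" unfolding Q_def by (intro borel_closed closed_Times) auto
  have \<chi>: "(\<lambda>x. indicator W (x #>\<^bsub>PSL2C\<^esub> h) :: ennreal) \<in> borel_measurable \<mu>" for h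
    using measurable_compose[OF act_measurable borel_measurable_indicator[OF W]] .
  define J where "J = (\<integral>\<^sup>+x. \<integral>\<^sup>+p. indicator W (x #>\<^bsub>PSL2C\<^esub> ?a) * (indicator Y (x #>\<^bsub>PSL2C\<^esub> n p) * indicator Q p) \<partial>lborel \<partial>\<mu>)"
  have slice: "(\<integral>\<^sup>+p. indicator Y (x #>\<^bsub>PSL2C\<^esub> n p) * indicator Q p \<partial>lborel) \<le> ennreal (2 * R * N)" if x: "x \<in> space \<mu>" for x
  proof -
    have mp: "(\<lambda>p. indicator Y (x #>\<^bsub>PSL2C\<^esub> n p) :: ennreal) \<in> borel_measurable borel"
      using measurable_compose[OF measurable_Pair1'[OF x] joint] by simp
    have "(\<integral>\<^sup>+p. indicator Y (x #>\<^bsub>PSL2C\<^esub> n p) * indicator Q p \<partial>lborel) =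
        (\<integral>\<^sup>+p. indicator Y (x #>\<^bsub>PSL2C\<^esub> n p) * indicator Q p \<partial>(lborel \<Otimes>\<^sub>M lborel))"
      by (simp add: lborel_prod)
    also have "\<dots> = (\<integral>\<^sup>+u. \<integral>\<^sup>+t. indicator Y (x #>\<^bsub>PSL2C\<^esub> n (u, t)) * indicator Q (u, t) \<partial>lborel \<partial>lborel)"
      using mp Q by (intro lborel.nn_integral_fst[symmetric]) (simp add: lborel_prod)
    also have "\<dots> \<le> (\<integral>\<^sup>+u. ennreal N * indicator {-R..R} u \<partial>lborel)"
    proof (rule nn_integral_mono)
      fix u :: real
      have "(\<integral>\<^sup>+t. indicator Y (x #>\<^bsub>PSL2C\<^esub> n (u, t)) * indicator Q (u, t) \<partial>lborel) \<le>
          (\<integral>\<^sup>+t. indicator Y ((x #>\<^bsub>PSL2C\<^esub> n_elt (Complex 0 u)) #>\<^bsub>PSL2C\<^esub> u_elt t) * indicator {-R..R} u \<partial>lborel)"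
      proof (rule nn_integral_mono)
        fix t :: real
        have "Complex 0 u + of_real t = Complex t u" by (simp add: complex_eq_iff)
        then have "x #>\<^bsub>PSL2C\<^esub> n (u, t) = (x #>\<^bsub>PSL2C\<^esub> n_elt (Complex 0 u)) #>\<^bsub>PSL2C\<^esub> u_elt t"
          by (simp add: act_comp[OF x] u_elt_def n_elt_add n_def)
        then show "indicator Y (x #>\<^bsub>PSL2C\<^esub> n (u, t)) * indicator Q (u, t) \<le>
            (indicator Y ((x #>\<^bsub>PSL2C\<^esub> n_elt (Complex 0 u)) #>\<^bsub>PSL2C\<^esub> u_elt t) * indicator {-R..R} u :: ennreal)"
          by (cases "u \<in> {-R..R}") (auto simp: Q_def indicator_def)
      qed
      also have "\<dots> \<le> ennreal N * indicator {-R..R} u"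
        using trans[OF act_space[OF x], of "n_elt (Complex 0 u)"] by (simp add: indicator_def)
      finally show "(\<integral>\<^sup>+t. indicator Y (x #>\<^bsub>PSL2C\<^esub> n (u, t)) * indicator Q (u, t) \<partial>lborel) \<le> ennreal N * indicator {-R..R} u" .
    qed
    also have "\<dots> = ennreal (2 * R * N)"
      using R N by (simp add: nn_integral_cmult_indicator mult.commute flip: ennreal_mult)
    finally show ?thesis .
  qed
  have "J = (\<integral>\<^sup>+x. indicator W (x #>\<^bsub>PSL2C\<^esub> ?a) * (\<integral>\<^sup>+p. indicator Y (x #>\<^bsub>PSL2C\<^esub> n p) * indicator Q p \<partial>lborel) \<partial>\<mu>)"
    unfolding J_def
  proof (rule nn_integral_cong)
    fix x assume x: "x \<in> space \<mu>"
    have mp: "(\<lambda>p. indicator Y (x #>\<^bsub>PSL2C\<^esub> n p) :: ennreal) \<in> borel_measurable borel"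
      using measurable_compose[OF measurable_Pair1'[OF x] joint] by simp
    show "(\<integral>\<^sup>+p. indicator W (x #>\<^bsub>PSL2C\<^esub> ?a) * (indicator Y (x #>\<^bsub>PSL2C\<^esub> n p) * indicator Q p) \<partial>lborel) =
        indicator W (x #>\<^bsub>PSL2C\<^esub> ?a) * (\<integral>\<^sup>+p. indicator Y (x #>\<^bsub>PSL2C\<^esub> n p) * indicator Q p \<partial>lborel)"
      using mp Q by (intro nn_integral_cmult) simp
  qed
  also have "\<dots> \<le> (\<integral>\<^sup>+x. indicator W (x #>\<^bsub>PSL2C\<^esub> ?a) * ennreal (2 * R * N) \<partial>\<mu>)"
    by (intro nn_integral_mono mult_left_mono slice) auto
  also have "\<dots> = (\<integral>\<^sup>+x. indicator W (x #>\<^bsub>PSL2C\<^esub> ?a) \<partial>\<mu>) * ennreal (2 * R * N)"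
    by (rule nn_integral_multc[OF \<chi>])
  also have "(\<integral>\<^sup>+x. indicator W (x #>\<^bsub>PSL2C\<^esub> ?a) \<partial>\<mu>) = ennreal (exp ((\<delta> - 2) * (- real s))) * ennreal m"
    using nn_integral_a[OF borel_measurable_indicator[OF W], of "- real s"] W m by simp
  also have "ennreal (exp ((\<delta> - 2) * (- real s))) * ennreal m * ennreal (2 * R * N) =
      ennreal (exp ((\<delta> - 2) * (- real s)) * m * (2 * R * N))"
    using m R N by (simp add: ennreal_mult)
  finally have upper: "J \<le> ennreal (exp ((\<delta> - 2) * (- real s)) * m * (2 * R * N))" .
  have jm: "(\<lambda>(x, p). indicator W (x #>\<^bsub>PSL2C\<^esub> ?a) * (indicator Y (x #>\<^bsub>PSL2C\<^esub> n p) * indicator Q p) :: ennreal)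
      \<in> borel_measurable (\<mu> \<Otimes>\<^sub>M lborel)"
  proof -
    have 1: "(\<lambda>z. indicator W (fst z #>\<^bsub>PSL2C\<^esub> ?a) :: ennreal) \<in> borel_measurable (\<mu> \<Otimes>\<^sub>M lborel)"
      by (rule measurable_compose[OF measurable_fst \<chi>])
    have 2: "(\<lambda>z. indicator Y (fst z #>\<^bsub>PSL2C\<^esub> n (snd z)) :: ennreal) \<in> borel_measurable (\<mu> \<Otimes>\<^sub>M lborel)"
      using joint measurable_cong_sets[OF sets_pair_measure_cong[OF refl sets_lborel] refl] by (auto simp: case_prod_unfold)
    have 3: "(\<lambda>z. indicator Q (snd z) :: ennreal) \<in> borel_measurable (\<mu> \<Otimes>\<^sub>M lborel)"
      using Q by (intro measurable_compose[OF measurable_snd] borel_measurable_indicator) simp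
    show ?thesis unfolding case_prod_unfold by (intro borel_measurable_times_ennreal 1 2 3)
  qed
  have "J = (\<integral>\<^sup>+p. \<integral>\<^sup>+x. indicator W (x #>\<^bsub>PSL2C\<^esub> ?a) * (indicator Y (x #>\<^bsub>PSL2C\<^esub> n p) * indicator Q p) \<partial>\<mu> \<partial>lborel)"
    unfolding J_def using Fubini'[OF jm] by simp
  also have "\<dots> = (\<integral>\<^sup>+p. emeasure \<mu> Y * indicator Q p \<partial>lborel)"
  proof (rule nn_integral_cong)
    fix p :: "real \<times> real"
    let ?np = "n_elt (- Complex (snd p) (fst p))"
    \<comment> \<open>The integrand after the substitution x to x n_{-p}. It equals the indicator of
      Y, because the factor with W is 1 on Y.\<close>
    define f where "f x = indicator W ((x #>\<^bsub>PSL2C\<^esub> ?np) #>\<^bsub>PSL2C\<^esub> ?a) * (indicator Y x :: ennreal)" for x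
    have f: "f \<in> borel_measurable \<mu>"
      unfolding f_def using Y(1) by (intro borel_measurable_times_ennreal measurable_compose[OF act_measurable \<chi>]) simp
    show "(\<integral>\<^sup>+x. indicator W (x #>\<^bsub>PSL2C\<^esub> ?a) * (indicator Y (x #>\<^bsub>PSL2C\<^esub> n p) * indicator Q p) \<partial>\<mu>) =
        emeasure \<mu> Y * indicator Q p"
    proof (cases "p \<in> Q")
      case True
      have "(\<integral>\<^sup>+x. indicator W (x #>\<^bsub>PSL2C\<^esub> ?a) * (indicator Y (x #>\<^bsub>PSL2C\<^esub> n p) * indicator Q p) \<partial>\<mu>) =
          (\<integral>\<^sup>+x. f (x #>\<^bsub>PSL2C\<^esub> n p) \<partial>\<mu>)"
        using True by (intro nn_integral_cong)
          (simp add: f_def act_comp act_space n_def n_elt_add psl_assoc del: n_elt_0, simp add: act_comp n_elt_add)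
      also have "\<dots> = (\<integral>\<^sup>+x. f x \<partial>\<mu>)" unfolding n_def by (rule nn_integral_n[OF f])
      also have "\<dots> = (\<integral>\<^sup>+x. indicator Y x \<partial>\<mu>)"
      proof (rule nn_integral_cong)
        fix x assume x: "x \<in> space \<mu>"
        show "f x = indicator Y x"
        proof (cases "x \<in> Y")
          case xY: True
          then have "x #>\<^bsub>PSL2C\<^esub> ?a \<in> pr ` norm_ball k"
            using Y(2) unfolding returning_def by blast
          then obtain g where g: "g \<in> norm_ball k" "x #>\<^bsub>PSL2C\<^esub> ?a = pr g" by blast
          \<comment> \<open>The displacement -p contracted by R = exp s, which brings it into the
            box of \<open>norm_ball_mult_box\<close>.\<close>
          define t u where "t = - (snd p / R)" and "u = - (fst p / R)"
          have "\<bar>t\<bar> \<le> 1" "\<bar>u\<bar> \<le> 1" using True R by (auto simp: Q_def t_def u_def abs_le_iff field_simps)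
          then have "psl_mult g (n_elt (Complex t u)) \<in> norm_ball k'" using k' g by blast
          moreover have "exp (- real s) *\<^sub>R (- Complex (snd p) (fst p)) = Complex t u"
            by (simp add: complex_eq_iff t_def u_def R_def exp_minus field_simps)
          then have "(x #>\<^bsub>PSL2C\<^esub> ?np) #>\<^bsub>PSL2C\<^esub> ?a = (x #>\<^bsub>PSL2C\<^esub> ?a) #>\<^bsub>PSL2C\<^esub> n_elt (Complex t u)"
            by (simp add: act_comp[OF x] n_a_elt)
          ultimately have "(x #>\<^bsub>PSL2C\<^esub> ?np) #>\<^bsub>PSL2C\<^esub> ?a \<in> W"
            by (simp add: W_def g(2) pr_act)
          then show ?thesis using xY by (simp add: f_def)
        qed (simp add: f_def)
      qed
      finally show ?thesis using Y(1) True by simp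
    qed simp
  qed
  also have "\<dots> = emeasure \<mu> Y * emeasure lborel Q"
    using Q by (simp add: nn_integral_cmult_indicator)
  also have "emeasure lborel Q = ennreal (4 * R * R)"
  proof -
    have "emeasure lborel Q = emeasure (lborel \<Otimes>\<^sub>M lborel) ({-R..R} \<times> {-R..R})" by (simp add: lborel_prod Q_def)
    also have "\<dots> = emeasure lborel {-R..R} * emeasure lborel {-R..R}"
      by (intro lborel.emeasure_pair_measure_Times) auto
    also have "\<dots> = ennreal (4 * R * R)" using R by (simp flip: ennreal_mult)
    finally show ?thesis .
  qed
  finally have lower: "emeasure \<mu> Y * ennreal (4 * R * R) \<le> ennreal (exp ((\<delta> - 2) * (- real s)) * m * (2 * R * N))"
    using upper by simp
  have "emeasure \<mu> Y = emeasure \<mu> Y * ennreal (4 * R * R) * ennreal (1 / (4 * R * R))"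
    using R by (simp add: mult.assoc flip: ennreal_mult)
  also have "\<dots> \<le> ennreal (exp ((\<delta> - 2) * (- real s)) * m * (2 * R * N)) * ennreal (1 / (4 * R * R))"
    using lower by (rule mult_right_mono) simp
  also have "\<dots> = ennreal (exp ((\<delta> - 2) * (- real s)) * m * (2 * R * N) * (1 / (4 * R * R)))"
    using R m N by (simp flip: ennreal_mult)
  also have "\<dots> \<le> ennreal (N * m * exp ((1 - \<delta>) * real s))"
  proof (rule ennreal_leI)
    \<comment> \<open>One factor R is split off; with the R of the slice bound it cancels the area
      R^2.\<close>
    have "exp ((\<delta> - 2) * (- real s)) = exp ((1 - \<delta>) * real s) * R"
      by (simp add: R_def algebra_simps flip: exp_add)
    then have "exp ((\<delta> - 2) * (- real s)) * m * (2 * R * N) * (1 / (4 * R * R)) = (N * m * exp ((1 - \<delta>) * real s)) / 2"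
      using R by (simp add: field_simps)
    also have "\<dots> \<le> N * m * exp ((1 - \<delta>) * real s)" using N m by simp
    finally show "exp ((\<delta> - 2) * (- real s)) * m * (2 * R * N) * (1 / (4 * R * R)) \<le> N * m * exp ((1 - \<delta>) * real s)" .
  qed
  finally show ?thesis by (simp add: m_def W_def)
qed

lemma transient_null:
  assumes \<delta>: "\<delta> > 1" and Y: "Y \<in> sets \<mu>" "Y \<subseteq> returning k" and N: "N \<ge> 0"
    and trans: "\<And>x. x \<in> space \<mu> \<Longrightarrow> (\<integral>\<^sup>+t. indicator Y (x #>\<^bsub>PSL2C\<^esub> u_elt t) \<partial>(lborel :: real measure)) \<le> ennreal N"
  shows "emeasure \<mu> Y = 0"
proof -
  obtain k' where k': "\<And>g t u. g \<in> norm_ball k \<Longrightarrow> \<bar>t\<bar> \<le> 1 \<Longrightarrow> \<bar>u\<bar> \<le> 1 \<Longrightarrow> psl_mult g (n_elt (Complex t u)) \<in> norm_ball k'"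
    using norm_ball_mult_box[of k] by metis
  define c where "c = N * measure \<mu> (pr ` norm_ball k')"
  have "(\<lambda>s. ennreal (c * exp ((1 - \<delta>) * real s))) \<longlonglongrightarrow> ennreal 0"
  proof (rule tendsto_ennrealI)
    have "(\<lambda>s. c * exp (1 - \<delta>) ^ s) \<longlonglongrightarrow> c * 0"
      using \<delta> by (intro tendsto_mult tendsto_const LIMSEQ_power_zero) simp
    then show "(\<lambda>s. c * exp ((1 - \<delta>) * real s)) \<longlonglongrightarrow> 0"
      by (simp add: exp_of_nat_mult[symmetric] mult.commute)
  qed
  moreover have "emeasure \<mu> Y \<le> ennreal (c * exp ((1 - \<delta>) * real s))" for s
    unfolding c_def by (rule transient_null_estimate[OF Y N trans k'])
  ultimately have "emeasure \<mu> Y \<le> ennreal 0" by (intro LIMSEQ_le_const) auto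
  then show ?thesis by simp
qed

end

theorem theorem6p7:
  fixes \<Gamma> :: "psl2c set"
    and \<nu> :: "complex \<times> real \<Rightarrow> complex option measure"
    and m\<^sub>B\<^sub>R :: "psl2c set measure"
  assumes "discrete_subgroup \<Gamma>" and "torsion_free \<Gamma>" and "non_elementary \<Gamma>"
    and "convex_cocompact \<Gamma>"
    and "critical_exponent \<Gamma> > 1"
    and "PS_density \<Gamma> \<nu>"
    and "is_BR_measure \<Gamma> \<nu> m\<^sub>B\<^sub>R"
  shows "U_conservative m\<^sub>B\<^sub>R"
proof -
  interpret ps_br \<Gamma> \<nu> "m\<^sub>B\<^sub>R" by unfold_locales (use assms in auto)
  let ?\<mu> = "m\<^sub>B\<^sub>R"
  show ?thesis
    unfolding U_conservative_def
  proof (intro ballI impI)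
    fix B assume B: "B \<in> sets ?\<mu>"
    define I where "I x = (\<integral>\<^sup>+t. indicator B (x #>\<^bsub>PSL2C\<^esub> u_elt t) \<partial>(lborel :: real measure))" for x
    have "(\<lambda>(x, t). x #>\<^bsub>PSL2C\<^esub> u_elt t) \<in> ?\<mu> \<Otimes>\<^sub>M borel \<rightarrow>\<^sub>M ?\<mu>"
      unfolding u_elt_def n_elt_abs by (rule act_joint_measurable) (auto intro!: continuous_intros)
    then have joint: "(\<lambda>(x, t). indicator B (x #>\<^bsub>PSL2C\<^esub> u_elt t) :: ennreal) \<in> borel_measurable (?\<mu> \<Otimes>\<^sub>M borel)"
      using measurable_compose[OF _ borel_measurable_indicator[OF B]] by (simp add: case_prod_unfold)
    then have "(\<lambda>(x, t). indicator B (x #>\<^bsub>PSL2C\<^esub> u_elt t) :: ennreal) \<in> borel_measurable (?\<mu> \<Otimes>\<^sub>M lborel)"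
      using measurable_cong_sets[OF sets_pair_measure_cong[OF refl sets_lborel] refl] by blast
    then have I_meas: "I \<in> borel_measurable ?\<mu>"
      unfolding I_def using lborel.borel_measurable_nn_integral by simp
    \<comment> \<open>Every point of B with finite return time that is returning for some k lies in
      one of these countably many sets, so it suffices that each is null.\<close>
    define Y where "Y N k = {x \<in> space ?\<mu>. I x \<le> ennreal (real N)} \<inter> (B \<inter> returning k)" for N k :: nat
    have Y_sets: "Y N k \<in> sets ?\<mu>" for N k
      unfolding Y_def using I_meas B returning_sets by (intro sets.Int borel_measurable_le) auto
    have "emeasure ?\<mu> (Y N k) = 0" for N k
    proof (rule transient_null[OF assms(5) Y_sets])
      show "Y N k \<subseteq> returning k" by (auto simp: Y_def)
      fix x assume x: "x \<in> space ?\<mu>"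
      show "(\<integral>\<^sup>+t. indicator (Y N k) (x #>\<^bsub>PSL2C\<^esub> u_elt t) \<partial>(lborel :: real measure)) \<le> ennreal (real N)"
      proof (cases "\<exists>t. x #>\<^bsub>PSL2C\<^esub> u_elt t \<in> Y N k")
        case True
        \<comment> \<open>The bound on I is known only at points of Y, but I is constant along
          U-orbits; an orbit meeting Y inherits it, and any other orbit spends no time
          there.\<close>
        then obtain t0 where t0: "x #>\<^bsub>PSL2C\<^esub> u_elt t0 \<in> Y N k" by auto
        have mt: "(\<lambda>t. indicator B (x #>\<^bsub>PSL2C\<^esub> u_elt t) :: ennreal) \<in> borel_measurable borel"
          using measurable_compose[OF measurable_Pair1'[OF x] joint] by simp
        have "(\<integral>\<^sup>+t. indicator (Y N k) (x #>\<^bsub>PSL2C\<^esub> u_elt t) \<partial>(lborel :: real measure)) \<le>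
            (\<integral>\<^sup>+t. indicator B (x #>\<^bsub>PSL2C\<^esub> u_elt t) \<partial>(lborel :: real measure))"
          by (intro nn_integral_mono) (auto simp: Y_def indicator_def)
        also have "\<dots> = (\<integral>\<^sup>+t. indicator B (x #>\<^bsub>PSL2C\<^esub> u_elt (t0 + t)) \<partial>(lborel :: real measure))"
          using nn_integral_real_affine[OF mt, of 1 t0] by simp
        also have "\<dots> = I (x #>\<^bsub>PSL2C\<^esub> u_elt t0)"
          by (simp add: I_def act_comp[OF x] u_elt_def n_elt_add)
        also have "\<dots> \<le> ennreal (real N)" using t0 by (simp add: Y_def)
        finally show ?thesis .
      qed simp
    qed simp
    then have "AE x in ?\<mu>. x \<notin> Y N k" for N k
      using Y_sets by (intro AE_not_in) auto
    then have "AE x in ?\<mu>. \<forall>N k. x \<notin> Y N k" by (simp add: AE_all_countable)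
    moreover have "AE x in ?\<mu>. \<exists>k. x \<in> returning k"
      using AE_limit_set AE_space
    proof eventually_elim
      case (elim x)
      then obtain g where g: "x = pr g" "moebius g (Some 0) \<in> limit_set \<Gamma>" by (auto simp: space_mu)
      have "\<exists>\<eta>\<in>limit_set \<Gamma>. \<eta> \<noteq> \<xi>" for \<xi>
        using assms(5) by (intro limit_set_two_points assms(2,3)) simp
      from conical[OF assms(4) this g(2)] show ?case
        using elim(2) by (auto simp: returning_def g(1) pr_act)
    qed
    ultimately show "AE x in ?\<mu>. x \<in> B \<longrightarrow>
        (\<integral>\<^sup>+t. indicator B (x #>\<^bsub>PSL2C\<^esub> u_elt t) \<partial>(lborel :: real measure)) = \<infinity>"
      unfolding I_def[symmetric]
    proof eventually_elim
      case (elim x)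
      show ?case
      proof (intro impI, rule ccontr)
        assume "x \<in> B" "I x \<noteq> \<infinity>"
        then obtain r where r: "I x = ennreal r" by (cases "I x") auto
        obtain N :: nat where "r \<le> real N" using real_arch_simple by auto
        then have "I x \<le> ennreal (real N)" by (simp add: r ennreal_leI)
        then show False
          using elim \<open>x \<in> B\<close> sets.sets_into_space[OF B] by (auto simp: Y_def)
      qed
    qed
  qed
qed

end
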